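(* Let $\mathcal{M}=(M_k)_{k\ge0}$ be a regular sequence. Let $\Omega=\Omega'\times I\subset\mathbb{R}^N\times\mathbb{R}$ be an open neighborhood of the origin and let $\Omega''\subset\mathbb{C}^{N+1}$ be an open set. Let $f(x,t,\zeta_0,\zeta)$ be of class $\mathcal{C}^{\mathcal{M}}$ with respect to $(x,t)\in\Omega$ and holomorphic with respect to $(\zeta_0,\zeta)\in\Omega''$, and let $u\in\mathcal{C}^2(\Omega)$ be a solution of $$u_t=f(x,t,u,u_x)$$ (with $(u(x,t),u_x(x,t))\in\Omega''$ for $(x,t)\in\Omega$). Let $L^u$ be the linearized operator $$L^u=\frac{\partial}{\partial t}-\sum_{j=1}^N\frac{\partial f}{\partial\zeta_j}(x,t,u,u_x)\frac{\partial}{\partial x_j}.$$ Then for each open set $U\Subset\Omega'$ there exist $\mathcal{C}^1$ functions $Z_j(x,t)$, $j=1,\dots,N$, and $\Psi(x,t)$ that are $(\mathcal{M},t)$-approximate solutions of $L^u$ on $U\times\mathbb{R}$ with initial data $x_j$ and $u_0=u(\cdot,0)$, respectively.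
   Context: Regular sequence: a sequence $\mathcal{M}=(M_k)_{k\ge0}$ of positive reals such that, with $m_k=M_k/k!$: (a) $m_0=m_1=1$; (b) $m_k^2\le m_{k-1}m_{k+1}$ for $k\ge1$; (c) $\sup_{k\ge 1}(m_{k+1}/m_k)^{1/k}<\infty$; (d) $\lim_{k\to\infty}m_k^{1/k}=\infty$. For $r>0$, $h(r)=\inf_{k\in\mathbb{Z}_+}m_kr^k$. $I$ is an open interval containing $0$ and $\Omega'\subset\mathbb{R}^N$ is open. A function $f$ on $\Omega\times\Omega''$ is of class $\mathcal{C}^{\mathcal{M}}$ in $(x,t)$ and holomorphic in $(\zeta_0,\zeta)$ if it is $\mathcal{C}^\infty$, holomorphic in $(\zeta_0,\zeta)$, and for each compact $K\subset\Omega\times\Omega''$ there is $A>0$ with $\sup_K|\partial_{(x,t)}^\alpha f|\le A^{|\alpha|+1}M_{|\alpha|}$ for all $\alpha\in\mathbb{Z}_+^{N+1}$. $(\mathcal{M},t)$-approximate solution: given a vector field $L=\partial_t+\sum_j a_j(x,t)\partial_{x_j}$ with $\mathcal{C}^1$ complex coefficients defined for $x\in U$ and $t$ in an interval about $0$, and $u_0\in\mathcal{C}^1(U)$, an $(\mathcal{M},t)$-approximate solution of $L$ on $U\times\mathbb{R}$ with initial datum $u_0$ is a function $v\in\mathcal{C}^1(U\times\mathbb{R})$ such that $v(x,0)=u_0(x)$ for $x\in U$, and for every compact $K\subset U$ there are $A,\gamma,\delta>0$ with $\sup_{x\in K}|Lv(x,t)|\le A\,h(\gamma|t|)$ for $0<|t|\le\delta$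 (only small $|t|$, for which $L$ is defined, are involved, i.e. $\delta$ is taken with $[-\delta,\delta]$ in that interval). *)

theory Defs
  imports "HOL-Analysis.Analysis"
begin

section \<open>Partial derivatives and classes of differentiability\<close>

definition pderivative :: "'a::real_normed_vector \<Rightarrow> ('a \<Rightarrow> 'b::real_normed_vector) \<Rightarrow> 'a \<Rightarrow> 'b" where
  "pderivative b g p = vector_derivative (\<lambda>s. g (p + s *\<^sub>R b)) (at 0)"

text \<open>A multi-index is encoded by a list of coordinate directions, in which each direction occurs
  as often as its exponent; the length of the list is the order of the multi-index. The order of
  the entries does not matter for smooth functions.\<close>

definition iter_pderivative :: "'a list \<Rightarrow> ('a::real_normed_vector \<Rightarrow> 'b::real_normed_vector) \<Rightarrow> 'a \<Rightarrow> 'b" where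
  "iter_pderivative bs g = foldr pderivative bs g"

text \<open>This is only meant for open sets \<^term>\<open>S\<close>.\<close>

fun Ck_on :: "nat \<Rightarrow> ('a::euclidean_space \<Rightarrow> 'b::real_normed_vector) \<Rightarrow> 'a set \<Rightarrow> bool" where
  "Ck_on 0 g S \<longleftrightarrow> continuous_on S g"
| "Ck_on (Suc k) g S \<longleftrightarrow>
     (\<forall>p\<in>S. g differentiable (at p)) \<and> (\<forall>b\<in>Basis. Ck_on k (pderivative b g) S)"

definition smooth_on :: "('a::euclidean_space \<Rightarrow> 'b::real_normed_vector) \<Rightarrow> 'a set \<Rightarrow> bool" where
  "smooth_on g S \<longleftrightarrow> (\<forall>k. Ck_on k g S)"

text \<open>Holomorphy in several variables \<open>(\<zeta>\<^sub>0, \<zeta>)\<close> on an open set: at each point there is a Frechet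
  derivative that is linear over the complex numbers.\<close>

definition multi_holomorphic_on :: "(complex \<times> (complex^'n) \<Rightarrow> complex) \<Rightarrow> (complex \<times> (complex^'n)) set \<Rightarrow> bool" where
  "multi_holomorphic_on g S \<longleftrightarrow>
     (\<forall>z\<in>S. \<exists>D. (g has_derivative D) (at z) \<and> (\<forall>c w\<^sub>0 w. D (c * w\<^sub>0, c *s w) = c * D (w\<^sub>0, w)))"

section \<open>Regular sequences\<close>

definition normalized :: "(nat \<Rightarrow> real) \<Rightarrow> nat \<Rightarrow> real" where
  "normalized M k = M k / fact k"

definition regular_sequence :: "(nat \<Rightarrow> real) \<Rightarrow> bool" where
  "regular_sequence M \<longleftrightarrow>
     (\<forall>k. M k > 0) \<and>
     normalized M 0 = 1 \<and> normalized M 1 = 1 \<and>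
     (\<forall>k\<ge>1. (normalized M k)\<^sup>2 \<le> normalized M (k - 1) * normalized M (k + 1)) \<and>
     bdd_above ((\<lambda>k. (normalized M (k + 1) / normalized M k) powr (1 / real k)) ` {1..}) \<and>
     filterlim (\<lambda>k. normalized M k powr (1 / real k)) at_top sequentially"

definition h_fun :: "(nat \<Rightarrow> real) \<Rightarrow> real \<Rightarrow> real" where
  "h_fun M r = (INF k. normalized M k * r ^ k)"

text \<open>\<^term>\<open>f ((x, t), (\<zeta>\<^sub>0, \<zeta>))\<close> is of class \<open>C\<^sup>M\<close> in \<^term>\<open>(x, t)\<close> and holomorphic in the remaining
  variables; only derivatives in \<^term>\<open>(x, t)\<close> are estimated.\<close>

definition CM_holomorphic_on ::
  "(nat \<Rightarrow> real) \<Rightarrow> (((real^'n) \<times> real) \<times> (complex \<times> (complex^'n)) \<Rightarrow> complex) \<Rightarrow>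
   ((real^'n) \<times> real) set \<Rightarrow> (complex \<times> (complex^'n)) set \<Rightarrow> bool" where
  "CM_holomorphic_on M f \<Omega> \<Omega>'' \<longleftrightarrow>
     smooth_on f (\<Omega> \<times> \<Omega>'') \<and>
     (\<forall>p\<in>\<Omega>. multi_holomorphic_on (\<lambda>z. f (p, z)) \<Omega>'') \<and>
     (\<forall>K. compact K \<and> K \<subseteq> \<Omega> \<times> \<Omega>'' \<longrightarrow>
        (\<exists>A>0. \<forall>bs. set bs \<subseteq> Basis \<longrightarrow>
           (\<forall>(p, z)\<in>K. cmod (iter_pderivative bs (\<lambda>q. f (q, z)) p)
                          \<le> A ^ (length bs + 1) * M (length bs))))"

section \<open>Vector fields and approximate solutions\<close>

abbreviation dt :: "((real^'n) \<times> real \<Rightarrow> complex) \<Rightarrow> (real^'n) \<times> real \<Rightarrow> complex" where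
  "dt \<equiv> pderivative (0, 1)"

abbreviation dx :: "'n \<Rightarrow> ((real^'n) \<times> real \<Rightarrow> complex) \<Rightarrow> (real^'n) \<times> real \<Rightarrow> complex" where
  "dx j \<equiv> pderivative (axis j 1, 0)"

definition grad_x :: "((real^'n) \<times> real \<Rightarrow> complex) \<Rightarrow> (real^'n) \<times> real \<Rightarrow> complex^'n" where
  "grad_x u p = (\<chi> j. dx j u p)"

text \<open>The operator \<open>\<partial>\<^sub>t + \<Sum>\<^sub>j a\<^sub>j \<partial>\<^sub>x\<^sub>j\<close>.\<close>

definition vector_field ::
  "('n \<Rightarrow> (real^'n) \<times> real \<Rightarrow> complex) \<Rightarrow> ((real^'n) \<times> real \<Rightarrow> complex) \<Rightarrow> (real^'n) \<times> real \<Rightarrow> complex" where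
  "vector_field a v p = dt v p + (\<Sum>j\<in>UNIV. a j p * dx j v p)"

text \<open>\<open>(M, t)\<close>-approximate solutions on \<open>U \<times> \<real>\<close> with initial datum \<open>u\<^sub>0\<close>, for the vector field with
  coefficients \<open>a\<close> defined on \<open>U \<times> I\<close>. The first two conditions are the standing requirements on
  the vector field and on the datum.\<close>

definition approximate_solution ::
  "(nat \<Rightarrow> real) \<Rightarrow> ('n \<Rightarrow> (real^'n) \<times> real \<Rightarrow> complex) \<Rightarrow> (real^'n) set \<Rightarrow> real set \<Rightarrow>
   (real^'n \<Rightarrow> complex) \<Rightarrow> ((real^'n) \<times> real \<Rightarrow> complex) \<Rightarrow> bool" where
  "approximate_solution M a U I u\<^sub>0 v \<longleftrightarrow>
     (\<forall>j. Ck_on 1 (a j) (U \<times> I)) \<and>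
     Ck_on 1 u\<^sub>0 U \<and>
     Ck_on 1 v (U \<times> UNIV) \<and>
     (\<forall>x\<in>U. v (x, 0) = u\<^sub>0 x) \<and>
     (\<forall>K. compact K \<and> K \<subseteq> U \<longrightarrow>
        (\<exists>A>0. \<exists>\<gamma>>0. \<exists>\<delta>>0. {-\<delta>..\<delta>} \<subseteq> I \<and>
           (\<forall>x\<in>K. \<forall>t. 0 < \<bar>t\<bar> \<and> \<bar>t\<bar> \<le> \<delta> \<longrightarrow>
              cmod (vector_field a v (x, t)) \<le> A * h_fun M (\<gamma> * \<bar>t\<bar>))))"

text \<open>The complex partial derivative of \<^term>\<open>f\<close> in the variable \<open>\<zeta>\<^sub>j\<close>.\<close>

definition dzeta ::
  "'n \<Rightarrow> (((real^'n) \<times> real) \<times> (complex \<times> (complex^'n)) \<Rightarrow> complex) \<Rightarrow>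
   ((real^'n) \<times> real) \<times> (complex \<times> (complex^'n)) \<Rightarrow> complex" where
  "dzeta j f = (\<lambda>(p, (\<zeta>\<^sub>0, \<zeta>)). deriv (\<lambda>w. f (p, (\<zeta>\<^sub>0, \<chi> i. if i = j then w else \<zeta> $ i))) (\<zeta> $ j))"

definition linearized_coeff ::
  "(((real^'n) \<times> real) \<times> (complex \<times> (complex^'n)) \<Rightarrow> complex) \<Rightarrow> ((real^'n) \<times> real \<Rightarrow> complex) \<Rightarrow>
   'n \<Rightarrow> (real^'n) \<times> real \<Rightarrow> complex" where
  "linearized_coeff f u j p = - dzeta j f (p, (u p, grad_x u p))"

end

theory Submission
  imports Defs "HOL-Complex_Analysis.Cauchy_Integral_Formula"
begin

text \<open>Let \<open>H = \<partial>\<^sub>t - \<Sum> f\<^bsub>\<zeta>\<^sub>j\<^esub> \<partial>\<^bsub>x\<^sub>j\<^esub> + (f - \<Sum> \<zeta>\<^sub>j f\<^bsub>\<zeta>\<^sub>j\<^esub>) \<partial>\<^bsub>\<zeta>\<^sub>0\<^esub> + \<Sum> (f\<^bsub>x\<^sub>j\<^esub> + \<zeta>\<^sub>j f\<^bsub>\<zeta>\<^sub>0\<^esub>) \<partial>\<^bsub>\<zeta>\<^sub>j\<^esub>\<close>.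
  Differentiating the equation for \<open>u\<close> shows that \<open>L\<^sup>u\<close> maps the restriction of \<open>G\<close> to the jet
  \<open>(x, t, u, u\<^sub>x)\<close> to the restriction of \<open>H G\<close>, for every \<open>G\<close> that is smooth and holomorphic
  in \<open>(\<zeta>\<^sub>0, \<zeta>)\<close>. Let \<open>g\<^sub>k\<close> be the restriction of \<open>H\<^sup>k G\<close>, where \<open>G\<close> is \<open>x\<^sub>j\<close> or \<open>\<zeta>\<^sub>0\<close>.
  Then \<open>\<Sum> (- t)\<^sup>k g\<^sub>k / k!\<close> is a formal solution, since applying \<open>L\<^sup>u\<close> makes the series telescope.
  Cauchy estimates in \<open>(\<zeta>\<^sub>0, \<zeta>)\<close> and the log-convexity of \<open>m\<^sub>k\<close> give
  \<open>|g\<^sub>k| + |\<partial> g\<^sub>k| \<le> Q\<^sup>k\<^sup>+\<^sup>1 M\<^sub>k\<close>. Multiplying the \<open>k\<close>-th term by a cutoff in \<open>t\<close> at the scale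
  \<open>c m\<^sub>k / m\<^sub>k\<^sub>+\<^sub>1\<close> makes the series converge in \<open>C\<^sup>1\<close>; after applying \<open>L\<^sup>u\<close>, only terms with \<open>|t|\<close> comparable
  to such a scale survive, and there \<open>P\<^sup>k m\<^sub>k |t|\<^sup>k\<close> is bounded by a multiple of \<open>h (\<gamma> |t|)\<close>.\<close>

section \<open>Real calculus: symmetry of second derivatives and bookkeeping for
  multi-indices\<close>

section \<open>Partial derivatives\<close>

text \<open>The coefficients of L^u are only C^1, since u is only C^2, so L^u cannot be iterated on
  general functions of (x, t): each application would cost a derivative. On the jet space the
  coefficients of H are built from f and the coordinates, so H can be iterated without limit, and u
  enters only through the restriction to its jet, which is C^1. As u is complex valued, holomorphy
  in (\<zeta>_0, \<zeta>) is what keeps conjugate derivatives out of the chain rule along the jet.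
  The formal series need not converge, because m_k outgrows every geometric sequence. The cutoff
  scale is the natural one: m_k r^k, as a function of k, is smallest where r m_{k+1} / m_k passes
  through 1, so near that scale the k-th term is comparable to h up to geometric factors. The growth
  condition on m_{k+1} / m_k absorbs each shift of the index by one, and the last condition on the
  sequence leaves only finitely many terms at any t other than 0.\<close>

lemma pderivative_eq:
  assumes "(g has_derivative D) (at p)"
  shows "pderivative b g p = D b"
proof -
  have "((\<lambda>s. p + s *\<^sub>R b) has_vector_derivative b) (at 0)"
    by (auto intro!: derivative_eq_intros)
  moreover have "(g has_derivative D) (at (p + 0 *\<^sub>R b) within range (\<lambda>s. p + s *\<^sub>R b))"
    using assms by (simp add: has_derivative_at_withinI)
  ultimately have "((g \<circ> (\<lambda>s. p + s *\<^sub>R b)) has_vector_derivative D b) (at 0)"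
    by (intro vector_derivative_diff_chain_within) simp_all
  then show ?thesis
    unfolding pderivative_def by (simp add: vector_derivative_at o_def)
qed

lemma pderivative_cong:
  assumes "open S" "p \<in> S" "\<And>q. q \<in> S \<Longrightarrow> g q = h q"
  shows "pderivative b g p = pderivative b h p"
proof -
  have "((\<lambda>s. p + s *\<^sub>R b) \<longlongrightarrow> p) (nhds 0)"
    by (auto intro!: tendsto_eq_intros filterlim_ident)
  then have "\<forall>\<^sub>F s in nhds 0. p + s *\<^sub>R b \<in> S"
    using assms(1,2) by (rule topological_tendstoD)
  then show ?thesis
    unfolding pderivative_def using assms(3)
    by (intro vector_derivative_cong_eq) (auto elim!: eventually_mono)
qed

lemma has_derivative_pderivative:
  fixes g :: "'a::euclidean_space \<Rightarrow> 'b::real_normed_vector"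
  assumes "g differentiable (at p)"
  shows "(g has_derivative (\<lambda>v. \<Sum>b\<in>Basis. (v \<bullet> b) *\<^sub>R pderivative b g p)) (at p)"
proof -
  obtain D where D: "(g has_derivative D) (at p)"
    using assms by (auto simp: differentiable_def)
  then interpret D: bounded_linear D
    by (rule has_derivative_bounded_linear)
  have "D = (\<lambda>v. \<Sum>b\<in>Basis. (v \<bullet> b) *\<^sub>R pderivative b g p)"
  proof
    fix v
    have "D v = D (\<Sum>b\<in>Basis. (v \<bullet> b) *\<^sub>R b)"
      by (simp add: euclidean_representation)
    then show "D v = (\<Sum>b\<in>Basis. (v \<bullet> b) *\<^sub>R pderivative b g p)"
      by (simp add: D.sum D.scaleR pderivative_eq[OF D])
  qed
  with D show ?thesis by simp
qed

lemma pderivative_bounded_linear: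
  "bounded_linear g \<Longrightarrow> pderivative b g p = g b"
  by (intro pderivative_eq bounded_linear_imp_has_derivative)

lemma pderivative_const [simp]: "pderivative b (\<lambda>_. c) p = 0"
  using pderivative_eq[OF has_derivative_const] .

lemma pderivative_add:
  assumes "g differentiable (at p)" "h differentiable (at p)"
  shows "pderivative b (\<lambda>q. g q + h q) p = pderivative b g p + pderivative b h p"
proof -
  obtain D E where "(g has_derivative D) (at p)" "(h has_derivative E) (at p)"
    using assms by (auto simp: differentiable_def)
  then show ?thesis
    using pderivative_eq[OF has_derivative_add, of g D p h E b] by (simp add: pderivative_eq)
qed

lemma pderivative_mult:
  fixes g h :: "'a::real_normed_vector \<Rightarrow> 'b::real_normed_algebra"
  assumes "g differentiable (at p)" "h differentiable (at p)"
  shows "pderivative b (\<lambda>q. g q * h q) p = pderivative b g p * h p + g p * pderivative b h p"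
proof -
  obtain D E where "(g has_derivative D) (at p)" "(h has_derivative E) (at p)"
    using assms by (auto simp: differentiable_def)
  then show ?thesis
    using pderivative_eq[OF has_derivative_mult, of g D p h E b] by (simp add: pderivative_eq add.commute)
qed

text \<open>The mean value inequality in \<tau> for g(p + \<tau> b + s c) - g(p + \<tau> b) - \<tau>
  s X, where X is the mixed derivative. The \<tau>-derivative of this expression is controlled by
  the linearization of \<open>pderivative b g\<close> at the single point p.\<close>

lemma mixed_difference_approx:
  fixes g :: "'a::real_normed_vector \<Rightarrow> 'b::real_normed_vector"
  assumes "open S" "p \<in> S" and diff: "\<And>q. q \<in> S \<Longrightarrow> g differentiable (at q)"
    and diff2: "pderivative b g differentiable (at p)"
    and "\<epsilon> > 0"
  shows "\<exists>d>0. \<forall>s. 0 < s \<and> s < d \<longrightarrow>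
    norm (g (p + s *\<^sub>R b + s *\<^sub>R c) - g (p + s *\<^sub>R b) - g (p + s *\<^sub>R c) + g p
      - (s * s) *\<^sub>R pderivative c (pderivative b g) p) \<le> \<epsilon> * (s * s)"
proof -
  define G where "G = pderivative b g"
  define X where "X = pderivative c G p"
  obtain D where D: "(G has_derivative D) (at p)"
    using diff2 by (auto simp: differentiable_def G_def)
  interpret D: bounded_linear D
    using D by (rule has_derivative_bounded_linear)
  have X: "X = D c"
    unfolding X_def by (rule pderivative_eq[OF D])
  define N where "N = norm b + norm c + 1"
  have N: "N > 0" unfolding N_def by (simp add: add_nonneg_pos)
  \<comment> \<open>Two linearization errors of size \<open>e * (s * N)\<close> are added below,
    hence the 2; \<open>N\<close> bounds the displacement per unit of s.\<close>
  define e where "e = \<epsilon> / (2 * N)"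
  have "e > 0" using N \<open>\<epsilon> > 0\<close> by (simp add: e_def)
  then obtain d1 where d1: "d1 > 0"
    "\<And>y. norm (y - p) < d1 \<Longrightarrow> norm (G y - G p - D (y - p)) \<le> e * norm (y - p)"
    using D unfolding has_derivative_at_alt by blast
  obtain d2 where d2: "d2 > 0" "ball p d2 \<subseteq> S"
    using assms(1,2) open_contains_ball by blast
  define d where "d = min d1 d2 / N"
  have "d > 0" using d1 d2 N by (simp add: d_def)
  moreover have "norm (g (p + s *\<^sub>R b + s *\<^sub>R c) - g (p + s *\<^sub>R b) - g (p + s *\<^sub>R c) + g p
      - (s * s) *\<^sub>R X) \<le> \<epsilon> * (s * s)" if s: "0 < s" "s < d" for s
  proof -
    have sN: "s * N < d1" "s * N < d2"
      using s N by (auto simp: d_def field_simps)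
    have near: "norm (\<tau> *\<^sub>R b + \<sigma> *\<^sub>R c) \<le> s * N" if "0 \<le> \<tau>" "\<tau> \<le> s" "0 \<le> \<sigma>" "\<sigma> \<le> s" for \<tau> \<sigma>
    proof -
      have "norm (\<tau> *\<^sub>R b + \<sigma> *\<^sub>R c) \<le> \<tau> * norm b + \<sigma> * norm c"
        using that by (metis abs_of_nonneg norm_scaleR norm_triangle_ineq)
      also have "\<dots> \<le> s * norm b + s * norm c"
        using that by (intro add_mono mult_right_mono) auto
      also have "\<dots> \<le> s * N" using s by (simp add: N_def algebra_simps)
      finally show ?thesis .
    qed
    have inS: "p + \<tau> *\<^sub>R b + \<sigma> *\<^sub>R c \<in> S" if "0 \<le> \<tau>" "\<tau> \<le> s" "0 \<le> \<sigma>" "\<sigma> \<le> s" for \<tau> \<sigma>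
    proof -
      have "dist p (p + \<tau> *\<^sub>R b + \<sigma> *\<^sub>R c) = norm (\<tau> *\<^sub>R b + \<sigma> *\<^sub>R c)"
        by (simp add: dist_norm norm_minus_commute algebra_simps)
      then show ?thesis using near[OF that] sN d2 by auto
    qed
    have G: "norm (G (p + \<tau> *\<^sub>R b + \<sigma> *\<^sub>R c) - G p - (\<tau> *\<^sub>R D b + \<sigma> *\<^sub>R D c)) \<le> e * (s * N)"
      if "0 \<le> \<tau>" "\<tau> \<le> s" "0 \<le> \<sigma>" "\<sigma> \<le> s" for \<tau> \<sigma>
    proof -
      have eq: "p + \<tau> *\<^sub>R b + \<sigma> *\<^sub>R c - p = \<tau> *\<^sub>R b + \<sigma> *\<^sub>R c" by simp
      show ?thesis
        using d1(2)[of "p + \<tau> *\<^sub>R b + \<sigma> *\<^sub>R c"] near[OF that] sN \<open>e > 0\<close>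
        unfolding eq by (simp add: D.add D.scaleR) (meson dual_order.strict_trans1 less_imp_le mult_left_mono order_trans)
    qed
    have dg: "((\<lambda>\<tau>. g (p + \<tau> *\<^sub>R b + \<sigma> *\<^sub>R c)) has_derivative (\<lambda>h. h *\<^sub>R G (p + \<tau> *\<^sub>R b + \<sigma> *\<^sub>R c)))
        (at \<tau> within {0..s})" if \<tau>\<sigma>: "0 \<le> \<tau>" "\<tau> \<le> s" "0 \<le> \<sigma>" "\<sigma> \<le> s" for \<tau> \<sigma>
    proof -
      obtain E where E: "(g has_derivative E) (at (p + \<tau> *\<^sub>R b + \<sigma> *\<^sub>R c))"
        using diff[OF inS[OF \<tau>\<sigma>]] by (auto simp: differentiable_def)
      interpret E: bounded_linear E
        using E by (rule has_derivative_bounded_linear)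
      have "((\<lambda>\<tau>. p + \<tau> *\<^sub>R b + \<sigma> *\<^sub>R c) has_derivative (\<lambda>h. h *\<^sub>R b)) (at \<tau> within {0..s})"
        by (auto intro!: derivative_eq_intros)
      from has_derivative_compose[OF this E] show ?thesis
        unfolding G_def using pderivative_eq[OF E, of b] by (simp add: E.scaleR)
    qed
    define F where "F \<tau> = g (p + \<tau> *\<^sub>R b + s *\<^sub>R c) - g (p + \<tau> *\<^sub>R b) - (\<tau> * s) *\<^sub>R X" for \<tau>
    define F' where "F' \<tau> = G (p + \<tau> *\<^sub>R b + s *\<^sub>R c) - G (p + \<tau> *\<^sub>R b) - s *\<^sub>R X" for \<tau>
    have dF: "(F has_derivative (\<lambda>h. h *\<^sub>R F' \<tau>)) (at \<tau> within {0..s})" if "\<tau> \<in> {0..s}" for \<tau>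
      unfolding F_def[abs_def] F'_def using dg[of \<tau> s] dg[of \<tau> 0] that s
      by (auto intro!: derivative_eq_intros simp: algebra_simps)
    have "norm (F' \<tau>) \<le> \<epsilon> * s" if "\<tau> \<in> {0..s}" for \<tau>
    proof -
      have "F' \<tau> = (G (p + \<tau> *\<^sub>R b + s *\<^sub>R c) - G p - (\<tau> *\<^sub>R D b + s *\<^sub>R D c))
         - (G (p + \<tau> *\<^sub>R b + 0 *\<^sub>R c) - G p - (\<tau> *\<^sub>R D b + 0 *\<^sub>R D c))"
        by (simp add: F'_def X)
      also have "norm \<dots> \<le> e * (s * N) + e * (s * N)"
        using that s by (intro order_trans[OF norm_triangle_ineq4] add_mono G) auto
      also have "\<dots> = \<epsilon> * s" using N by (simp add: e_def field_simps)
      finally show ?thesis .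
    qed
    then have "onorm (\<lambda>h. h *\<^sub>R F' \<tau>) \<le> \<epsilon> * s" if "\<tau> \<in> {0..s}" for \<tau>
      using that by (intro onorm_le) (metis mult.commute mult_right_mono norm_ge_zero norm_scaleR real_norm_def)
    from differentiable_bound[OF convex_real_interval(5) dF this, of s 0]
    have "norm (F s - F 0) \<le> \<epsilon> * s * s"
      using s by simp
    then show ?thesis by (simp add: F_def algebra_simps)
  qed
  ultimately show ?thesis unfolding X_def G_def by blast
qed

text \<open>The second difference over the parallelogram spanned by s b and s c is symmetric in b
  and c; divided by s^2 it approximates both mixed derivatives.\<close>

lemma pderivative_commute:
  fixes g :: "'a::real_normed_vector \<Rightarrow> 'b::real_normed_vector"
  assumes "open S" "p \<in> S" "\<And>q. q \<in> S \<Longrightarrow> g differentiable (at q)"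
    and "pderivative b g differentiable (at p)" "pderivative c g differentiable (at p)"
  shows "pderivative b (pderivative c g) p = pderivative c (pderivative b g) p"
proof -
  define X where "X = pderivative c (pderivative b g) p"
  define Y where "Y = pderivative b (pderivative c g) p"
  have "norm (X - Y) \<le> \<epsilon>" if "\<epsilon> > 0" for \<epsilon>
  proof -
    have "\<epsilon> / 2 > 0" using that by simp
    from mixed_difference_approx[OF assms(1-4) this, of c]
      mixed_difference_approx[OF assms(1-3,5) this, of b]
    obtain d1 d2 where d: "d1 > 0" "d2 > 0"
      and d1: "\<And>s. 0 < s \<Longrightarrow> s < d1 \<Longrightarrow> norm (g (p + s *\<^sub>R b + s *\<^sub>R c) - g (p + s *\<^sub>R b) - g (p + s *\<^sub>R c) + g p
      - (s * s) *\<^sub>R X) \<le> \<epsilon> / 2 * (s * s)"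
      and d2: "\<And>s. 0 < s \<Longrightarrow> s < d2 \<Longrightarrow> norm (g (p + s *\<^sub>R c + s *\<^sub>R b) - g (p + s *\<^sub>R c) - g (p + s *\<^sub>R b) + g p
      - (s * s) *\<^sub>R Y) \<le> \<epsilon> / 2 * (s * s)"
      unfolding X_def Y_def by blast
    define s where "s = min d1 d2 / 2"
    have s: "0 < s" "s < d1" "s < d2" using d by (auto simp: s_def)
    define T where "T = g (p + s *\<^sub>R b + s *\<^sub>R c) - g (p + s *\<^sub>R b) - g (p + s *\<^sub>R c) + g p"
    have "norm (T - (s * s) *\<^sub>R X) \<le> \<epsilon> / 2 * (s * s)"
      using d1[OF s(1,2)] by (simp add: T_def)
    moreover have "norm (T - (s * s) *\<^sub>R Y) \<le> \<epsilon> / 2 * (s * s)"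
      using d2[OF s(1,3)] by (simp add: T_def algebra_simps)
    ultimately have "norm ((T - (s * s) *\<^sub>R Y) - (T - (s * s) *\<^sub>R X)) \<le> \<epsilon> * (s * s)"
      by (intro order_trans[OF norm_triangle_ineq4]) simp
    moreover have "(T - (s * s) *\<^sub>R Y) - (T - (s * s) *\<^sub>R X) = (s * s) *\<^sub>R (X - Y)"
      by (simp add: algebra_simps)
    ultimately show ?thesis using s(1) by simp
  qed
  then have "norm (X - Y) \<le> 0" using field_le_epsilon by (metis add_0)
  then show ?thesis by (simp add: X_def Y_def)
qed

section \<open>Functions of class \<open>C\<^sup>k\<close> and smooth functions\<close>

lemma Ck_on_cong:
  assumes "open S" "\<And>q. q \<in> S \<Longrightarrow> g q = h q"
  shows "Ck_on k g S \<longleftrightarrow> Ck_on k h S"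
  using assms(2)
proof (induction k arbitrary: g h)
  case 0
  then show ?case by (simp cong: continuous_on_cong)
next
  case (Suc k)
  have "g differentiable (at p) \<longleftrightarrow> h differentiable (at p)" if "p \<in> S" for p
    using Suc.prems that \<open>open S\<close> unfolding differentiable_def
    by (metis has_derivative_transform_within_open)
  moreover have "Ck_on k (pderivative b g) S \<longleftrightarrow> Ck_on k (pderivative b h) S" for b
    by (rule Suc.IH) (rule pderivative_cong[OF \<open>open S\<close> _ Suc.prems])
  ultimately show ?case by simp
qed

lemma Ck_on_SucD: "Ck_on (Suc k) g S \<Longrightarrow> Ck_on k g S"
  by (induction k arbitrary: g)
    (auto intro: continuous_at_imp_continuous_on differentiable_imp_continuous_within)

lemma Ck_on_subset: "Ck_on k g S \<Longrightarrow> T \<subseteq> S \<Longrightarrow> Ck_on k g T"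
  by (induction k arbitrary: g) (auto intro: continuous_on_subset)

lemma Ck_on_const: "Ck_on k (\<lambda>_. c) S"
proof (induction k arbitrary: c)
  case (Suc k)
  have "pderivative b (\<lambda>_::'a. c) = (\<lambda>_. 0)" for b
    by (rule ext) simp
  with Suc show ?case by simp
qed simp

lemma Ck_on_bounded_linear:
  assumes "bounded_linear g"
  shows "Ck_on k g S"
proof (cases k)
  case 0
  then show ?thesis using assms by (simp add: linear_continuous_on)
next
  case (Suc l)
  have "pderivative b g = (\<lambda>_. g b)" for b
    using pderivative_bounded_linear[OF assms] by (intro ext)
  then show ?thesis
    using Suc assms by (auto simp: Ck_on_const intro: bounded_linear_imp_differentiable)
qed

lemma Ck_on_add:
  assumes "open S" "Ck_on k g S" "Ck_on k h S"
  shows "Ck_on k (\<lambda>q. g q + h q) S"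
  using assms(2,3)
proof (induction k arbitrary: g h)
  case (Suc k)
  have "Ck_on k (\<lambda>q. pderivative b g q + pderivative b h q) S" if "b \<in> Basis" for b
    using Suc that by simp
  moreover have "Ck_on k (pderivative b (\<lambda>q. g q + h q)) S
      \<longleftrightarrow> Ck_on k (\<lambda>q. pderivative b g q + pderivative b h q) S" for b
    using Suc.prems by (intro Ck_on_cong[OF \<open>open S\<close>] pderivative_add) auto
  ultimately show ?case using Suc.prems by simp
qed (simp add: continuous_on_add)

lemma Ck_on_sum:
  assumes "open S" "\<And>i. i \<in> A \<Longrightarrow> Ck_on k (g i) S"
  shows "Ck_on k (\<lambda>q. \<Sum>i\<in>A. g i q) S"
  using assms(2) by (induction A rule: infinite_finite_induct) (simp_all add: Ck_on_const Ck_on_add[OF \<open>open S\<close>])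

lemma Ck_on_mult:
  fixes g h :: "'a::euclidean_space \<Rightarrow> 'b::real_normed_algebra"
  assumes "open S" "Ck_on k g S" "Ck_on k h S"
  shows "Ck_on k (\<lambda>q. g q * h q) S"
  using assms(2,3)
proof (induction k arbitrary: g h)
  case (Suc k)
  have "Ck_on k (\<lambda>q. pderivative b g q * h q + g q * pderivative b h q) S" if "b \<in> Basis" for b
    using Suc.prems that Ck_on_SucD[OF Suc.prems(1)] Ck_on_SucD[OF Suc.prems(2)]
    by (intro Ck_on_add[OF \<open>open S\<close>] Suc.IH) auto
  moreover have "Ck_on k (pderivative b (\<lambda>q. g q * h q)) S
      \<longleftrightarrow> Ck_on k (\<lambda>q. pderivative b g q * h q + g q * pderivative b h q) S" for b
    using Suc.prems by (intro Ck_on_cong[OF \<open>open S\<close>] pderivative_mult) auto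
  ultimately show ?case using Suc.prems by simp
qed (simp add: continuous_on_mult)

lemma smooth_on_differentiable: "smooth_on g S \<Longrightarrow> p \<in> S \<Longrightarrow> g differentiable (at p)"
  unfolding smooth_on_def by (meson Ck_on.simps(2))

lemma smooth_on_pderivative: "smooth_on g S \<Longrightarrow> b \<in> Basis \<Longrightarrow> smooth_on (pderivative b g) S"
  unfolding smooth_on_def by (meson Ck_on.simps(2))

lemma smooth_on_continuous: "smooth_on g S \<Longrightarrow> continuous_on S g"
  unfolding smooth_on_def by (metis Ck_on.simps(1))

lemma smooth_on_pderivative_commute:
  assumes "open S" "smooth_on g S" "p \<in> S" "b \<in> Basis" "c \<in> Basis"
  shows "pderivative b (pderivative c g) p = pderivative c (pderivative b g) p"
  using assms
  by (intro pderivative_commute) (auto intro: smooth_on_differentiable smooth_on_pderivative)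

section \<open>Iterated partial derivatives\<close>

lemma iter_pderivative_simps [simp]:
  "iter_pderivative [] g = g"
  "iter_pderivative (b # bs) g = pderivative b (iter_pderivative bs g)"
  "iter_pderivative (bs @ cs) g = iter_pderivative bs (iter_pderivative cs g)"
  by (simp_all add: iter_pderivative_def)

lemma smooth_on_iter_pderivative:
  "smooth_on g S \<Longrightarrow> set bs \<subseteq> Basis \<Longrightarrow> smooth_on (iter_pderivative bs g) S"
  by (induction bs) (auto intro: smooth_on_pderivative)

lemma iter_pderivative_cong:
  assumes "open S" "\<And>q. q \<in> S \<Longrightarrow> g q = h q" "p \<in> S"
  shows "iter_pderivative bs g p = iter_pderivative bs h p"
  using assms(3) by (induction bs arbitrary: p) (auto simp: assms intro: pderivative_cong[OF assms(1)])

lemma iter_pderivative_add: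
  assumes "open S" "smooth_on g S" "smooth_on h S" "p \<in> S" "set bs \<subseteq> Basis"
  shows "iter_pderivative bs (\<lambda>q. g q + h q) p = iter_pderivative bs g p + iter_pderivative bs h p"
  using assms(4,5)
proof (induction bs arbitrary: p)
  case (Cons b bs)
  have "iter_pderivative (b # bs) (\<lambda>q. g q + h q) p
      = pderivative b (\<lambda>q. iter_pderivative bs g q + iter_pderivative bs h q) p"
    using Cons by (auto intro: pderivative_cong[OF \<open>open S\<close>])
  also have "\<dots> = iter_pderivative (b # bs) g p + iter_pderivative (b # bs) h p"
    using Cons.prems assms(2,3)
    by (simp add: pderivative_add smooth_on_differentiable[OF smooth_on_iter_pderivative])
  finally show ?case .
qed simp

text \<open>Mixed derivatives commute, so a list can be sorted into two groups. This serves to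
  separate the \<zeta>-derivatives, handled by Cauchy estimates, from the (x, t)-derivatives,
  bounded by the class C^M.\<close>

lemma iter_pderivative_filter:
  assumes "open S" "smooth_on g S" "p \<in> S" "set bs \<subseteq> Basis"
  shows "iter_pderivative bs g p
    = iter_pderivative (filter P bs) (iter_pderivative (filter (\<lambda>b. \<not> P b) bs) g) p"
  using assms(3,4)
proof (induction bs arbitrary: p)
  case (Cons b bs)
  let ?G = "iter_pderivative (filter (\<lambda>b. \<not> P b) bs) g"
  have smooth: "smooth_on ?G S"
    using Cons.prems assms(2) by (auto intro!: smooth_on_iter_pderivative)
  have move: "pderivative b (iter_pderivative cs ?G) q = iter_pderivative cs (pderivative b ?G) q"
    if "set cs \<subseteq> Basis" "q \<in> S" for cs q
    using that
  proof (induction cs arbitrary: q)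
    case (Cons c cs)
    have "pderivative b (iter_pderivative (c # cs) ?G) q
        = pderivative c (pderivative b (iter_pderivative cs ?G)) q"
      using Cons.prems \<open>set (b # bs) \<subseteq> Basis\<close> smooth
      by (simp add: smooth_on_pderivative_commute[OF \<open>open S\<close>] smooth_on_iter_pderivative)
    also have "\<dots> = iter_pderivative (c # cs) (pderivative b ?G) q"
      using Cons by (auto intro: pderivative_cong[OF \<open>open S\<close>])
    finally show ?case .
  qed simp
  have "iter_pderivative (b # bs) g p = pderivative b (iter_pderivative (filter P bs) ?G) p"
    using Cons by (auto intro: pderivative_cong[OF \<open>open S\<close>])
  also have "\<dots> = iter_pderivative (filter P (b # bs)) (iter_pderivative (filter (\<lambda>b. \<not> P b) (b # bs)) g) p"
    using move[of "filter P bs" p] Cons.prems by auto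
  finally show ?case .
qed simp

section \<open>Weights: log-convex sequences and the algebra of functions they control\<close>

section \<open>Regular sequences\<close>

lemma regular_sequence_pos:
  assumes "regular_sequence M"
  shows "M k > 0" "normalized M k > 0"
  using assms by (simp_all add: regular_sequence_def normalized_def)

lemma regular_sequence_0_1:
  assumes "regular_sequence M"
  shows "normalized M 0 = 1" "normalized M (Suc 0) = 1"
  using assms by (simp_all add: regular_sequence_def)

lemma fact_mult_normalized: "fact k * normalized M k = M k"
  by (simp add: normalized_def)

text \<open>The quotients m_{k+1} / m_k carry the growth conditions: log-convexity makes them
  increase, the supremum condition makes them at most geometric in k, and the limit condition makes
  them unbounded.\<close>

definition ratio :: "(nat \<Rightarrow> real) \<Rightarrow> nat \<Rightarrow> real" where
  "ratio M k = normalized M (Suc k) / normalized M k"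

lemma normalized_Suc:
  assumes "regular_sequence M"
  shows "normalized M (Suc k) = normalized M k * ratio M k"
  using regular_sequence_pos(2)[OF assms, of k] by (simp add: ratio_def)

lemma ratio_mono:
  assumes "regular_sequence M"
  shows "mono (ratio M)"
proof (rule incseq_SucI)
  fix k
  have "(normalized M (Suc k))\<^sup>2 \<le> normalized M (Suc k - 1) * normalized M (Suc k + 1)"
    using assms unfolding regular_sequence_def by (metis le_add1 plus_1_eq_Suc)
  then show "ratio M k \<le> ratio M (Suc k)"
    using regular_sequence_pos(2)[OF assms, of k] regular_sequence_pos(2)[OF assms, of "Suc k"]
    by (simp add: ratio_def field_simps power2_eq_square)
qed

lemma ratio_ge_1:
  assumes "regular_sequence M"
  shows "ratio M k \<ge> 1"
proof -
  have "ratio M 0 = 1"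
    using regular_sequence_0_1[OF assms] by (simp add: ratio_def)
  then show ?thesis
    using monoD[OF ratio_mono[OF assms], of 0 k] by simp
qed

text \<open>m_{i+j} / m_i is a product of j later quotients, hence at least the product of the first
  j quotients, which is m_j because m_0 = 1.\<close>

lemma normalized_mult_le:
  assumes "regular_sequence M"
  shows "normalized M i * normalized M j \<le> normalized M (i + j)"
proof (induction j)
  case 0
  then show ?case using regular_sequence_0_1[OF assms] by simp
next
  case (Suc j)
  have "normalized M i * normalized M (Suc j) = (normalized M i * normalized M j) * ratio M j"
    by (simp add: normalized_Suc[OF assms])
  also have "\<dots> \<le> normalized M (i + j) * ratio M (i + j)"
    using Suc ratio_ge_1[OF assms, of j] regular_sequence_pos(2)[OF assms] monoD[OF ratio_mono[OF assms], of j "i + j"]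
    by (intro mult_mono) (auto simp: less_imp_le)
  finally show ?case by (simp add: normalized_Suc[OF assms])
qed

lemma normalized_mono:
  assumes "regular_sequence M" "i \<le> j"
  shows "normalized M i \<le> normalized M j"
  using assms(2)
proof (induction j rule: dec_induct)
  case (step j)
  then show ?case
    using ratio_ge_1[OF assms(1), of j] regular_sequence_pos(2)[OF assms(1), of j]
    by (simp add: normalized_Suc[OF assms(1)]) (meson dual_order.trans less_imp_le mult_le_cancel_left1 linorder_not_le)
qed simp

text \<open>The bound on the k-th root, raised to the power k. The supremum starts at k = 1; at k =
  0 the quotient is m_1 / m_0 = 1.\<close>

lemma ratio_le_power:
  assumes "regular_sequence M"
  shows "\<exists>C\<ge>1. \<forall>k. ratio M k \<le> C ^ k"
proof -
  have "bdd_above ((\<lambda>k. ratio M k powr (1 / real k)) ` {1..})"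
    using assms by (simp add: regular_sequence_def ratio_def)
  then obtain B where B: "\<And>k. k \<ge> 1 \<Longrightarrow> ratio M k powr (1 / real k) \<le> B"
    by (auto simp: bdd_above_def)
  have "ratio M k \<le> (max 1 B) ^ k" for k
  proof (cases "k = 0")
    case True
    then show ?thesis using regular_sequence_0_1[OF assms] by (simp add: ratio_def)
  next
    case False
    have pos: "ratio M k > 0" using ratio_ge_1[OF assms, of k] by linarith
    have "ratio M k = (ratio M k powr (1 / real k)) ^ k"
      using False pos by (simp add: powr_power)
    also have "\<dots> \<le> (max 1 B) ^ k"
      using B[of k] False by (intro power_mono) auto
    finally show ?thesis .
  qed
  then show ?thesis by (intro exI[of _ "max 1 B"]) simp
qed

text \<open>m_k is the product of the first k quotients, each at most \<open>ratio M k\<close>, so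
  the k-th root of m_k lies below \<open>ratio M k\<close> and drives it to infinity.\<close>

lemma filterlim_ratio:
  assumes "regular_sequence M"
  shows "filterlim (ratio M) at_top sequentially"
proof -
  have le: "normalized M k \<le> ratio M k ^ k" for k
  proof (induction k)
    case (Suc k)
    have "normalized M (Suc k) \<le> ratio M k ^ k * ratio M k"
      using Suc ratio_ge_1[OF assms, of k] by (simp add: normalized_Suc[OF assms])
    also have "\<dots> \<le> ratio M (Suc k) ^ Suc k"
      using ratio_ge_1[OF assms, of k] monoD[OF ratio_mono[OF assms], of k "Suc k"]
      by (metis le_SucI order_refl power_Suc2 power_mono zero_le_one order_trans)
    finally show ?case .
  qed (use regular_sequence_0_1[OF assms] in simp)
  have "normalized M k powr (1 / real k) \<le> ratio M k" if "k \<ge> 1" for k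
  proof -
    have "normalized M k powr (1 / real k) \<le> (ratio M k ^ k) powr (1 / real k)"
      using le[of k] regular_sequence_pos(2)[OF assms, of k] by (intro powr_mono2) auto
    also have "\<dots> = ratio M k"
      using ratio_ge_1[OF assms, of k] that by (simp flip: powr_realpow add: powr_powr)
    finally show ?thesis .
  qed
  moreover have "filterlim (\<lambda>k. normalized M k powr (1 / real k)) at_top sequentially"
    using assms by (simp add: regular_sequence_def)
  ultimately show ?thesis
    by (elim filterlim_at_top_mono) (auto simp: eventually_sequentially)
qed

section \<open>Functions with derivatives bounded by a regular sequence\<close>

text \<open>Pascal's rule in the shape that arises when one derivative is distributed over a
  product.\<close>

lemma binomial_convolution_Suc:
  fixes \<beta> \<gamma> :: "nat \<Rightarrow> real"
  shows "(\<Sum>j\<le>Suc n. real (Suc n choose j) * \<beta> j * \<gamma> (Suc n - j))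
    = (\<Sum>j\<le>n. real (n choose j) * \<beta> (Suc j) * \<gamma> (n - j))
      + (\<Sum>j\<le>n. real (n choose j) * \<beta> j * \<gamma> (Suc (n - j)))"
proof -
  have "(\<Sum>j\<le>n. real (n choose j) * \<beta> j * \<gamma> (Suc (n - j)))
      = (\<Sum>j\<le>n. real (n choose j) * \<beta> j * \<gamma> (Suc n - j))"
    by (intro sum.cong) (auto simp: Suc_diff_le)
  also have "\<dots> = (\<Sum>j\<le>Suc n. real (n choose j) * \<beta> j * \<gamma> (Suc n - j))"
    by simp
  also have "\<dots> = \<beta> 0 * \<gamma> (Suc n) + (\<Sum>j\<le>n. real (n choose Suc j) * \<beta> (Suc j) * \<gamma> (n - j))"
    by (subst sum.atMost_Suc_shift) simp
  finally show ?thesis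
    by (subst sum.atMost_Suc_shift) (simp add: sum.distrib algebra_simps)
qed

text \<open>Leibniz rule recording only the orders of derivatives. The bounds are arbitrary
  sequences so that the induction can replace \<open>\<beta>\<close> or \<open>\<gamma>\<close> by
  its shift; it peels off the innermost derivative, where the product rule acts on g and h
  themselves.\<close>

lemma iter_pderivative_mult_le:
  fixes g h :: "'a::euclidean_space \<Rightarrow> 'b::real_normed_algebra"
  assumes "open S" "p \<in> S" "smooth_on g S" "smooth_on h S"
    and "\<And>bs. set bs \<subseteq> Basis \<Longrightarrow> norm (iter_pderivative bs g p) \<le> \<beta> (length bs)"
    and "\<And>bs. set bs \<subseteq> Basis \<Longrightarrow> norm (iter_pderivative bs h p) \<le> \<gamma> (length bs)"
    and "set bs \<subseteq> Basis"
  shows "norm (iter_pderivative bs (\<lambda>q. g q * h q) p)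
    \<le> (\<Sum>j\<le>length bs. real (length bs choose j) * \<beta> j * \<gamma> (length bs - j))"
  using assms(3-)
proof (induction bs arbitrary: g h \<beta> \<gamma> rule: rev_induct)
  case Nil
  have "norm (g p * h p) \<le> norm (g p) * norm (h p)" by (rule norm_mult_ineq)
  also have "\<dots> \<le> \<beta> 0 * \<gamma> 0"
    using Nil(3)[of "[]"] Nil(4)[of "[]"] by (intro mult_mono) (auto intro: order_trans[OF norm_ge_zero])
  finally show ?case by simp
next
  case (snoc b bs)
  have b: "b \<in> Basis" and bs: "set bs \<subseteq> Basis" using snoc.prems by auto
  have bnd: "norm (iter_pderivative cs (pderivative b g) p) \<le> \<beta> (Suc (length cs))"
    "norm (iter_pderivative cs (pderivative b h) p) \<le> \<gamma> (Suc (length cs))"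
    if "set cs \<subseteq> Basis" for cs
    using snoc.prems(3)[of "cs @ [b]"] snoc.prems(4)[of "cs @ [b]"] that b by auto
  have smooth: "smooth_on (pderivative b g) S" "smooth_on (pderivative b h) S"
    using snoc.prems b by (auto intro: smooth_on_pderivative)
  have "iter_pderivative (bs @ [b]) (\<lambda>q. g q * h q) p
      = iter_pderivative bs (\<lambda>q. pderivative b g q * h q + g q * pderivative b h q) p"
    using snoc.prems assms(1,2)
    by (auto intro!: iter_pderivative_cong[OF \<open>open S\<close>] pderivative_mult smooth_on_differentiable)
  also have "\<dots> = iter_pderivative bs (\<lambda>q. pderivative b g q * h q) p
      + iter_pderivative bs (\<lambda>q. g q * pderivative b h q) p"
    using assms(1,2) smooth snoc.prems bs
    by (intro iter_pderivative_add) (auto simp: smooth_on_def intro!: Ck_on_mult)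
  also have "norm \<dots> \<le> (\<Sum>j\<le>length bs. real (length bs choose j) * \<beta> (Suc j) * \<gamma> (length bs - j))
      + (\<Sum>j\<le>length bs. real (length bs choose j) * \<beta> j * \<gamma> (Suc (length bs - j)))"
    using smooth snoc.prems bnd bs
    by (intro order_trans[OF norm_triangle_ineq] add_mono snoc.IH[where \<beta> = "\<lambda>j. \<beta> (Suc j)"] 
        snoc.IH[where \<gamma> = "\<lambda>j. \<gamma> (Suc j)"]) auto
  finally show ?case by (simp only: length_append_singleton binomial_convolution_Suc)
qed

lemma smooth_on_mult:
  fixes g h :: "'a::euclidean_space \<Rightarrow> 'b::real_normed_algebra"
  shows "open S \<Longrightarrow> smooth_on g S \<Longrightarrow> smooth_on h S \<Longrightarrow> smooth_on (\<lambda>q. g q * h q) S"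
  by (simp add: smooth_on_def Ck_on_mult)

lemma smooth_on_add:
  "open S \<Longrightarrow> smooth_on g S \<Longrightarrow> smooth_on h S \<Longrightarrow> smooth_on (\<lambda>q. g q + h q) S"
  by (simp add: smooth_on_def Ck_on_add)

lemma smooth_on_const: "smooth_on (\<lambda>_. c) S"
  by (simp add: smooth_on_def Ck_on_const)

lemma smooth_on_bounded_linear: "bounded_linear g \<Longrightarrow> smooth_on g S"
  by (simp add: smooth_on_def Ck_on_bounded_linear)

text \<open>Bounds of class C^M in all directions of the space, with an explicit constant. On the
  jet space this includes the complex directions, unlike \<open>CM_holomorphic_on\<close>.\<close>

definition CM_bounded :: "(nat \<Rightarrow> real) \<Rightarrow> real \<Rightarrow> ('a::euclidean_space \<Rightarrow> 'b::real_normed_vector) \<Rightarrow> 'a set \<Rightarrow> bool" where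
  "CM_bounded M A g K \<longleftrightarrow> (\<forall>bs. set bs \<subseteq> Basis \<longrightarrow>
     (\<forall>p\<in>K. norm (iter_pderivative bs g p) \<le> A ^ (length bs + 1) * M (length bs)))"

lemma CM_bounded_mono:
  assumes "regular_sequence M" "CM_bounded M A g K" "0 \<le> A" "A \<le> B"
  shows "CM_bounded M B g K"
  unfolding CM_bounded_def
proof (intro allI impI ballI)
  fix bs p assume "set bs \<subseteq> (Basis :: 'a set)" "p \<in> K"
  then have "norm (iter_pderivative bs g p) \<le> A ^ (length bs + 1) * M (length bs)"
    using assms(2) by (auto simp: CM_bounded_def)
  also have "\<dots> \<le> B ^ (length bs + 1) * M (length bs)"
    using regular_sequence_pos(1)[OF assms(1)] assms(3,4)
    by (intro mult_right_mono power_mono) (auto simp: less_imp_le)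
  finally show "norm (iter_pderivative bs g p) \<le> B ^ (length bs + 1) * M (length bs)" .
qed

text \<open>M_{n+1} = (n + 1) (m_{n+1} / m_n) M_n, and both factors grow at most geometrically; the
  second one by the supremum condition on regular sequences.\<close>

lemma CM_bounded_pderivative:
  assumes "regular_sequence M" "CM_bounded M A g K" "A \<ge> 1" "b \<in> Basis"
  shows "\<exists>B\<ge>1. CM_bounded M B (pderivative b g) K"
proof -
  obtain C where C: "C \<ge> 1" "\<And>k. ratio M k \<le> C ^ k"
    using ratio_le_power[OF assms(1)] by blast
  have "norm (iter_pderivative bs (pderivative b g) p) \<le> (2 * C * A\<^sup>2) ^ (length bs + 1) * M (length bs)"
    if bs: "set bs \<subseteq> Basis" and p: "p \<in> K" for bs p
  proof -
    define n where "n = length bs"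
    have "M (Suc n) = real (Suc n) * ratio M n * M n"
      by (simp add: fact_mult_normalized[of _ M, symmetric] normalized_Suc[OF assms(1)] algebra_simps)
    also have "\<dots> \<le> 2 ^ (n + 1) * C ^ (n + 1) * M n"
    proof (intro mult_right_mono mult_mono)
      show "real (Suc n) \<le> 2 ^ (n + 1)" using of_nat_less_two_power[of "n + 1", where 'a = real] by simp
      show "ratio M n \<le> C ^ (n + 1)"
        using C(1) by (intro order_trans[OF C(2)] power_increasing) auto
    qed (use regular_sequence_pos(1)[OF assms(1), of n] ratio_ge_1[OF assms(1), of n] in auto)
    finally have Mn: "M (Suc n) \<le> (2 * C) ^ (n + 1) * M n" by (simp only: power_mult_distrib)
    have "norm (iter_pderivative (bs @ [b]) g p) \<le> A ^ (n + 2) * M (Suc n)"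
      using assms(2,4) bs p unfolding CM_bounded_def n_def
      by (auto dest!: spec[of _ "bs @ [b]"])
    also have "\<dots> \<le> (A\<^sup>2) ^ (n + 1) * ((2 * C) ^ (n + 1) * M n)"
    proof (intro mult_mono Mn)
      show "A ^ (n + 2) \<le> (A\<^sup>2) ^ (n + 1)"
        using assms(3) by (simp only: power_mult[symmetric]) (intro power_increasing; simp)
    qed (use regular_sequence_pos(1)[OF assms(1)] in \<open>auto simp: less_imp_le\<close>)
    also have "\<dots> = (2 * C * A\<^sup>2) ^ (n + 1) * M n" by (simp add: power_mult_distrib algebra_simps)
    finally show ?thesis by (simp add: n_def)
  qed
  moreover have "1 \<le> 2 * C * A\<^sup>2"
  proof -
    have "1 * 1 \<le> (2 * C) * A\<^sup>2" using C assms(3) by (intro mult_mono) auto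
    then show ?thesis by simp
  qed
  ultimately show ?thesis unfolding CM_bounded_def by blast
qed

lemma CM_bounded_add:
  assumes "regular_sequence M" "open S" "K \<subseteq> S" "smooth_on g S" "smooth_on h S"
    and "CM_bounded M A g K" "CM_bounded M B h K" "A \<ge> 1" "B \<ge> 1"
  shows "CM_bounded M (A + B) (\<lambda>q. g q + h q) K"
  unfolding CM_bounded_def
proof (intro allI impI ballI)
  fix bs p assume bs: "set bs \<subseteq> (Basis :: 'a set)" and p: "p \<in> K"
  define n where "n = length bs"
  have "norm (iter_pderivative bs (\<lambda>q. g q + h q) p)
      \<le> norm (iter_pderivative bs g p) + norm (iter_pderivative bs h p)"
    using bs p assms by (subst iter_pderivative_add[OF assms(2)]) (auto intro: norm_triangle_ineq)
  also have "\<dots> \<le> A ^ (n + 1) * M n + B ^ (n + 1) * M n"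
    using assms(6,7) bs p by (intro add_mono) (auto simp: CM_bounded_def n_def)
  also have "\<dots> = (A ^ (n + 1) + B ^ (n + 1)) * M n" by (simp add: algebra_simps)
  also have "\<dots> \<le> (A + B) ^ (n + 1) * M n"
  proof (intro mult_right_mono)
    have "A * A ^ n + B * B ^ n \<le> A * (A + B) ^ n + B * (A + B) ^ n"
      using assms(8,9) by (intro add_mono mult_left_mono power_mono) auto
    then show "A ^ (n + 1) + B ^ (n + 1) \<le> (A + B) ^ (n + 1)" by (simp add: algebra_simps)
  qed (use regular_sequence_pos(1)[OF assms(1)] in \<open>auto simp: less_imp_le\<close>)
  finally show "norm (iter_pderivative bs (\<lambda>q. g q + h q) p) \<le> (A + B) ^ (length bs + 1) * M (length bs)"
    by (simp add: n_def)
qed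

text \<open>In the Leibniz sum, the binomial coefficient times M_j M_{n-j} equals n! m_j m_{n-j},
  which log-convexity bounds by M_n; the number n + 1 of terms goes into 2^(n+1).\<close>

lemma CM_bounded_mult:
  fixes g h :: "'a::euclidean_space \<Rightarrow> 'b::real_normed_algebra"
  assumes "regular_sequence M" "open S" "K \<subseteq> S" "smooth_on g S" "smooth_on h S"
    and "CM_bounded M A g K" "CM_bounded M B h K" "A \<ge> 1" "B \<ge> 1"
  shows "CM_bounded M (2 * (A * B)) (\<lambda>q. g q * h q) K"
  unfolding CM_bounded_def
proof (intro allI impI ballI)
  fix bs p assume bs: "set bs \<subseteq> (Basis :: 'a set)" and p: "p \<in> K"
  define n where "n = length bs"
  have "norm (iter_pderivative bs (\<lambda>q. g q * h q) p)
      \<le> (\<Sum>j\<le>n. real (n choose j) * (A ^ (j + 1) * M j) * (B ^ (n - j + 1) * M (n - j)))"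
    unfolding n_def using bs p assms(3-7)
    by (intro iter_pderivative_mult_le[OF assms(2)]) (auto simp: CM_bounded_def)
  also have "\<dots> \<le> (\<Sum>j\<le>n. (A * B) ^ (n + 1) * M n)"
  proof (rule sum_mono)
    fix j assume "j \<in> {..n}"
    then have j: "j \<le> n" by simp
    have pos: "A > 0" "B > 0" using assms(8,9) by auto
    have AB: "A ^ (j + 1) * B ^ (n - j + 1) \<le> A ^ (n + 1) * B ^ (n + 1)"
      using j assms(8,9) by (intro mult_mono power_increasing) auto
    have "real (n choose j) * M j * M (n - j) = real (n choose j) * fact j * fact (n - j)
        * (normalized M j * normalized M (n - j))"
      by (simp add: fact_mult_normalized[of _ M, symmetric])
    also have "real (n choose j) * fact j * fact (n - j) = fact n"
      using binomial_fact[OF j, where 'a = real] by (simp add: field_simps)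
    also have "fact n * (normalized M j * normalized M (n - j)) \<le> fact n * normalized M n"
      using normalized_mult_le[OF assms(1), of j "n - j"] j by (intro mult_left_mono) auto
    finally have "real (n choose j) * M j * M (n - j) \<le> M n"
      by (simp add: fact_mult_normalized)
    then have "(A ^ (j + 1) * B ^ (n - j + 1)) * (real (n choose j) * M j * M (n - j))
        \<le> (A ^ (n + 1) * B ^ (n + 1)) * M n"
      using pos regular_sequence_pos(1)[OF assms(1)] by (intro mult_mono[OF AB]) (auto simp: less_imp_le)
    then show "real (n choose j) * (A ^ (j + 1) * M j) * (B ^ (n - j + 1) * M (n - j))
        \<le> (A * B) ^ (n + 1) * M n"
      unfolding power_mult_distrib by (simp only: mult_ac)
  qed
  also have "\<dots> = real (n + 1) * ((A * B) ^ (n + 1) * M n)" by simp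
  also have "\<dots> \<le> 2 ^ (n + 1) * ((A * B) ^ (n + 1) * M n)"
  proof (intro mult_right_mono)
    show "real (n + 1) \<le> 2 ^ (n + 1)" using of_nat_less_two_power[of "n + 1", where 'a = real] by simp
  qed (use regular_sequence_pos(1)[OF assms(1)] assms(8,9) in \<open>auto simp: less_imp_le\<close>)
  finally show "norm (iter_pderivative bs (\<lambda>q. g q * h q) p)
      \<le> (2 * (A * B)) ^ (length bs + 1) * M (length bs)"
    unfolding n_def power_mult_distrib by (simp only: mult_ac)
qed

lemma iter_pderivative_const:
  "iter_pderivative bs (\<lambda>_. c) = (\<lambda>_. if bs = [] then c else 0)"
proof (induction bs)
  case (Cons b bs)
  then show ?case by (cases bs) auto
qed simp

text \<open>Derivatives of order at least 2 vanish, so \<open>A\<close> has only to dominate the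
  values on K and the constant first derivatives; M_0 = M_1 = 1.\<close>

lemma CM_bounded_bounded_linear:
  assumes "regular_sequence M" "bounded_linear g" "bounded K"
  shows "\<exists>A\<ge>1. CM_bounded M A g K"
proof -
  obtain B where B: "B > 0" "\<And>v. norm (g v) \<le> norm v * B"
    using bounded_linear.pos_bounded[OF assms(2)] by blast
  obtain R where R: "R > 0" "\<And>p. p \<in> K \<Longrightarrow> norm p \<le> R"
    using assms(3) by (auto simp: bounded_pos)
  define A where "A = 1 + B + R * B"
  have A: "A \<ge> 1" "B \<le> A" "R * B \<le> A" using B(1) R(1) by (auto simp: A_def)
  have "norm (iter_pderivative bs g p) \<le> A ^ (length bs + 1) * M (length bs)"
    if bs: "set bs \<subseteq> Basis" and p: "p \<in> K" for bs p
  proof (cases bs rule: rev_cases)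
    case Nil
    have "norm (g p) \<le> R * B"
      using B R p by (meson less_imp_le mult_right_mono order_trans)
    then show ?thesis
      using Nil A(3) regular_sequence_0_1[OF assms(1)] by (simp add: normalized_def)
  next
    case (snoc cs b)
    have "pderivative b g = (\<lambda>_. g b)"
      using pderivative_bounded_linear[OF assms(2)] by (intro ext)
    then have eq: "iter_pderivative bs g p = (if cs = [] then g b else 0)"
      by (simp add: snoc iter_pderivative_const)
    show ?thesis
    proof (cases "cs = []")
      case True
      have "norm (g b) \<le> A" using B(2)[of b] A(2) bs snoc by simp
      also have "\<dots> \<le> A ^ 2 * 1" using A(1) by (simp add: power2_eq_square)
      finally show ?thesis
        unfolding eq using True snoc regular_sequence_0_1[OF assms(1)]
        by (simp add: normalized_def power2_eq_square)
    next
      case False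
      then show ?thesis
        using eq A(1) regular_sequence_pos(1)[OF assms(1), of "length bs"] by simp
    qed
  qed
  with A(1) show ?thesis by (auto simp: CM_bounded_def)
qed

section \<open>Complex analysis in the jet variables, leading to bounds on all derivatives of
  f\<close>

section \<open>Functions that are holomorphic in the last variables\<close>

text \<open>The index \<^term>\<open>None\<close> stands for \<open>t\<close> among the real variables \<open>(x, t)\<close> and for \<open>\<zeta>\<^sub>0\<close> among
  the complex variables \<open>(\<zeta>\<^sub>0, \<zeta>)\<close>.\<close>

type_synonym 'n jet = "((real^'n) \<times> real) \<times> (complex \<times> (complex^'n))"

definition xdir :: "'n option \<Rightarrow> 'n::finite jet" where
  "xdir i = (case i of None \<Rightarrow> ((0, 1), 0) | Some j \<Rightarrow> ((axis j 1, 0), 0))"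

text \<open>The scalar argument lets \<open>zdir i 1\<close> and \<open>zdir i \<i>\<close> be the
  two real basis vectors of one complex coordinate.\<close>

definition zdir :: "'n option \<Rightarrow> complex \<Rightarrow> 'n::finite jet" where
  "zdir i c = (case i of None \<Rightarrow> (0, (c, 0)) | Some j \<Rightarrow> (0, (0, axis j c)))"

definition xcoord :: "'n option \<Rightarrow> 'n::finite jet \<Rightarrow> real" where
  "xcoord i v = (case i of None \<Rightarrow> snd (fst v) | Some j \<Rightarrow> fst (fst v) $ j)"

definition zcoord :: "'n option \<Rightarrow> 'n::finite jet \<Rightarrow> complex" where
  "zcoord i v = (case i of None \<Rightarrow> fst (snd v) | Some j \<Rightarrow> snd (snd v) $ j)"

lemma sum_UNIV_option:
  fixes F :: "'n::finite option \<Rightarrow> 'b::comm_monoid_add"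
  shows "(\<Sum>i\<in>UNIV. F i) = F None + (\<Sum>j\<in>UNIV. F (Some j))"
  by (simp add: UNIV_option_conv sum.reindex)

lemma xdir_Basis: "xdir i \<in> Basis"
  by (auto simp: xdir_def Basis_prod_def axis_in_Basis_iff zero_prod_def split: option.split)

lemma zdir_Basis: "zdir i 1 \<in> Basis" "zdir i \<i> \<in> Basis"
  by (auto simp: zdir_def Basis_prod_def axis_in_Basis_iff zero_prod_def Basis_complex_def split: option.split)

lemma Basis_jet:
  assumes "b \<in> Basis"
  shows "(\<exists>i. b = xdir i) \<or> (\<exists>i. b = zdir i 1 \<or> b = zdir i \<i>)"
proof -
  consider (t) "b = ((0, 1), 0)" | (x) j where "b = ((axis j 1, 0), 0)"
    | (z0) c where "b = (0, (c, 0))" "c \<in> {1, \<i>}" | (z) j c where "b = (0, (0, axis j c))" "c \<in> {1, \<i>}"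
    using assms by (auto simp: Basis_prod_def Basis_vec_def zero_prod_def Basis_complex_def)
  then show ?thesis
  proof cases
    case t
    then have "b = xdir None" by (simp add: xdir_def)
    then show ?thesis by blast
  next
    case (x j)
    then have "b = xdir (Some j)" by (simp add: xdir_def)
    then show ?thesis by blast
  next
    case (z0 c)
    then have "b = zdir None c" by (simp add: zdir_def)
    then show ?thesis using z0 by blast
  next
    case (z j c)
    then have "b = zdir (Some j) c" by (simp add: zdir_def)
    then show ?thesis using z by blast
  qed
qed

lemma zdir_Re_Im: "zdir i c = Re c *\<^sub>R zdir i 1 + Im c *\<^sub>R zdir i \<i>"
proof -
  have c: "c = Re c *\<^sub>R 1 + Im c *\<^sub>R \<i>"
    by (simp add: complex_eq_iff)
  show ?thesis
    by (subst c) (auto simp: zdir_def axis_def vec_eq_iff complex_eq_iff split: option.split)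
qed

lemma bounded_linear_zdir: "bounded_linear (zdir i)"
proof (rule linear_linear[THEN iffD2, OF linearI])
  show "zdir i (a + b) = zdir i a + zdir i b" for a b
    by (subst (1 2 3) zdir_Re_Im) (simp add: algebra_simps)
  show "zdir i (r *\<^sub>R a) = r *\<^sub>R zdir i a" for r a
    by (subst (1 2) zdir_Re_Im) (simp add: algebra_simps)
qed

lemma norm_zdir: "norm (zdir i c) = norm c"
proof -
  have "norm (axis j c) = norm c" for j :: 'a
    unfolding norm_eq_sqrt_inner by (simp only: inner_axis) (simp add: axis_def)
  then show ?thesis by (auto simp: zdir_def norm_Pair split: option.split)
qed

lemma jet_representation:
  "v = (\<Sum>i\<in>UNIV. xcoord i v *\<^sub>R xdir i) + (\<Sum>i\<in>UNIV. zdir i (zcoord i v))"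
proof -
  have x: "(\<Sum>j\<in>UNIV. (a $ j) *\<^sub>R (axis j 1 :: real^'a)) = a" for a :: "real^'a"
    using basis_expansion[of a] by (simp add: scalar_mult_eq_scaleR)
  have z: "(\<Sum>j\<in>UNIV. axis j (w $ j)) = w" for w :: "complex^'a"
    by (simp add: vec_eq_iff axis_def if_distrib cong: if_cong)
  obtain a t w0 w where v: "v = ((a, t), (w0, w))" by (metis prod.collapse)
  have xs: "(\<Sum>i\<in>UNIV. xcoord i v *\<^sub>R xdir i) = ((a, t), (0, 0))"
    unfolding sum_UNIV_option
    by (simp add: v xcoord_def xdir_def prod_eq_iff fst_sum snd_sum x)
  have zs: "(\<Sum>i\<in>UNIV. zdir i (zcoord i v)) = ((0, 0), (w0, w))"
    unfolding sum_UNIV_option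
    by (simp add: v zcoord_def zdir_def prod_eq_iff fst_sum snd_sum z)
  show ?thesis unfolding xs zs by (simp add: v)
qed

text \<open>Holomorphy in (\<zeta>_0, \<zeta>) is encoded by Cauchy-Riemann equations between real
  partial derivatives, a form that passes easily to partial derivatives, sums and products. The
  complex derivative in the variable of index i is then
  \<open>pderivative (zdir i 1)\<close>.\<close>

definition CR_on :: "('n::finite jet \<Rightarrow> complex) \<Rightarrow> 'n jet set \<Rightarrow> bool" where
  "CR_on g S \<longleftrightarrow> smooth_on g S \<and>
     (\<forall>p\<in>S. \<forall>i. pderivative (zdir i \<i>) g p = \<i> * pderivative (zdir i 1) g p)"

lemma CR_onD:
  assumes "CR_on g S"
  shows "smooth_on g S"
    and "p \<in> S \<Longrightarrow> pderivative (zdir i \<i>) g p = \<i> * pderivative (zdir i 1) g p"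
  using assms by (auto simp: CR_on_def)

lemma CR_on_zdir:
  assumes "CR_on g S" "p \<in> S" "(g has_derivative D) (at p)"
  shows "D (zdir i c) = c * pderivative (zdir i 1) g p"
proof -
  interpret D: bounded_linear D
    using assms(3) by (rule has_derivative_bounded_linear)
  have c: "c = of_real (Re c) + \<i> * of_real (Im c)" by (rule complex_eq)
  have "D (zdir i c) = Re c *\<^sub>R pderivative (zdir i 1) g p + Im c *\<^sub>R pderivative (zdir i \<i>) g p"
    by (subst zdir_Re_Im) (simp add: D.add D.scaleR pderivative_eq[OF assms(3)])
  also have "\<dots> = (of_real (Re c) + \<i> * of_real (Im c)) * pderivative (zdir i 1) g p"
    using CR_onD(2)[OF assms(1,2)] by (simp add: scaleR_conv_of_real algebra_simps)
  finally show ?thesis by (simp only: c[symmetric])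
qed

text \<open>Complex increments act by multiplication, so no conjugate derivatives appear, and the
  chain rule along a complex-valued jet looks as it does for real variables.\<close>

lemma CR_on_has_derivative:
  assumes "CR_on g S" "p \<in> S"
  shows "(g has_derivative (\<lambda>v. (\<Sum>i\<in>UNIV. xcoord i v *\<^sub>R pderivative (xdir i) g p)
    + (\<Sum>i\<in>UNIV. zcoord i v * pderivative (zdir i 1) g p))) (at p)"
proof -
  obtain D where D: "(g has_derivative D) (at p)"
    using smooth_on_differentiable[OF CR_onD(1)[OF assms(1)] assms(2)] by (auto simp: differentiable_def)
  interpret D: bounded_linear D
    using D by (rule has_derivative_bounded_linear)
  have x: "D (xdir i) = pderivative (xdir i) g p" for i
    by (simp add: pderivative_eq[OF D])
  have "D v = (\<Sum>i\<in>UNIV. xcoord i v *\<^sub>R pderivative (xdir i) g p)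
    + (\<Sum>i\<in>UNIV. zcoord i v * pderivative (zdir i 1) g p)" for v
  proof -
    have "D v = D ((\<Sum>i\<in>UNIV. xcoord i v *\<^sub>R xdir i) + (\<Sum>i\<in>UNIV. zdir i (zcoord i v)))"
      by (rule arg_cong[OF jet_representation])
    then show ?thesis
      by (simp add: D.add D.sum D.scaleR x CR_on_zdir[OF assms D])
  qed
  then have "D = (\<lambda>v. (\<Sum>i\<in>UNIV. xcoord i v *\<^sub>R pderivative (xdir i) g p)
    + (\<Sum>i\<in>UNIV. zcoord i v * pderivative (zdir i 1) g p))" by (intro ext)
  with D show ?thesis by simp
qed

text \<open>The Cauchy-Riemann equations have constant coefficients and so commute with
  \<open>pderivative b\<close>.\<close>

lemma CR_on_pderivative:
  assumes "open S" "CR_on g S" "b \<in> Basis"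
  shows "CR_on (pderivative b g) S"
  unfolding CR_on_def
proof (intro conjI ballI allI)
  show "smooth_on (pderivative b g) S"
    using CR_onD(1)[OF assms(2)] assms(3) by (rule smooth_on_pderivative)
  fix p i assume p: "p \<in> S"
  have diff: "pderivative (zdir i 1) g differentiable (at p)"
    using smooth_on_pderivative[OF CR_onD(1)[OF assms(2)] zdir_Basis(1)] p by (rule smooth_on_differentiable)
  have "pderivative (zdir i \<i>) (pderivative b g) p = pderivative b (pderivative (zdir i \<i>) g) p"
    using assms p by (intro smooth_on_pderivative_commute[OF assms(1)] CR_onD(1) zdir_Basis)
  also have "\<dots> = pderivative b (\<lambda>q. \<i> * pderivative (zdir i 1) g q) p"
    by (rule pderivative_cong[OF assms(1) p CR_onD(2)[OF assms(2)]])
  also have "\<dots> = \<i> * pderivative b (pderivative (zdir i 1) g) p"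
    using pderivative_mult[OF differentiable_const diff, of b \<i>] by simp
  also have "pderivative b (pderivative (zdir i 1) g) p = pderivative (zdir i 1) (pderivative b g) p"
    using assms p by (intro smooth_on_pderivative_commute[OF assms(1)] CR_onD(1) zdir_Basis)
  finally show "pderivative (zdir i \<i>) (pderivative b g) p = \<i> * pderivative (zdir i 1) (pderivative b g) p" .
qed

lemma CR_on_iter_pderivative:
  "open S \<Longrightarrow> CR_on g S \<Longrightarrow> set bs \<subseteq> Basis \<Longrightarrow> CR_on (iter_pderivative bs g) S"
  by (induction bs) (auto intro: CR_on_pderivative)

lemma CR_on_const: "CR_on (\<lambda>_. c) S"
  by (simp add: CR_on_def smooth_on_const)

lemma CR_on_add:
  assumes "open S" "CR_on g S" "CR_on h S"
  shows "CR_on (\<lambda>q. g q + h q) S"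
  unfolding CR_on_def
proof (intro conjI ballI allI)
  show "smooth_on (\<lambda>q. g q + h q) S" using assms by (simp add: smooth_on_add CR_onD(1))
  fix p i assume p: "p \<in> S"
  have diff: "g differentiable (at p)" "h differentiable (at p)"
    using assms p by (auto intro: smooth_on_differentiable CR_onD(1))
  show "pderivative (zdir i \<i>) (\<lambda>q. g q + h q) p = \<i> * pderivative (zdir i 1) (\<lambda>q. g q + h q) p"
    by (simp add: pderivative_add[OF diff] CR_onD(2)[OF assms(2) p] CR_onD(2)[OF assms(3) p] distrib_left)
qed

lemma CR_on_sum:
  assumes "open S" "\<And>i. i \<in> A \<Longrightarrow> CR_on (g i) S"
  shows "CR_on (\<lambda>q. \<Sum>i\<in>A. g i q) S"
  using assms(2)
  by (induction A rule: infinite_finite_induct) (auto intro: CR_on_const CR_on_add[OF assms(1)])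

lemma CR_on_mult:
  assumes "open S" "CR_on g S" "CR_on h S"
  shows "CR_on (\<lambda>q. g q * h q) S"
  unfolding CR_on_def
proof (intro conjI ballI allI)
  show "smooth_on (\<lambda>q. g q * h q) S" using assms by (simp add: smooth_on_mult CR_onD(1))
  fix p i assume p: "p \<in> S"
  have diff: "g differentiable (at p)" "h differentiable (at p)"
    using assms p by (auto intro: smooth_on_differentiable CR_onD(1))
  show "pderivative (zdir i \<i>) (\<lambda>q. g q * h q) p = \<i> * pderivative (zdir i 1) (\<lambda>q. g q * h q) p"
    by (simp add: pderivative_mult[OF diff] CR_onD(2)[OF assms(2) p] CR_onD(2)[OF assms(3) p] distrib_left mult_ac)
qed

lemma bounded_linear_zcoord: "bounded_linear (zcoord i)"
  unfolding zcoord_def[abs_def]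
  by (cases i) (simp_all add: bounded_linear_compose[OF bounded_linear_fst bounded_linear_snd]
      bounded_linear_compose[OF bounded_linear_vec_nth bounded_linear_compose[OF bounded_linear_snd bounded_linear_snd]])

lemma bounded_linear_xcoord: "bounded_linear (xcoord i)"
  unfolding xcoord_def[abs_def]
  by (cases i) (simp_all add: bounded_linear_compose[OF bounded_linear_snd bounded_linear_fst]
      bounded_linear_compose[OF bounded_linear_vec_nth bounded_linear_compose[OF bounded_linear_fst bounded_linear_fst]])

lemma zcoord_zdir: "zcoord i (zdir j c) = (if i = j then c else 0)"
  by (auto simp: zcoord_def zdir_def axis_def split: option.split)

lemma CR_on_zcoord: "CR_on (zcoord i) S"
  by (auto simp: CR_on_def smooth_on_bounded_linear bounded_linear_zcoord
      pderivative_bounded_linear[OF bounded_linear_zcoord] zcoord_zdir)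

lemma CR_on_xcoord: "CR_on (\<lambda>v. complex_of_real (xcoord i v)) S"
proof -
  have "bounded_linear (\<lambda>v. complex_of_real (xcoord i v))"
    using bounded_linear_of_real bounded_linear_xcoord by (rule bounded_linear_compose)
  moreover have "xcoord i (zdir j c) = 0" for j c
    by (auto simp: xcoord_def zdir_def split: option.split)
  ultimately show ?thesis
    by (auto simp: CR_on_def smooth_on_bounded_linear pderivative_bounded_linear)
qed

text \<open>By uniqueness, the complex-linear derivative of the slice at fixed p is the restriction
  of the real total derivative of f.\<close>

lemma multi_holomorphic_imp_CR_on:
  assumes "smooth_on f (\<Omega> \<times> \<Omega>'')" "\<And>p. p \<in> \<Omega> \<Longrightarrow> multi_holomorphic_on (\<lambda>z. f (p, z)) \<Omega>''"
  shows "CR_on f (\<Omega> \<times> \<Omega>'')"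
  unfolding CR_on_def
proof (intro conjI ballI allI)
  fix P :: "'a jet" and i assume P: "P \<in> \<Omega> \<times> \<Omega>''"
  obtain p z where pz: "P = (p, z)" by (cases P)
  obtain F where F: "(f has_derivative F) (at (p, z))"
    using smooth_on_differentiable[OF assms(1) P] by (auto simp: differentiable_def pz)
  obtain D where D: "((\<lambda>z. f (p, z)) has_derivative D) (at z)"
    and lin: "\<And>c w\<^sub>0 w. D (c * w\<^sub>0, c *s w) = c * D (w\<^sub>0, w)"
    using assms(2)[of p] P unfolding multi_holomorphic_on_def pz by blast
  have "((\<lambda>z. (p, z)) has_derivative (\<lambda>w. (0, w))) (at z)"
    by (auto intro!: derivative_eq_intros)
  from has_derivative_compose[OF this F] have "D = (\<lambda>w. F (0, w))"
    using D has_derivative_unique by blast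
  then have "F (0, (\<i> * w\<^sub>0, \<i> *s w)) = \<i> * F (0, (w\<^sub>0, w))" for w\<^sub>0 w
    using lin by simp
  moreover have "axis j \<i> = \<i> *s axis j 1" for j :: 'a
    by (simp add: vec_eq_iff axis_def)
  ultimately have "F (zdir i \<i>) = \<i> * F (zdir i 1)"
    by (cases i) (auto simp: zdir_def, metis mult_1_right mult_zero_right vector_smult_rzero, metis mult_zero_right)
  then show "pderivative (zdir i \<i>) f P = \<i> * pderivative (zdir i 1) f P"
    using pderivative_eq[OF F] by (simp add: pz)
qed (rule assms(1))

section \<open>Cauchy estimates\<close>

text \<open>Restriction to the complex line through p in direction \<open>zdir i\<close> reduces
  this to the one-variable inequality.\<close>

lemma CR_on_Cauchy_inequality:
  assumes "CR_on g S" "\<rho> > 0"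
    and "\<And>c. norm c \<le> \<rho> \<Longrightarrow> p + zdir i c \<in> S \<and> norm (g (p + zdir i c)) \<le> B"
  shows "norm (pderivative (zdir i 1) g p) \<le> B / \<rho>"
proof -
  define \<phi> where "\<phi> c = g (p + zdir i c)" for c
  have deriv: "(\<phi> has_field_derivative pderivative (zdir i 1) g (p + zdir i c)) (at c)"
    if "norm c \<le> \<rho>" for c
  proof -
    have inS: "p + zdir i c \<in> S" using assms(3) that by blast
    obtain D where D: "(g has_derivative D) (at (p + zdir i c))"
      using smooth_on_differentiable[OF CR_onD(1)[OF assms(1)] inS] by (auto simp: differentiable_def)
    have "((\<lambda>c. p + zdir i c) has_derivative zdir i) (at c)"
      by (auto intro!: derivative_eq_intros bounded_linear_imp_has_derivative bounded_linear_zdir)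
    from has_derivative_compose[OF this D] show ?thesis
      unfolding \<phi>_def[abs_def] has_field_derivative_def
      using CR_on_zdir[OF assms(1) inS D] by (simp add: mult_commute_abs)
  qed
  have "norm ((deriv ^^ 1) \<phi> 0) \<le> fact 1 * B / \<rho> ^ 1"
  proof (rule Cauchy_inequality)
    show "\<phi> holomorphic_on ball 0 \<rho>"
      by (auto simp: holomorphic_on_open intro!: exI deriv)
    show "continuous_on (cball 0 \<rho>) \<phi>"
      using deriv by (auto intro!: continuous_at_imp_continuous_on DERIV_isCont)
    show "norm (\<phi> x) \<le> B" if "norm (0 - x) = \<rho>" for x
      using assms(3)[of x] that by (simp add: \<phi>_def)
  qed (rule assms(2))
  moreover have "deriv \<phi> 0 = pderivative (zdir i 1) g p"
    using DERIV_imp_deriv[OF deriv[of 0]] assms(2) by (simp add: linear_0[OF bounded_linear.linear[OF bounded_linear_zdir]])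
  ultimately show ?thesis by simp
qed

text \<open>Each derivative uses up a distance \<open>\<delta>\<close> in the complex directions.
  Only the norm of the total complex displacement is tracked, so repeated and distinct directions
  are treated alike; an imaginary direction contributes a factor of modulus 1.\<close>

lemma CR_on_iterated_Cauchy_inequality:
  fixes g :: "'a::finite jet \<Rightarrow> complex"
  assumes "open S" "CR_on g S" "\<delta> > 0"
    and "\<forall>b\<in>set bs. \<exists>i. b = zdir i 1 \<or> b = zdir i \<i>"
    and "\<And>w. norm w \<le> real (length bs) * \<delta> \<Longrightarrow> p + (0, w) \<in> S \<and> norm (g (p + (0, w))) \<le> B"
  shows "norm (iter_pderivative bs g p) \<le> B / \<delta> ^ length bs"
  using assms(4,5)
proof (induction bs arbitrary: p)
  case Nil
  then show ?case using Nil(2)[of 0] by (simp flip: zero_prod_def)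
next
  case (Cons b bs)
  define G where "G = iter_pderivative bs g"
  have "set bs \<subseteq> Basis" using Cons.prems(1) zdir_Basis by (metis list.set_intros(2) subsetI)
  then have CR: "CR_on G S" unfolding G_def using assms by (intro CR_on_iter_pderivative)
  obtain i where i: "b = zdir i 1 \<or> b = zdir i \<i>" using Cons.prems(1) by auto
  have zd: "zdir i c = (0, snd (zdir i c))" for c
    by (auto simp: zdir_def split: option.split)
  have small: "norm (snd (zdir i c)) = norm c" for c
    using norm_zdir[of i c] by (subst (asm) zd) (simp add: norm_Pair)
  have "p + zdir i c \<in> S \<and> norm (G (p + zdir i c)) \<le> B / \<delta> ^ length bs" if c: "norm c \<le> \<delta>" for c
  proof
    have shift: "p + zdir i c + (0, w) = p + (0, snd (zdir i c) + w)"
        "norm (snd (zdir i c) + w) \<le> real (length (b # bs)) * \<delta>"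
      if "norm w \<le> real (length bs) * \<delta>" for w
      subgoal by (subst zd) simp
      subgoal using norm_triangle_ineq[of "snd (zdir i c)" w] that c by (simp add: small algebra_simps)
      done
    show "p + zdir i c \<in> S"
      using shift[of 0] Cons.prems(2)[of "snd (zdir i c)"] assms(3) by (simp flip: zero_prod_def)
    show "norm (G (p + zdir i c)) \<le> B / \<delta> ^ length bs"
      unfolding G_def
    proof (rule Cons.IH)
      show "\<forall>b\<in>set bs. \<exists>i. b = zdir i 1 \<or> b = zdir i \<i>" using Cons.prems(1) by (meson list.set_intros(2))
      fix w :: "complex \<times> (complex^'a)" assume w: "norm w \<le> real (length bs) * \<delta>"
      show "p + zdir i c + (0, w) \<in> S \<and> norm (g (p + zdir i c + (0, w))) \<le> B"
        unfolding shift(1)[OF w] using shift(2)[OF w] by (rule Cons.prems(2))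
    qed
  qed
  from CR_on_Cauchy_inequality[OF CR assms(3) this]
  have "norm (pderivative (zdir i 1) G p) \<le> B / \<delta> ^ length (b # bs)"
    by (simp add: field_simps)
  moreover have "p \<in> S" using Cons.prems(2)[of 0] assms(3) by (simp flip: zero_prod_def)
  then have "pderivative (zdir i \<i>) G p = \<i> * pderivative (zdir i 1) G p"
    by (rule CR_onD(2)[OF CR])
  ultimately have "norm (pderivative b G p) \<le> B / \<delta> ^ length (b # bs)"
    using i by (elim disjE) (simp_all add: norm_mult)
  then show ?case by (simp add: G_def)
qed

lemma iter_pderivative_map_fst:
  "iter_pderivative (map (\<lambda>b. (b, 0)) bs) F (q, z) = iter_pderivative bs (\<lambda>q. F (q, z)) q"
proof (induction bs arbitrary: q)
  case (Cons b bs)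
  then show ?case by (simp add: pderivative_def)
qed simp

text \<open>For k derivatives in (x, t) and l complex ones, Cauchy estimates with radius r / l cost
  (l / r)^l, which is at most (e / r)^l l!. Since m_k is increasing, M_k l! is at most M_{k+l}, so
  the complex derivatives fit into the same weights.\<close>

lemma CM_holomorphic_bounded:
  fixes f :: "'n::finite jet \<Rightarrow> complex"
  assumes "regular_sequence M" "open \<Omega>" "open \<Omega>''" "CM_holomorphic_on M f \<Omega> \<Omega>''"
    and "compact K" "K \<subseteq> \<Omega> \<times> \<Omega>''"
  shows "\<exists>B\<ge>1. CM_bounded M B f K"
proof -
  let ?S = "\<Omega> \<times> \<Omega>''"
  have S: "open ?S" using assms by (simp add: open_Times)
  have smooth: "smooth_on f ?S" and hol: "\<And>p. p \<in> \<Omega> \<Longrightarrow> multi_holomorphic_on (\<lambda>z. f (p, z)) \<Omega>''"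
    using assms(4) by (auto simp: CM_holomorphic_on_def)
  have CR: "CR_on f ?S" by (rule multi_holomorphic_imp_CR_on[OF smooth hol])
  obtain r where r: "r > 0" "(\<Union>x\<in>K. cball x r) \<subseteq> ?S"
    using compact_subset_open_imp_cball_epsilon_subset[OF assms(5) S assms(6)] by blast
  \<comment> \<open>K is thickened in the complex directions only, where the Cauchy estimates
    move.\<close>
  define K' where "K' = (\<lambda>(p, w). p + (0, w)) ` (K \<times> cball 0 r)"
  have "compact K'"
    unfolding K'_def case_prod_unfold using assms(5)
    by (intro compact_continuous_image compact_Times continuous_intros) auto
  moreover have "K' \<subseteq> ?S"
  proof -
    have "p + (0, w) \<in> cball p r" if "norm w \<le> r" for p :: "'n jet" and w
      using that by (simp add: dist_norm norm_Pair)
    then show ?thesis using r(2) unfolding K'_def by fastforce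
  qed
  ultimately have "\<exists>A>0. \<forall>bs. set bs \<subseteq> Basis \<longrightarrow>
           (\<forall>(p, z)\<in>K'. cmod (iter_pderivative bs (\<lambda>q. f (q, z)) p)
                          \<le> A ^ (length bs + 1) * M (length bs))"
    using assms(4) by (auto simp: CM_holomorphic_on_def)
  then obtain A where A: "A > 0" "\<And>bs p z. set bs \<subseteq> Basis \<Longrightarrow> (p, z) \<in> K' \<Longrightarrow>
      cmod (iter_pderivative bs (\<lambda>q. f (q, z)) p) \<le> A ^ (length bs + 1) * M (length bs)"
    by blast
  define B where "B = 1 + A + exp 1 / r"
  have B: "B \<ge> 1" "A \<le> B" "exp 1 / r \<le> B"
    using A(1) r(1) by (auto simp: B_def)
  have "norm (iter_pderivative bs f p) \<le> B ^ (length bs + 1) * M (length bs)"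
    if bs: "set bs \<subseteq> Basis" and p: "p \<in> K" for bs p
  proof -
    define P where "P b \<longleftrightarrow> (\<exists>i::'n option. b = zdir i 1 \<or> b = zdir i \<i>)" for b
    define zs where "zs = filter P bs"
    define xs where "xs = filter (\<lambda>b. \<not> P b) bs"
    define l where "l = length zs"
    define k where "k = length xs"
    have len: "length bs = k + l"
      using sum_length_filter_compl[of P bs] by (simp add: l_def k_def zs_def xs_def)
    define g where "g = iter_pderivative xs f"
    have "set xs \<subseteq> Basis" using bs by (auto simp: xs_def)
    then have CRg: "CR_on g ?S" unfolding g_def by (rule CR_on_iter_pderivative[OF S CR])
    have "\<exists>b'\<in>Basis. b = (b', 0)" if "b \<in> set xs" for b
    proof -
      have "\<exists>i. b = xdir i" using Basis_jet[of b] that bs by (auto simp: xs_def P_def)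
      then show ?thesis
        by (auto simp: xdir_def Basis_prod_def axis_in_Basis_iff split: option.splits)
    qed
    then have "\<forall>b\<in>set xs. fst b \<in> Basis \<and> b = (fst b, 0)" by force
    then have xs: "xs = map (\<lambda>b. (b, 0)) (map fst xs)" "set (map fst xs) \<subseteq> Basis"
      by (auto simp: map_idI)
    have gK': "norm (g (p + (0, w))) \<le> A ^ (k + 1) * M k" if "norm w \<le> r" for w
    proof -
      have "p + (0, w) \<in> K'" using that p by (force simp: K'_def)
      moreover obtain q z where qz: "p + (0, w) = (q, z)" by (cases "p + (0, w)")
      moreover have "g (q, z) = iter_pderivative (map fst xs) (\<lambda>q. f (q, z)) q"
        unfolding g_def by (subst xs(1)) (rule iter_pderivative_map_fst)
      ultimately show ?thesis
        using A(2)[OF xs(2), of q z] by (simp add: k_def)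
    qed
    \<comment> \<open>The available distance r is shared equally among the l complex derivatives;
      \<open>max 1 l\<close> covers l = 0.\<close>
    define \<delta> where "\<delta> = r / real (max 1 l)"
    have \<delta>: "\<delta> > 0" "real l * \<delta> \<le> r"
      using r(1) by (auto simp: \<delta>_def field_simps max_def)
    have "norm (iter_pderivative zs g p) \<le> A ^ (k + 1) * M k / \<delta> ^ length zs"
    proof (rule CR_on_iterated_Cauchy_inequality[OF S CRg \<delta>(1)])
      show "\<forall>b\<in>set zs. \<exists>i. b = zdir i 1 \<or> b = zdir i \<i>" by (simp add: zs_def P_def)
      fix w :: "complex \<times> (complex^'n)" assume "norm w \<le> real (length zs) * \<delta>"
      then have w: "norm w \<le> r" using \<delta> by (simp add: l_def)
      have "p + (0, w) \<in> K'" using w p by (force simp: K'_def)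
      with \<open>K' \<subseteq> ?S\<close> gK'[OF w] show "p + (0, w) \<in> ?S \<and> norm (g (p + (0, w))) \<le> A ^ (k + 1) * M k"
        by blast
    qed
    moreover have "iter_pderivative bs f p = iter_pderivative zs g p"
      using iter_pderivative_filter[OF S smooth _ bs, of p P] p assms(6)
      by (auto simp: zs_def g_def xs_def)
    ultimately have "norm (iter_pderivative bs f p) \<le> A ^ (k + 1) * M k / \<delta> ^ l"
      by (simp add: l_def)
    also have "\<dots> = A ^ (k + 1) * M k * (real (max 1 l) / r) ^ l"
      by (simp add: \<delta>_def power_divide)
    also have "\<dots> \<le> A ^ (k + 1) * M k * ((exp 1 / r) ^ l * fact l)"
    proof -
      \<comment> \<open>A single term of the exponential series at l yields l^l \<le> e^l
        l!.\<close>
      have "(\<Sum>n\<in>{l}. inverse (fact n) *\<^sub>R real l ^ n) \<le> exp (real l)"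
        unfolding exp_def by (intro sum_le_suminf summable_exp_generic) auto
      then have "real l ^ l / fact l \<le> exp (real l)"
        by (simp add: divide_inverse mult.commute)
      then have "real (max 1 l) ^ l \<le> exp 1 ^ l * fact l"
        by (cases "l = 0") (auto simp: max_def field_simps exp_of_nat_mult[symmetric])
      then have "(real (max 1 l) / r) ^ l \<le> (exp 1 / r) ^ l * fact l"
        using r(1) by (simp add: power_divide field_simps)
      then show ?thesis
        using A(1) regular_sequence_pos(1)[OF assms(1), of k] by (intro mult_left_mono) auto
    qed
    also have "\<dots> = A ^ (k + 1) * (exp 1 / r) ^ l * (M k * fact l)" by simp
    also have "\<dots> \<le> B ^ (k + 1) * B ^ l * M (k + l)"
    proof (intro mult_mono power_mono B)
      have "M k * fact l = fact k * fact l * (normalized M k * 1)"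
        by (simp add: fact_mult_normalized[of _ M, symmetric])
      also have "\<dots> \<le> fact (k + l) * (normalized M (k + l))"
      proof (intro mult_mono)
        show "fact k * fact l \<le> (fact (k + l) :: real)"
          using fact_fact_dvd_fact[of k l] by (metis dvd_imp_le fact_gt_zero of_nat_fact of_nat_le_iff of_nat_mult)
        show "normalized M k * 1 \<le> normalized M (k + l)"
          using normalized_mono[OF assms(1), of k "k + l"] by simp
      qed (use regular_sequence_pos(2)[OF assms(1), of k] in auto)
      finally show "M k * fact l \<le> M (k + l)" by (simp add: fact_mult_normalized)
    qed (use A(1) B r(1) regular_sequence_pos(1)[OF assms(1), of k] in auto)
    finally show ?thesis by (simp add: len power_add algebra_simps)
  qed
  with B(1) show ?thesis by (auto simp: CM_bounded_def)
qed

section \<open>Resummation: from a formal power series in t to an actual function\<close>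

section \<open>Series of functions of class \<open>C\<^sup>1\<close>\<close>

lemma Ck_on_1_iff:
  "Ck_on 1 g S \<longleftrightarrow> (\<forall>p\<in>S. g differentiable (at p)) \<and> (\<forall>b\<in>Basis. continuous_on S (pderivative b g))"
  by (simp add: One_nat_def)

lemma Ck_on_Un:
  "open S \<Longrightarrow> open T \<Longrightarrow> Ck_on k g S \<Longrightarrow> Ck_on k g T \<Longrightarrow> Ck_on k g (S \<union> T)"
  by (induction k arbitrary: g) (auto simp: continuous_on_open_Un)

text \<open>The Weierstrass test gives uniform convergence of the series of each partial derivative;
  the finitely many limits are assembled into a total derivative on a small ball.\<close>

lemma Ck_on_1_series:
  fixes v :: "nat \<Rightarrow> 'a::euclidean_space \<Rightarrow> 'b::banach"
  assumes "open S" and C1: "\<And>k. Ck_on 1 (v k) S" and "summable B"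
    and v_le: "\<And>k p. p \<in> S \<Longrightarrow> norm (v k p) \<le> B k"
    and dv_le: "\<And>k p b. p \<in> S \<Longrightarrow> b \<in> Basis \<Longrightarrow> norm (pderivative b (v k) p) \<le> B k"
  shows "Ck_on 1 (\<lambda>p. \<Sum>k. v k p) S"
    and "\<And>p b. p \<in> S \<Longrightarrow> b \<in> Basis \<Longrightarrow>
      pderivative b (\<lambda>p. \<Sum>k. v k p) p = (\<Sum>k. pderivative b (v k) p)"
proof -
  let ?d = "\<lambda>b p. \<Sum>k. pderivative b (v k) p"
  have unif: "uniform_limit S (\<lambda>n p. \<Sum>k<n. pderivative b (v k) p) (?d b) sequentially" if "b \<in> Basis" for b
    using dv_le that assms(3) by (intro Weierstrass_m_test) auto
  have der: "((\<lambda>p. \<Sum>k. v k p) has_derivative (\<lambda>h. \<Sum>b\<in>Basis. (h \<bullet> b) *\<^sub>R ?d b p)) (at p)"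
    if p: "p \<in> S" for p
  proof -
    obtain r where r: "r > 0" "ball p r \<subseteq> S"
      using assms(1) p open_contains_ball by blast
    have "\<exists>G. \<forall>x\<in>ball p r. (\<lambda>n. v n x) sums G x \<and>
        (G has_derivative (\<lambda>h. \<Sum>b\<in>Basis. (h \<bullet> b) *\<^sub>R ?d b x)) (at x within ball p r)"
    proof (rule has_derivative_series)
      fix n x assume "x \<in> ball p r"
      then have "v n differentiable (at x)" using C1 r by (auto simp: Ck_on_1_iff)
      from has_derivative_pderivative[OF this]
      show "(v n has_derivative (\<lambda>h. \<Sum>b\<in>Basis. (h \<bullet> b) *\<^sub>R pderivative b (v n) x)) (at x within ball p r)"
        by (rule has_derivative_at_withinI)
    next
      fix e :: real assume "e > 0"
      then have "e / DIM('a) > 0" by simp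
      then have "\<forall>\<^sub>F n in sequentially. \<forall>x\<in>S. dist (\<Sum>k<n. pderivative b (v k) x) (?d b x) < e / DIM('a)"
        if "b \<in> Basis" for b
        using unif[OF that] by (simp add: uniform_limit_iff)
      then have "\<forall>\<^sub>F n in sequentially. \<forall>b\<in>Basis. \<forall>x\<in>S.
          dist (\<Sum>k<n. pderivative b (v k) x) (?d b x) < e / DIM('a)"
        by (simp add: eventually_ball_finite_distrib)
      then show "\<forall>\<^sub>F n in sequentially. \<forall>x\<in>ball p r. \<forall>h.
          norm ((\<Sum>k<n. \<Sum>b\<in>Basis. (h \<bullet> b) *\<^sub>R pderivative b (v k) x)
            - (\<Sum>b\<in>Basis. (h \<bullet> b) *\<^sub>R ?d b x)) \<le> e * norm h"
      proof (eventually_elim, intro ballI allI)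
        fix n x and h :: 'a
        assume *: "\<forall>b\<in>Basis. \<forall>x\<in>S. dist (\<Sum>k<n. pderivative b (v k) x) (?d b x) < e / DIM('a)"
          and x: "x \<in> ball p r"
        have "(\<Sum>k<n. \<Sum>b\<in>Basis. (h \<bullet> b) *\<^sub>R pderivative b (v k) x)
            - (\<Sum>b\<in>Basis. (h \<bullet> b) *\<^sub>R ?d b x)
          = (\<Sum>b\<in>Basis. (h \<bullet> b) *\<^sub>R ((\<Sum>k<n. pderivative b (v k) x) - ?d b x))"
          by (subst sum.swap) (simp add: scaleR_right.sum sum_subtractf scaleR_diff_right)
        also have "norm \<dots> \<le> (\<Sum>b\<in>(Basis::'a set). norm h * (e / DIM('a)))"
        proof (rule sum_norm_le)
          fix b :: 'a assume b: "b \<in> Basis"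
          have "norm ((\<Sum>k<n. pderivative b (v k) x) - ?d b x) \<le> e / DIM('a)"
            using * b x r by (auto simp: dist_norm less_imp_le)
          then show "norm ((h \<bullet> b) *\<^sub>R ((\<Sum>k<n. pderivative b (v k) x) - ?d b x)) \<le> norm h * (e / DIM('a))"
            unfolding norm_scaleR by (intro mult_mono Basis_le_norm[OF b]) auto
        qed
        also have "\<dots> = e * norm h" by simp
        finally show "norm ((\<Sum>k<n. \<Sum>b\<in>Basis. (h \<bullet> b) *\<^sub>R pderivative b (v k) x)
            - (\<Sum>b\<in>Basis. (h \<bullet> b) *\<^sub>R ?d b x)) \<le> e * norm h" .
      qed
    next
      show "p \<in> ball p r" using r by simp
      show "(\<lambda>n. v n p) sums (\<Sum>k. v k p)"
        by (rule summable_sums[OF summable_comparison_test'[OF assms(3) v_le[OF p]]])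
    qed simp
    then obtain G where G: "\<forall>x\<in>ball p r. (\<lambda>n. v n x) sums G x \<and>
        (G has_derivative (\<lambda>h. \<Sum>b\<in>Basis. (h \<bullet> b) *\<^sub>R ?d b x)) (at x within ball p r)" ..
    have pr: "p \<in> ball p r" using r(1) by simp
    have "(G has_derivative (\<lambda>h. \<Sum>b\<in>Basis. (h \<bullet> b) *\<^sub>R ?d b p)) (at p)"
      using bspec[OF G pr] unfolding at_within_open[OF pr open_ball] by (rule conjunct2)
    then show ?thesis
    proof (rule has_derivative_transform_within_open[OF _ open_ball pr])
      show "G x = (\<Sum>k. v k x)" if "x \<in> ball p r" for x
        by (rule sums_unique[OF conjunct1[OF bspec[OF G that]]])
    qed
  qed
  show eq: "pderivative b (\<lambda>p. \<Sum>k. v k p) p = ?d b p" if "p \<in> S" "b \<in> Basis" for p b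
    using pderivative_eq[OF der[OF that(1)], of b] that(2)
    by (simp add: inner_Basis if_distrib[of "\<lambda>x. x *\<^sub>R _"] cong: if_cong)
  have cont: "continuous_on S (?d b)" if b: "b \<in> Basis" for b
    using C1 b by (intro uniform_limit_theorem[OF _ unif[OF b]])
      (auto simp: Ck_on_1_iff intro!: always_eventually continuous_on_sum)
  have "continuous_on S (pderivative b (\<lambda>p. \<Sum>k. v k p))" if "b \<in> Basis" for b
    by (rule continuous_on_eq[OF cont[OF that]]) (simp add: eq that)
  then show "Ck_on 1 (\<lambda>p. \<Sum>k. v k p) S"
    unfolding Ck_on_1_iff using differentiableI[OF der] by blast
qed

lemma Ck_on_1_of_real_snd:
  fixes w :: "real \<Rightarrow> real"
  assumes "\<And>t. (w has_real_derivative w' t) (at t)" "continuous_on UNIV w'"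
  shows "Ck_on 1 (\<lambda>p :: 'a::euclidean_space \<times> real. complex_of_real (w (snd p))) S"
    and "pderivative b (\<lambda>p :: 'a \<times> real. complex_of_real (w (snd p))) p = of_real (snd b * w' (snd p))"
proof -
  have "((\<lambda>p :: 'a \<times> real. w (snd p)) has_derivative (\<lambda>h. w' (snd p) * snd h)) (at p)" for p
    using has_derivative_compose[OF has_derivative_snd[OF has_derivative_ident]
      assms(1)[unfolded has_field_derivative_def]] .
  then have der: "((\<lambda>p :: 'a \<times> real. complex_of_real (w (snd p))) has_derivative
      (\<lambda>h. complex_of_real (w' (snd p) * snd h))) (at p)" for p
    by (rule has_derivative_of_real)
  show eq: "pderivative b (\<lambda>p :: 'a \<times> real. complex_of_real (w (snd p))) p = of_real (snd b * w' (snd p))" for b p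
    using pderivative_eq[OF der] by (simp add: mult.commute)
  have "continuous_on S (\<lambda>p :: 'a \<times> real. complex_of_real (snd b * w' (snd p)))" for b :: "'a \<times> real"
    by (intro continuous_intros continuous_on_compose2[OF assms(2)]) auto
  then have "continuous_on S (pderivative b (\<lambda>p :: 'a \<times> real. complex_of_real (w (snd p))))" for b
    unfolding eq[abs_def] .
  then show "Ck_on 1 (\<lambda>p :: 'a \<times> real. complex_of_real (w (snd p))) S"
    unfolding Ck_on_1_iff using differentiableI[OF der] by blast
qed

section \<open>Cutoff functions\<close>

text \<open>The square of the positive part is a simple C^1 function that vanishes on a half-line;
  two nested copies give the cutoff.\<close>

lemma DERIV_max_0_power2: "((\<lambda>y :: real. (max 0 y)\<^sup>2) has_real_derivative 2 * max 0 y) (at y)"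
proof (cases y "0 :: real" rule: linorder_cases)
  case less
  have "((\<lambda>y :: real. (max 0 y)\<^sup>2) has_real_derivative 0) (at y)"
    by (rule has_field_derivative_transform_within_open[where f = "\<lambda>_. 0" and S = "{..<0}"])
      (use less in auto)
  then show ?thesis using less by simp
next
  case equal
  have "((\<lambda>h. (max 0 h)\<^sup>2 / h) \<longlongrightarrow> (0 :: real)) (at 0)"
  proof (rule Lim_null_comparison)
    show "\<forall>\<^sub>F h in at 0. norm ((max 0 h)\<^sup>2 / h) \<le> \<bar>h :: real\<bar>"
      by (rule always_eventually) (auto simp: max_def power2_eq_square)
    show "((\<lambda>h. \<bar>h\<bar>) \<longlongrightarrow> (0 :: real)) (at 0)"
      by (auto intro!: tendsto_eq_intros)
  qed
  then show ?thesis using equal by (simp add: DERIV_def)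
next
  case greater
  have "((\<lambda>y :: real. y\<^sup>2) has_real_derivative 2 * y) (at y)"
    by (auto intro!: derivative_eq_intros)
  then have "((\<lambda>y :: real. (max 0 y)\<^sup>2) has_real_derivative 2 * y) (at y)"
    by (rule has_field_derivative_transform_within_open[where S = "{0<..}"]) (use greater in auto)
  then show ?thesis using greater by simp
qed

lemma cutoff_exists:
  "\<exists>\<phi> \<phi>' :: real \<Rightarrow> real. (\<forall>s. (\<phi> has_real_derivative \<phi>' s) (at s)) \<and> continuous_on UNIV \<phi>' \<and>
    (\<forall>s. 0 \<le> \<phi> s \<and> \<phi> s \<le> 1) \<and> (\<forall>s. \<bar>s\<bar> \<le> 1 \<longrightarrow> \<phi> s = 1 \<and> \<phi>' s = 0) \<and>
    (\<forall>s. \<bar>s\<bar> \<ge> 2 \<longrightarrow> \<phi> s = 0 \<and> \<phi>' s = 0) \<and> (\<exists>B>0. \<forall>s. \<bar>\<phi>' s\<bar> \<le> B)"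
proof -
  \<comment> \<open>Normalized so that y \<le> 0 for \<open>\<bar>s\<bar> \<le> 1\<close> and y
    \<ge> 1 for \<open>\<bar>s\<bar> \<ge> 2\<close>: these become the two plateaus.\<close>
  define y where "y s = (s\<^sup>2 - 1) / 3" for s :: real
  define \<phi> where "\<phi> s = (max 0 (1 - (max 0 (y s))\<^sup>2))\<^sup>2" for s
  define \<phi>' where "\<phi>' s = 2 * max 0 (1 - (max 0 (y s))\<^sup>2) * (- (2 * max 0 (y s) * (2 * s / 3)))" for s
  have der: "(\<phi> has_real_derivative \<phi>' s) (at s)" for s
  proof -
    have "(y has_real_derivative 2 * s / 3) (at s)"
      unfolding y_def[abs_def] by (auto intro!: derivative_eq_intros)
    from DERIV_diff[OF DERIV_const[of 1] DERIV_chain2[OF DERIV_max_0_power2 this]]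
    have "((\<lambda>s. 1 - (max 0 (y s))\<^sup>2) has_real_derivative - (2 * max 0 (y s) * (2 * s / 3))) (at s)"
      by simp
    then show ?thesis
      unfolding \<phi>_def[abs_def] \<phi>'_def by (rule DERIV_chain2[OF DERIV_max_0_power2])
  qed
  have cont: "continuous_on UNIV \<phi>'"
    unfolding \<phi>'_def[abs_def] y_def by (intro continuous_intros) auto
  have small: "\<phi> s = 1 \<and> \<phi>' s = 0" if "\<bar>s\<bar> \<le> 1" for s
  proof -
    have "s\<^sup>2 \<le> 1" using that by (simp add: abs_square_le_1)
    then show ?thesis by (simp add: \<phi>_def \<phi>'_def y_def)
  qed
  have large: "\<phi> s = 0 \<and> \<phi>' s = 0" if "\<bar>s\<bar> \<ge> 2" for s
  proof -
    have "s\<^sup>2 \<ge> 2\<^sup>2" using that by (metis abs_numeral abs_le_square_iff)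
    then have "y s \<ge> 1" by (simp add: y_def)
    then have "(max 0 (y s))\<^sup>2 \<ge> 1" by (simp add: max_def)
    then show ?thesis by (simp add: \<phi>_def \<phi>'_def)
  qed
  have range: "0 \<le> \<phi> s \<and> \<phi> s \<le> 1" for s
    by (auto simp: \<phi>_def intro!: power_le_one)
  have "compact (\<phi>' ` {-2..2})"
    using cont by (intro compact_continuous_image) (auto intro: continuous_on_subset)
  then have "bounded (\<phi>' ` {-2..2})" by (rule compact_imp_bounded)
  then obtain B where B: "B > 0" "\<And>s. s \<in> {-2..2} \<Longrightarrow> \<bar>\<phi>' s\<bar> \<le> B"
    by (auto simp: bounded_pos)
  have "\<bar>\<phi>' s\<bar> \<le> B" for s
  proof (cases "\<bar>s\<bar> \<ge> 2")
    case False
    then have "s \<in> {-2..2}" unfolding atLeastAtMost_iff by linarith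
    then show ?thesis by (rule B(2))
  qed (use B(1) large in simp)
  then show ?thesis using der cont small large range B(1) by blast
qed

section \<open>Lower bounds for the function \<open>h\<close>\<close>

text \<open>m_k / m_i is a product of k - i quotients of index below k, each at most
  \<open>ratio M k\<close>.\<close>

lemma normalized_le_ratio_power:
  assumes "regular_sequence M" "i \<le> k"
  shows "normalized M k \<le> normalized M i * ratio M k ^ (k - i)"
  using assms(2)
proof (induction k rule: dec_induct)
  case (step k)
  have "normalized M (Suc k) \<le> (normalized M i * ratio M k ^ (k - i)) * ratio M k"
    using step ratio_ge_1[OF assms(1), of k] by (simp add: normalized_Suc[OF assms(1)])
  also have "\<dots> \<le> (normalized M i * ratio M (Suc k) ^ (k - i)) * ratio M (Suc k)"
    using monoD[OF ratio_mono[OF assms(1)], of k "Suc k"] ratio_ge_1[OF assms(1), of k]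
      regular_sequence_pos(2)[OF assms(1), of i]
    by (intro mult_mono mult_left_mono power_mono) auto
  finally show ?case using step by (simp add: Suc_diff_le mult_ac)
qed simp

text \<open>m_{k+d} / m_k is a product of d quotients of index at least k.\<close>

lemma ratio_power_le_normalized:
  assumes "regular_sequence M"
  shows "normalized M k * ratio M k ^ d \<le> normalized M (k + d)"
proof (induction d)
  case (Suc d)
  have "normalized M k * ratio M k ^ Suc d = (normalized M k * ratio M k ^ d) * ratio M k"
    by simp
  also have "\<dots> \<le> normalized M (k + d) * ratio M (k + d)"
    using Suc monoD[OF ratio_mono[OF assms], of k "k + d"] ratio_ge_1[OF assms, of k]
      regular_sequence_pos(2)[OF assms, of "k + d"]
    by (intro mult_mono) auto
  finally show ?case by (simp add: normalized_Suc[OF assms])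
qed simp

text \<open>The range of r is where the cutoffs of index k and k + 1 can differ. Every term m_j
  (\<gamma> r)^j of the infimum is compared with P^k m_k r^k. Below k, the removed factors are at
  most 1 by the upper bound on r; beyond k + 1, the added factors are at least 1 by the lower bound.
  The step from k to k + 1 may lose up to C^(k+1).\<close>

lemma h_fun_lower_bound:
  assumes reg: "regular_sequence M" and C: "C \<ge> 1" "\<And>k. ratio M k \<le> C ^ k"
    and "P \<ge> 1" "c > 0" "2 * c * P \<le> 1"
    and r: "c / ratio M (Suc k) \<le> r" "r \<le> 2 * c / ratio M k"
  shows "P ^ k * normalized M k * r ^ k \<le> C * h_fun M ((P * C + 1 / c) * r)"
proof -
  \<comment> \<open>\<open>P * C\<close> makes up for C^k, lost in the step from k to k + 1;
    \<open>1 / c\<close> turns the lower bound on r into factors that are at least 1.\<close>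
  define \<gamma> where "\<gamma> = P * C + 1 / c"
  have \<mu>: "ratio M i > 0" for i using ratio_ge_1[OF reg, of i] by linarith
  have m: "normalized M i > 0" for i by (rule regular_sequence_pos(2)[OF reg])
  have r0: "r > 0" using r(1) \<mu>[of "Suc k"] \<open>c > 0\<close> by (meson divide_pos_pos less_le_trans)
  have PC: "P \<le> P * C" using C(1) \<open>P \<ge> 1\<close> by simp
  have \<gamma>: "P \<le> \<gamma>" "P * C \<le> \<gamma>" "1 / c \<le> \<gamma>" "\<gamma> > 0"
    using C(1) \<open>P \<ge> 1\<close> \<open>c > 0\<close> PC by (auto simp: \<gamma>_def intro: add_increasing2 add_pos_pos)
  have "P ^ k * normalized M k * r ^ k / C \<le> normalized M j * (\<gamma> * r) ^ j" for j
  proof (cases "j \<le> k")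
    case True
    have "P * (ratio M k * r) \<le> P * (2 * c)"
      using r(2) \<mu>[of k] \<open>P \<ge> 1\<close> by (intro mult_left_mono) (auto simp: field_simps)
    then have small: "P * (ratio M k * r) \<le> 1" using assms(6) by (simp add: algebra_simps)
    have "P ^ k * normalized M k * r ^ k / C \<le> P ^ k * normalized M k * r ^ k"
      using mult_left_mono[OF C(1), of "P ^ k * normalized M k * r ^ k"] m[of k] r0 \<open>P \<ge> 1\<close> C(1)
      by (simp add: pos_divide_le_eq)
    also have "\<dots> \<le> P ^ k * (normalized M j * ratio M k ^ (k - j)) * r ^ k"
      using normalized_le_ratio_power[OF reg True] r0 \<open>P \<ge> 1\<close> by (intro mult_right_mono mult_left_mono) auto
    also have "\<dots> = normalized M j * (P * r) ^ j * (P * (ratio M k * r)) ^ (k - j)"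
      using power_add[of P j "k - j"] power_add[of r j "k - j"] True by (simp add: power_mult_distrib mult_ac)
    also have "\<dots> \<le> normalized M j * (P * r) ^ j * 1"
      using small \<mu>[of k] r0 \<open>P \<ge> 1\<close> m[of j] by (intro mult_left_mono power_le_one) auto
    also have "\<dots> \<le> normalized M j * (\<gamma> * r) ^ j * 1"
      using \<gamma> r0 \<open>P \<ge> 1\<close> m[of j] by (intro mult_left_mono mult_right_mono power_mono) auto
    finally show ?thesis by simp
  next
    case False
    then obtain d where j: "j = Suc k + d" using less_iff_Suc_add by (metis add_Suc not_le)
    have rc: "c \<le> ratio M (Suc k) * r" using r(1) \<mu>[of "Suc k"] by (simp add: field_simps)
    have "P ^ k * normalized M k * r ^ k / C = (P * C) ^ k * normalized M k * r ^ k * (1 / C ^ Suc k)"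
      using C(1) by (simp add: power_mult_distrib field_simps)
    also have "\<dots> \<le> \<gamma> ^ k * normalized M k * r ^ k * (ratio M k * (\<gamma> * r))"
    proof (intro mult_mono power_mono \<gamma>)
      \<comment> \<open>The factor leading from k to k + 1: \<open>ratio M k\<close> may be far
        below \<open>ratio M (Suc k)\<close>, so the crude bounds 1 and C^(k+1) are used for
        them.\<close>
      have "1 / C ^ Suc k \<le> 1 / ratio M (Suc k)"
        using C(2)[of "Suc k"] \<mu>[of "Suc k"] by (intro divide_left_mono) auto
      also have "\<dots> \<le> 1 * (1 / c * (c / ratio M (Suc k)))" using \<open>c > 0\<close> by simp
      also have "\<dots> \<le> ratio M k * (\<gamma> * r)"
        using ratio_ge_1[OF reg, of k] \<gamma> r(1) \<open>c > 0\<close> \<mu>[of "Suc k"] by (intro mult_mono) auto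
      finally show "1 / C ^ Suc k \<le> ratio M k * (\<gamma> * r)" .
    qed (use m[of k] r0 \<open>P \<ge> 1\<close> C(1) \<gamma> in auto)
    also have "\<dots> = (\<gamma> ^ k * normalized M k * r ^ k * (ratio M k * (\<gamma> * r))) * 1" by simp
    also have "\<dots> \<le> (\<gamma> ^ k * normalized M k * r ^ k * (ratio M k * (\<gamma> * r))) * (\<gamma> * (ratio M (Suc k) * r)) ^ d"
    proof (intro mult_left_mono one_le_power)
      have "1 / c * c \<le> \<gamma> * (ratio M (Suc k) * r)"
        using \<gamma> rc \<open>c > 0\<close> by (intro mult_mono) auto
      then show "1 \<le> \<gamma> * (ratio M (Suc k) * r)" using \<open>c > 0\<close> by simp
    qed (use m[of k] r0 \<gamma> \<mu>[of k] in auto)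
    also have "\<dots> = (normalized M (Suc k) * ratio M (Suc k) ^ d) * (\<gamma> * r) ^ j"
      by (simp add: j normalized_Suc[OF reg] power_add power_mult_distrib mult_ac)
    also have "\<dots> \<le> normalized M j * (\<gamma> * r) ^ j"
      unfolding j using ratio_power_le_normalized[OF reg, of "Suc k" d] \<gamma> r0 by (intro mult_right_mono) auto
    finally show ?thesis .
  qed
  then have "P ^ k * normalized M k * r ^ k / C \<le> h_fun M (\<gamma> * r)"
    unfolding h_fun_def by (intro cINF_greatest) auto
  then show ?thesis using C(1) by (simp add: \<gamma>_def field_simps)
qed

section \<open>Summation of a formal solution\<close>

text \<open>Summation by parts: what survives the cancellation is weighted by differences of
  consecutive cutoffs, apart from one boundary term. In use, \<open>e k\<close> is (- t)^k / k! and
  \<open>d k\<close> its derivative.\<close>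

lemma sum_telescope:
  fixes e \<theta> G :: "nat \<Rightarrow> 'a::comm_ring_1"
  assumes "d 0 = 0" "\<And>k. d (Suc k) = - e k"
  shows "(\<Sum>k<Suc n. d k * \<theta> k * G k + e k * \<theta> k * G (Suc k))
    = (\<Sum>k<Suc n. e k * (\<theta> k - \<theta> (Suc k)) * G (Suc k)) + e n * \<theta> (Suc n) * G (Suc n)"
proof (induction n)
  case 0
  then show ?case by (simp add: assms algebra_simps)
next
  case (Suc n)
  show ?case
    by (subst sum.lessThan_Suc, subst Suc.IH, subst (2) sum.lessThan_Suc)
      (simp add: assms algebra_simps del: sum.lessThan_Suc)
qed

lemma DERIV_power_div_fact:
  "((\<lambda>t. (- t) ^ k / fact k) has_real_derivative (case k of 0 \<Rightarrow> 0 | Suc j \<Rightarrow> - ((- t) ^ j / fact j))) (at t)"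
proof (cases k)
  case (Suc j)
  have "((\<lambda>t :: real. - t) has_real_derivative - 1) (at t)"
    by (auto intro!: derivative_eq_intros)
  from DERIV_cdivide[OF DERIV_power_Suc[OF this, of j], of "fact (Suc j)"]
  have "((\<lambda>t. (- t) ^ Suc j / fact (Suc j)) has_real_derivative (1 + real j) * (- 1 * (- t) ^ j) / fact (Suc j)) (at t)" .
  moreover have "(1 + real j) * (- 1 * (- t) ^ j) / fact (Suc j) = - ((- t) ^ j / fact j)"
  proof -
    have "1 + real j \<noteq> 0" by linarith
    then show ?thesis
      by (simp only: fact_Suc of_nat_Suc mult_divide_mult_cancel_left) simp
  qed
  ultimately show ?thesis by (simp add: Suc)
qed simp

text \<open>The summation problem cut loose from the jet space: the vector field enters only through
  the recursion, and the bounds are uniform over U and a strip around t = 0.\<close>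

locale formal_solution =
  fixes M :: "nat \<Rightarrow> real" and U :: "(real^'n) set" and I :: "real set"
    and a :: "'n \<Rightarrow> (real^'n) \<times> real \<Rightarrow> complex" and g :: "nat \<Rightarrow> (real^'n) \<times> real \<Rightarrow> complex"
    and Q \<delta>\<^sub>0 :: real
  assumes reg: "regular_sequence M" and open_U: "open U" and open_I: "open I"
    and \<delta>\<^sub>0: "\<delta>\<^sub>0 > 0" "{-\<delta>\<^sub>0..\<delta>\<^sub>0} \<subseteq> I"
    and C1: "\<And>k. Ck_on 1 (g k) (U \<times> I)"
    and rec: "\<And>k p. p \<in> U \<times> I \<Longrightarrow> vector_field a (g k) p = g (Suc k) p"
    and Q: "Q \<ge> 1"
    and g_le: "\<And>k x t. x \<in> U \<Longrightarrow> \<bar>t\<bar> \<le> \<delta>\<^sub>0 \<Longrightarrow> norm (g k (x, t)) \<le> Q ^ (k + 1) * M k"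
    and dg_le: "\<And>k x t b. x \<in> U \<Longrightarrow> \<bar>t\<bar> \<le> \<delta>\<^sub>0 \<Longrightarrow> b \<in> Basis \<Longrightarrow>
      norm (pderivative b (g k) (x, t)) \<le> Q ^ (k + 1) * M k"
begin

text \<open>Each term is supported in a strip inside \<open>U \<times> I\<close>, so it extends by
  zero to all real t. The constants come out uniform on U and therefore serve every compact
  subset.\<close>

lemma exists_sum:
  "\<exists>v. Ck_on 1 v (U \<times> UNIV) \<and> (\<forall>x\<in>U. v (x, 0) = g 0 (x, 0)) \<and>
    (\<exists>A>0. \<exists>\<gamma>>0. \<exists>\<delta>>0. {-\<delta>..\<delta>} \<subseteq> I \<and> (\<forall>x\<in>U. \<forall>t. 0 < \<bar>t\<bar> \<and> \<bar>t\<bar> \<le> \<delta> \<longrightarrow>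
      cmod (vector_field a v (x, t)) \<le> A * h_fun M (\<gamma> * \<bar>t\<bar>)))"
proof -
  obtain C where C: "C \<ge> 1" "\<And>k. ratio M k \<le> C ^ k"
    using ratio_le_power[OF reg] by blast
  obtain \<phi> \<phi>' :: "real \<Rightarrow> real" and B where
    der_\<phi>: "\<And>s. (\<phi> has_real_derivative \<phi>' s) (at s)" and cont_\<phi>': "continuous_on UNIV \<phi>'"
    and \<phi>_range: "\<And>s. 0 \<le> \<phi> s" "\<And>s. \<phi> s \<le> 1"
    and \<phi>_small: "\<And>s. \<bar>s\<bar> \<le> 1 \<Longrightarrow> \<phi> s = 1" "\<And>s. \<bar>s\<bar> \<le> 1 \<Longrightarrow> \<phi>' s = 0"
    and \<phi>_large: "\<And>s. \<bar>s\<bar> \<ge> 2 \<Longrightarrow> \<phi> s = 0" "\<And>s. \<bar>s\<bar> \<ge> 2 \<Longrightarrow> \<phi>' s = 0"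
    and B: "B > 0" "\<And>s. \<bar>\<phi>' s\<bar> \<le> B"
    using cutoff_exists by blast
  \<comment> \<open>\<open>Q\<close> comes from the bounds on \<open>g k\<close> and
    \<open>C\<close> from m_{k+1} \<le> C^k m_k. Of the 4, one factor 2 absorbs k + 1 \<le> 2^k and
    the other leaves a summable (1/2)^k.\<close>
  define P where "P = 4 * Q * C"
  have QP: "4 * Q \<le> P" using Q C(1) by (simp add: P_def)
  have P: "P \<ge> 1" using Q QP by linarith
  \<comment> \<open>The first entry keeps all supports in the strip where the bounds hold; the
    second gives \<open>2 * c * P \<le> 1\<close>, used both for convergence and for
    \<open>h_fun_lower_bound\<close>.\<close>
  define c where "c = min (\<delta>\<^sub>0 / 2) (1 / (2 * P))"
  have c: "c > 0" "2 * c \<le> \<delta>\<^sub>0" using \<delta>\<^sub>0(1) P by (auto simp: c_def)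
  have "c * (2 * P) \<le> 1 / (2 * P) * (2 * P)"
    using P by (intro mult_right_mono) (auto simp: c_def)
  then have cP: "2 * c * P \<le> 1" using P by (simp add: mult.commute mult.left_commute)
  have cQ: "2 * c * Q \<le> 1 / 4"
    using cP mult_left_mono[OF QP, of "2 * c"] c(1) by linarith
  define \<mu> where "\<mu> = ratio M"
  have \<mu>: "\<mu> k \<ge> 1" "\<mu> k > 0" for k
    using ratio_ge_1[OF reg, of k] by (auto simp: \<mu>_def)
  have m: "normalized M k > 0" for k by (rule regular_sequence_pos(2)[OF reg])
  have m_Suc: "normalized M (Suc k) = normalized M k * \<mu> k" for k
    by (simp add: \<mu>_def normalized_Suc[OF reg])
  have mono_\<mu>: "\<mu> j \<le> \<mu> k" if "j \<le> k" for j k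
    using monoD[OF ratio_mono[OF reg] that] by (simp add: \<mu>_def)

  \<comment> \<open>Weights of the series and their supports\<close>
  define e where "e k t = (- t) ^ k / fact k" for k and t :: real
  define d where "d k t = (case k of 0 \<Rightarrow> 0 | Suc j \<Rightarrow> - e j t)" for k and t :: real
  define \<theta> where "\<theta> k t = \<phi> (t * \<mu> k / c)" for k t
  define \<theta>' where "\<theta>' k t = \<phi>' (t * \<mu> k / c) * (\<mu> k / c)" for k t
  define w where "w k t = e k t * \<theta> k t" for k t
  define w' where "w' k t = d k t * \<theta> k t + e k t * \<theta>' k t" for k t
  define v where "v k p = complex_of_real (w k (snd p)) * g k p" for k p

  have arg_large: "\<bar>t * \<mu> k / c\<bar> \<ge> 2" if "\<bar>t\<bar> \<ge> 2 * c / \<mu> k" for k t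
    using that c(1) \<mu>(2)[of k] by (simp add: abs_mult field_simps)
  have arg_small: "\<bar>t * \<mu> k / c\<bar> \<le> 1" if "\<bar>t\<bar> \<le> c / \<mu> k" for k t
    using that c(1) \<mu>(2)[of k] by (simp add: abs_mult field_simps)
  have \<theta>_large: "\<theta> k t = 0" "\<theta>' k t = 0" if "\<bar>t\<bar> \<ge> 2 * c / \<mu> k" for k t
    using \<phi>_large arg_large[OF that] by (auto simp: \<theta>_def \<theta>'_def)
  have \<theta>_small: "\<theta> k t = 1" "\<theta>' k t = 0" if "\<bar>t\<bar> \<le> c / \<mu> k" for k t
    using \<phi>_small arg_small[OF that] by (auto simp: \<theta>_def \<theta>'_def)
  have w_large: "w k t = 0" "w' k t = 0" if "\<bar>t\<bar> \<ge> 2 * c / \<mu> k" for k t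
    using \<theta>_large[OF that] by (auto simp: w_def w'_def)
  have \<theta>_range: "0 \<le> \<theta> k t" "\<theta> k t \<le> 1" for k t
    using \<phi>_range by (auto simp: \<theta>_def)
  have \<theta>'_le: "\<bar>\<theta>' k t\<bar> \<le> B * (\<mu> k / c)" for k t
    using B c(1) \<mu>(2)[of k] unfolding \<theta>'_def abs_mult by (intro mult_mono) auto
  have \<tau>_le: "2 * c / \<mu> k \<le> 2 * c" for k
    using \<mu>[of k] c(1) by (simp add: divide_le_eq mult_le_cancel_left1)

  have der_e: "(e k has_real_derivative d k t) (at t)" for k t
    using DERIV_power_div_fact[of k t] unfolding e_def[abs_def] d_def .
  have der_\<theta>: "(\<theta> k has_real_derivative \<theta>' k t) (at t)" for k t
  proof -
    have "((\<lambda>t. t * \<mu> k / c) has_real_derivative \<mu> k / c) (at t)"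
      using c(1) by (auto intro!: derivative_eq_intros)
    from DERIV_chain2[OF der_\<phi> this] show ?thesis unfolding \<theta>_def[abs_def] \<theta>'_def .
  qed
  have der_w: "(w k has_real_derivative w' k t) (at t)" for k t
    using DERIV_mult[OF der_e[of k t] der_\<theta>[of k t]] unfolding w_def[abs_def] w'_def
    by (simp add: algebra_simps)
  have cont_e: "continuous_on UNIV (e k)" for k
    unfolding e_def[abs_def] by (intro continuous_intros) auto
  have cont_w': "continuous_on UNIV (w' k)" for k
  proof -
    have "continuous_on UNIV (d k)"
      using cont_e by (cases k) (auto simp: d_def[abs_def] intro: continuous_intros)
    moreover have "continuous_on UNIV (\<theta> k)"
      using der_\<theta> by (meson DERIV_continuous_on has_field_derivative_at_within)
    moreover have "continuous_on UNIV (\<theta>' k)"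
      unfolding \<theta>'_def[abs_def] using c(1)
      by (intro continuous_intros continuous_on_compose2[OF cont_\<phi>']) auto
    ultimately show ?thesis
      unfolding w'_def[abs_def] using cont_e by (intro continuous_intros)
  qed

  \<comment> \<open>Regularity of the single terms\<close>
  have C1_w: "Ck_on 1 (\<lambda>p. complex_of_real (w k (snd p))) S" for k and S :: "((real^'n) \<times> real) set"
    using der_w cont_w' by (rule Ck_on_1_of_real_snd(1))
  have pd_w: "pderivative b (\<lambda>p :: (real^'n) \<times> real. complex_of_real (w k (snd p))) p = of_real (snd b * w' k (snd p))"
    for b k p
    using der_w cont_w' by (rule Ck_on_1_of_real_snd(2))
  have open_UI: "open (U \<times> I)" using open_U open_I by (rule open_Times)

  have pd_v_in: "pderivative b (v k) p
      = of_real (snd b * w' k (snd p)) * g k p + of_real (w k (snd p)) * pderivative b (g k) p"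
    if "p \<in> U \<times> I" for b k p
  proof -
    have "(\<lambda>p. complex_of_real (w k (snd p))) differentiable (at p)" "g k differentiable (at p)"
      using C1_w[of k "U \<times> I"] C1[of k] that unfolding Ck_on_1_iff by blast+
    from pderivative_mult[OF this] show ?thesis unfolding v_def[abs_def] pd_w .
  qed
  \<comment> \<open>An open set on which the k-th term is identically zero. With
    \<open>U \<times> I\<close> it covers \<open>U \<times> UNIV\<close>, so regularity is checked
    on the two pieces separately.\<close>
  define T where "T k = U \<times> {t. \<bar>t\<bar> > 2 * c / \<mu> k}" for k
  have open_T: "open (T k)" for k
    unfolding T_def by (intro open_Times open_U open_Collect_less continuous_intros)
  have v_T: "v k p = 0" if "p \<in> T k" for k p
    using that w_large by (auto simp: T_def v_def)
  have pd_v_T: "pderivative b (v k) p = 0" if "p \<in> T k" for b k p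
    using pderivative_cong[OF open_T that v_T, where b = b] by simp
  have in_I: "t \<in> I" if "\<bar>t\<bar> \<le> 2 * c" for t
    using that c(2) \<delta>\<^sub>0(2) by (auto simp: abs_le_iff)
  have cover: "U \<times> UNIV = U \<times> I \<union> T k" for k
  proof -
    have "t \<in> I \<or> \<bar>t\<bar> > 2 * c / \<mu> k" for t
      using in_I \<tau>_le[of k] by force
    then show ?thesis by (auto simp: T_def)
  qed
  have C1_v: "Ck_on 1 (v k) (U \<times> UNIV)" for k
  proof -
    have "Ck_on 1 (v k) (T k) \<longleftrightarrow> Ck_on 1 (\<lambda>_. 0 :: complex) (T k)"
      by (rule Ck_on_cong[OF open_T v_T])
    then have "Ck_on 1 (v k) (T k)" by (simp only: Ck_on_const)
    moreover have "Ck_on 1 (v k) (U \<times> I)"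
      unfolding v_def[abs_def] by (rule Ck_on_mult[OF open_UI C1_w C1])
    ultimately show ?thesis
      unfolding cover[of k] by (intro Ck_on_Un open_UI open_T)
  qed

  \<comment> \<open>Geometric bounds for the terms and their first derivatives\<close>
  have t_pow: "\<bar>t\<bar> ^ k * normalized M (Suc k) \<le> (2 * c) ^ k" if "\<bar>t\<bar> \<le> 2 * c / \<mu> k" for k t
  proof -
    \<comment> \<open>m_{k+1} is a product of k + 1 quotients, the first of which is 1. The index
      gained this way pays for the factor \<open>\<mu> k\<close> that the derivative of the cutoff
      produces.\<close>
    have "normalized M (Suc k) \<le> \<mu> k ^ k"
    proof (cases k)
      case (Suc j)
      have "normalized M (Suc j) \<le> normalized M (Suc 0) * \<mu> (Suc j) ^ j"
        using normalized_le_ratio_power[OF reg, of "Suc 0" "Suc j"] by (simp add: \<mu>_def)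
      then have "normalized M (Suc j) * \<mu> (Suc j) \<le> \<mu> (Suc j) ^ j * \<mu> (Suc j)"
        using regular_sequence_0_1[OF reg] \<mu>[of "Suc j"] by (intro mult_right_mono) auto
      then show ?thesis by (simp add: Suc m_Suc[of "Suc j"] mult.commute)
    qed (use regular_sequence_0_1[OF reg] in simp)
    then have "\<bar>t\<bar> ^ k * normalized M (Suc k) \<le> (\<bar>t\<bar> * \<mu> k) ^ k"
      unfolding power_mult_distrib by (intro mult_left_mono) auto
    also have "\<dots> \<le> (2 * c) ^ k"
      using that \<mu>(2)[of k] by (intro power_mono) (auto simp: field_simps)
    finally show ?thesis .
  qed
  \<comment> \<open>The 1 accounts for the weight itself, \<open>(1 + B) / c\<close> for its
    derivative.\<close>
  define D where "D = Q * (1 + (1 + B) / c)"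
  have w_le: "\<bar>w k t\<bar> * M k \<le> (2 * c) ^ k" if "\<bar>t\<bar> \<le> 2 * c / \<mu> k" for k t
  proof -
    have "\<bar>w k t\<bar> * M k = \<theta> k t * (\<bar>t\<bar> ^ k * normalized M k)"
      using \<theta>_range[of k t]
      by (simp add: w_def e_def abs_mult power_abs fact_mult_normalized[of k M, symmetric])
    also have "\<dots> \<le> 1 * (\<bar>t\<bar> ^ k * normalized M (Suc k))"
      using \<theta>_range[of k t] m[of k] normalized_mono[OF reg, of k "Suc k"]
      by (intro mult_mono mult_left_mono) auto
    also have "\<dots> \<le> (2 * c) ^ k" using t_pow[OF that] by simp
    finally show ?thesis .
  qed
  have w'_le: "\<bar>w' k t\<bar> * M k \<le> (1 + B) / c * 2 ^ k * (2 * c) ^ k" if t: "\<bar>t\<bar> \<le> 2 * c / \<mu> k" for k t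
  proof -
    have "\<bar>d k t\<bar> * M k \<le> real k / c * (2 * c) ^ k"
    proof (cases k)
      case (Suc j)
      \<comment> \<open>The derivative of \<open>e k\<close> has degree k - 1, so
        \<open>t_pow\<close> is applied at index j = k - 1, whose range of t is at least as
        large.\<close>
      have "\<bar>t\<bar> \<le> 2 * c / \<mu> j"
        using t mono_\<mu>[of j k] \<mu>(2)[of j] c(1) Suc
        by (elim order_trans) (intro divide_left_mono, auto)
      then have le: "\<bar>t\<bar> ^ j * normalized M (Suc j) \<le> (2 * c) ^ j" by (rule t_pow)
      have "\<bar>d k t\<bar> * M k = real k * (\<bar>t\<bar> ^ j * normalized M (Suc j))"
        by (simp add: Suc d_def e_def abs_mult power_abs fact_mult_normalized[of "Suc j" M, symmetric])
      also have "\<dots> \<le> real k * (2 * c) ^ j" using le by (intro mult_left_mono) auto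
      also have "\<dots> \<le> real k / c * (2 * c) ^ k" using c(1) by (simp add: Suc)
      finally show ?thesis .
    qed (simp add: d_def)
    moreover have "\<bar>e k t * \<theta>' k t\<bar> * M k \<le> B / c * (2 * c) ^ k"
    proof -
      have "\<bar>e k t * \<theta>' k t\<bar> * M k = \<bar>\<theta>' k t\<bar> * (\<bar>t\<bar> ^ k * normalized M k)"
        by (simp add: e_def abs_mult power_abs fact_mult_normalized[of k M, symmetric])
      also have "\<dots> \<le> B * (\<mu> k / c) * (\<bar>t\<bar> ^ k * normalized M k)"
        using \<theta>'_le m[of k] by (intro mult_right_mono) auto
      also have "\<dots> = B / c * (\<bar>t\<bar> ^ k * normalized M (Suc k))" by (simp add: m_Suc)
      also have "\<dots> \<le> B / c * (2 * c) ^ k" using t_pow[OF t] B(1) c(1) by (intro mult_left_mono) auto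
      finally show ?thesis .
    qed
    moreover have "\<bar>w' k t\<bar> * M k \<le> \<bar>d k t\<bar> * M k + \<bar>e k t * \<theta>' k t\<bar> * M k"
    proof -
      have "\<bar>w' k t\<bar> \<le> \<bar>d k t * \<theta> k t\<bar> + \<bar>e k t * \<theta>' k t\<bar>" unfolding w'_def by (rule abs_triangle_ineq)
      also have "\<bar>d k t * \<theta> k t\<bar> \<le> \<bar>d k t\<bar>"
        using \<theta>_range[of k t] by (simp add: abs_mult mult_left_le)
      finally show ?thesis
        using regular_sequence_pos(1)[OF reg, of k] by (simp flip: distrib_right)
    qed
    ultimately have "\<bar>w' k t\<bar> * M k \<le> (real k + B) / c * (2 * c) ^ k"
      by (simp add: add_divide_distrib distrib_right)
    also have "\<dots> \<le> (1 + B) / c * 2 ^ k * (2 * c) ^ k"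
    proof (intro mult_right_mono)
      have "real k \<le> 2 ^ k" using of_nat_less_two_power[of k, where 'a = real] by simp
      moreover have "B * 1 \<le> B * 2 ^ k" using B(1) by (intro mult_left_mono) auto
      ultimately have "real k + B \<le> (1 + B) * 2 ^ k" unfolding distrib_right by linarith
      from divide_right_mono[OF this, of c]
      show "(real k + B) / c \<le> (1 + B) / c * 2 ^ k" using c(1) by simp
    qed (use c(1) in auto)
    finally show ?thesis .
  qed
  \<comment> \<open>\<open>2 * c * Q \<le> 1 / 4\<close> leaves room for the factor 2^k in the bound
    on \<open>w'\<close>.\<close>
  have geometric: "Q ^ (k + 1) * 2 ^ k * (2 * c) ^ k \<le> Q * (1 / 2) ^ k" for k
  proof -
    have "Q ^ (k + 1) * 2 ^ k * (2 * c) ^ k = Q * (2 * (2 * c * Q)) ^ k"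
      by (simp only: power_add power_one_right power_mult_distrib mult_ac)
    also have "\<dots> \<le> Q * (1 / 2) ^ k"
      using cQ c(1) Q by (intro mult_left_mono power_mono) auto
    finally show ?thesis .
  qed
  have w_Q: "\<bar>w k t\<bar> * (Q ^ (k + 1) * M k) \<le> Q * (1 / 2) ^ k" if "\<bar>t\<bar> \<le> 2 * c / \<mu> k" for k t
  proof -
    have "\<bar>w k t\<bar> * (Q ^ (k + 1) * M k) = Q ^ (k + 1) * 1 * (\<bar>w k t\<bar> * M k)" by simp
    also have "\<dots> \<le> Q ^ (k + 1) * 2 ^ k * (2 * c) ^ k"
      using w_le[OF that] Q regular_sequence_pos(1)[OF reg, of k] by (intro mult_mono) auto
    finally show ?thesis using geometric[of k] by linarith
  qed
  have v_le: "norm (v k p) \<le> D * (1 / 2) ^ k"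
    and pd_v_le: "b \<in> Basis \<Longrightarrow> norm (pderivative b (v k) p) \<le> D * (1 / 2) ^ k"
    if pU: "p \<in> U \<times> UNIV" for k p b
  proof -
    obtain x t where p: "p = (x, t)" "x \<in> U" using pU by auto
    have D: "Q \<le> D" "0 \<le> D" using Q B(1) c(1) by (auto simp: D_def)
    have QD: "Q * (1 / 2) ^ k \<le> D * (1 / 2) ^ k" using D(1) by (intro mult_right_mono) auto
    show "norm (v k p) \<le> D * (1 / 2) ^ k"
    proof (cases "p \<in> T k")
      case False
      then have t: "\<bar>t\<bar> \<le> 2 * c / \<mu> k" using p by (auto simp: T_def)
      then have "\<bar>t\<bar> \<le> \<delta>\<^sub>0" using \<tau>_le[of k] c(2) by linarith
      then have "norm (v k p) \<le> \<bar>w k t\<bar> * (Q ^ (k + 1) * M k)"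
        using g_le[OF p(2)] by (simp add: v_def p norm_mult mult_left_mono)
      then show ?thesis using w_Q[OF t] QD by linarith
    qed (use v_T D in auto)
    show "norm (pderivative b (v k) p) \<le> D * (1 / 2) ^ k" if b: "b \<in> Basis"
    proof (cases "p \<in> T k")
      case False
      then have t: "\<bar>t\<bar> \<le> 2 * c / \<mu> k" using p by (auto simp: T_def)
      then have t': "\<bar>t\<bar> \<le> \<delta>\<^sub>0" "t \<in> I" using \<tau>_le[of k] c(2) in_I by (linarith, force)
      have "\<bar>snd b\<bar> \<le> 1" using b by (auto simp: Basis_prod_def)
      have "norm (of_real (snd b * w' k t) * g k (x, t)) = \<bar>snd b\<bar> * (\<bar>w' k t\<bar> * norm (g k (x, t)))"
        by (simp add: norm_mult abs_mult)
      also have "\<dots> \<le> 1 * (\<bar>w' k t\<bar> * (Q ^ (k + 1) * M k))"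
        using g_le[OF p(2) t'(1)] \<open>\<bar>snd b\<bar> \<le> 1\<close> by (intro mult_mono mult_left_mono) auto
      also have "\<dots> = Q ^ (k + 1) * (\<bar>w' k t\<bar> * M k)" by simp
      also have "\<dots> \<le> Q ^ (k + 1) * ((1 + B) / c * 2 ^ k * (2 * c) ^ k)"
        using w'_le[OF t] Q by (intro mult_left_mono) auto
      also have "\<dots> = (1 + B) / c * (Q ^ (k + 1) * 2 ^ k * (2 * c) ^ k)" by simp
      also have "\<dots> \<le> (1 + B) / c * (Q * (1 / 2) ^ k)"
        using geometric B(1) c(1) by (intro mult_left_mono) auto
      finally have 1: "norm (of_real (snd b * w' k t) * g k (x, t)) \<le> (1 + B) / c * (Q * (1 / 2) ^ k)" .
      have 2: "norm (of_real (w k t) * pderivative b (g k) (x, t)) \<le> Q * (1 / 2) ^ k"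
        using order_trans[OF mult_left_mono[OF dg_le[OF p(2) t'(1) b] abs_ge_zero] w_Q[OF t]]
        by (simp only: norm_mult norm_of_real)
      have "norm (pderivative b (v k) p) \<le> (1 + B) / c * (Q * (1 / 2) ^ k) + Q * (1 / 2) ^ k"
        using pd_v_in[of p b k] p t' norm_triangle_mono[OF 1 2] by simp
      also have "\<dots> = D * (1 / 2) ^ k" by (simp add: D_def algebra_simps)
      finally show ?thesis .
    qed (use pd_v_T D in auto)
  qed

  \<comment> \<open>The sum of the series and its initial values\<close>
  define V where "V p = (\<Sum>k. v k p)" for p
  have summ: "summable (\<lambda>k. D * (1 / 2) ^ k)" by (intro summable_mult summable_geometric) auto
  have open_U': "open (U \<times> (UNIV :: real set))" using open_U by (simp add: open_Times)
  have C1_V: "Ck_on 1 V (U \<times> UNIV)"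
    unfolding V_def[abs_def] using v_le pd_v_le by (intro Ck_on_1_series(1)[OF open_U' C1_v summ])
  have pd_V: "pderivative b V p = (\<Sum>k. pderivative b (v k) p)" if "p \<in> U \<times> UNIV" "b \<in> Basis" for b p
    unfolding V_def[abs_def] using v_le pd_v_le that by (intro Ck_on_1_series(2)[OF open_U' C1_v summ])
  have V_0: "V (x, 0) = g 0 (x, 0)" if "x \<in> U" for x
  proof -
    \<comment> \<open>At t = 0 every \<open>e k\<close> with k \<ge> 1 vanishes, and the cutoff of
      index 0 equals 1.\<close>
    have v_0: "v k (x, 0) = (if k = 0 then g 0 (x, 0) else 0)" for k
      using \<theta>_small(1)[of 0 0] c(1) \<mu>(2)[of 0] by (auto simp: v_def w_def e_def)
    have "V (x, 0) = (\<Sum>k\<in>{0}. v k (x, 0))"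
      unfolding V_def by (rule suminf_finite) (simp_all add: v_0)
    then show ?thesis by (simp add: v_0)
  qed

  \<comment> \<open>The error left after applying the vector field\<close>
  define A where "A = 2 * (Q\<^sup>2 * (1 + B / c) * C)"
  \<comment> \<open>The dilation from \<open>h_fun_lower_bound\<close>. In \<open>A\<close>, the 2
    sums a geometric series, \<open>C\<close> comes from that same lemma, and the rest from the two
    kinds of error terms.\<close>
  define \<gamma> where "\<gamma> = P * C + 1 / c"
  have bound: "cmod (vector_field a V (x, t)) \<le> A * h_fun M (\<gamma> * \<bar>t\<bar>)"
    if x: "x \<in> U" and t: "0 < \<bar>t\<bar>" "\<bar>t\<bar> \<le> 2 * c" for x t
  proof -
    define p where "p = (x, t)"
    have p: "p \<in> U \<times> I" using x in_I t by (simp add: p_def)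
    \<comment> \<open>As t is not 0, the quotients eventually exceed
      \<open>2 * c / \<bar>t\<bar>\<close>; all later terms vanish near (x, t), and the derivatives
      of the series there are finite sums.\<close>
    have "\<forall>\<^sub>F k in sequentially. \<mu> k > 2 * c / \<bar>t\<bar>"
      using filterlim_ratio[OF reg] unfolding \<mu>_def filterlim_at_top_dense by blast
    then obtain n where n: "\<And>k. k \<ge> n \<Longrightarrow> \<mu> k > 2 * c / \<bar>t\<bar>"
      unfolding eventually_sequentially by blast
    have nT: "2 * c / \<mu> k < \<bar>t\<bar>" if "k \<ge> n" for k
      using n[OF that] t \<mu>(2)[of k] by (simp add: field_simps)
    have pd_V': "pderivative b V p = (\<Sum>k<Suc n. pderivative b (v k) p)" if "b \<in> Basis" for b
    proof -
      have "pderivative b (v k) p = 0" if "k \<notin> {..<Suc n}" for k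
        using pd_v_T[of p k b] nT[of k] x that by (auto simp: T_def p_def)
      then show ?thesis
        using pd_V[of p b] p that by (subst suminf_finite[symmetric]) auto
    qed
    have basis: "((0, 1) :: (real^'n) \<times> real) \<in> Basis" "((axis j 1, 0) :: (real^'n) \<times> real) \<in> Basis" for j
      by (auto simp: Basis_prod_def axis_in_Basis_iff)
    define G where "G k = g k p" for k
    have vf_v: "vector_field a (v k) p = of_real (w' k t) * G k + of_real (w k t) * G (Suc k)" for k
    proof -
      have "vector_field a (v k) p = of_real (w' k t) * G k + of_real (w k t) * vector_field a (g k) p"
        unfolding vector_field_def pd_v_in[OF p]
        by (simp add: p_def G_def sum_distrib_left algebra_simps)
      then show ?thesis using rec[OF p] by (simp add: G_def)
    qed
    have "vector_field a V p = (\<Sum>k<Suc n. vector_field a (v k) p)"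
      unfolding vector_field_def pd_V'[OF basis(1)] pd_V'[OF basis(2)]
      by (simp only: sum_distrib_left sum.distrib) (subst sum.swap, rule refl)
    also have "\<dots> = (\<Sum>k<Suc n. (of_real (d k t) * of_real (\<theta> k t) * G k + of_real (e k t) * of_real (\<theta> k t) * G (Suc k))
        + of_real (e k t * \<theta>' k t) * G k)"
      unfolding vf_v by (intro sum.cong) (auto simp: w_def w'_def algebra_simps)
    also have "\<dots> = (\<Sum>k<Suc n. of_real (e k t) * (of_real (\<theta> k t) - of_real (\<theta> (Suc k) t)) * G (Suc k))
        + of_real (e n t) * of_real (\<theta> (Suc n) t) * G (Suc n)
        + (\<Sum>k<Suc n. of_real (e k t * \<theta>' k t) * G k)"
      by (subst sum.distrib, subst sum_telescope) (auto simp: d_def)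
    \<comment> \<open>The boundary term drops out because \<open>\<theta> (Suc n)\<close> is already
      0 at t.\<close>
    also have "\<dots> = (\<Sum>k<Suc n. of_real (e k t * (\<theta> k t - \<theta> (Suc k) t)) * G (Suc k) + of_real (e k t * \<theta>' k t) * G k)"
      using \<theta>_large(1)[of "Suc n" t] nT[of "Suc n"] by (simp only: sum.distrib) simp
    finally have eq: "vector_field a V p = \<dots>" .
    have "cmod (of_real (e k t * (\<theta> k t - \<theta> (Suc k) t)) * G (Suc k) + of_real (e k t * \<theta>' k t) * G k)
        \<le> A / 2 * h_fun M (\<gamma> * \<bar>t\<bar>) * (1 / 2) ^ k" (is "?l \<le> ?r") for k
    proof (cases "c / \<mu> (Suc k) \<le> \<bar>t\<bar> \<and> \<bar>t\<bar> \<le> 2 * c / \<mu> k")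
      \<comment> \<open>Outside this range the cutoffs of index k and k + 1 are both 0 or both 1 at
        t, and \<open>\<theta>' k\<close> vanishes, so the term disappears.\<close>
      case False
      have le: "c / \<mu> (Suc k) \<le> c / \<mu> k" "2 * c / \<mu> (Suc k) \<le> 2 * c / \<mu> k"
        using mono_\<mu>[of k "Suc k"] \<mu>(2)[of k] c(1) by (auto intro!: divide_left_mono)
      have "\<theta> k t = \<theta> (Suc k) t \<and> \<theta>' k t = 0"
      proof (cases "c / \<mu> (Suc k) \<le> \<bar>t\<bar>")
        case True
        then have "2 * c / \<mu> k \<le> \<bar>t\<bar>" "2 * c / \<mu> (Suc k) \<le> \<bar>t\<bar>"
          using False le by linarith+
        then show ?thesis using \<theta>_large by simp
      next
        case False
        then have "\<bar>t\<bar> \<le> c / \<mu> k" "\<bar>t\<bar> \<le> c / \<mu> (Suc k)"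
          using le by linarith+
        then show ?thesis using \<theta>_small by simp
      qed
      moreover have "0 \<le> h_fun M (\<gamma> * \<bar>t\<bar>)"
        unfolding h_fun_def using m P C(1) c(1)
        by (intro cINF_greatest) (auto simp: \<gamma>_def less_imp_le)
      ultimately show ?thesis using Q B(1) c(1) C(1) by (simp add: A_def)
    next
      case True
      have t\<^sub>0: "\<bar>t\<bar> \<le> \<delta>\<^sub>0" using t c(2) by linarith
      have G: "norm (G j) \<le> Q ^ (j + 1) * M j" for j
        unfolding G_def p_def by (rule g_le[OF x t\<^sub>0])
      \<comment> \<open>Both error terms reduce to \<open>X\<close>:
        \<open>\<bar>e k t\<bar>\<close> times M_{k+1} is (k + 1) \<open>X\<close>, and the
        derivative of the cutoff turns m_k into m_{k+1} through its factor
        \<open>\<mu> k\<close>.\<close>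
      define X where "X = \<bar>t\<bar> ^ k * normalized M (Suc k)"
      have X: "0 \<le> X" using m[of "Suc k"] by (simp add: X_def)
      have "\<bar>\<theta> k t - \<theta> (Suc k) t\<bar> \<le> 1"
        using \<theta>_range[of k t] \<theta>_range[of "Suc k" t] by linarith
      then have "cmod (of_real (e k t * (\<theta> k t - \<theta> (Suc k) t)) * G (Suc k))
          \<le> (\<bar>e k t\<bar> * 1) * (Q ^ (Suc k + 1) * M (Suc k))"
        unfolding norm_mult norm_of_real abs_mult by (intro mult_mono mult_left_mono G) auto
      also have "\<dots> = Q\<^sup>2 * (real (Suc k) * Q ^ k * X)"
        by (simp add: e_def X_def abs_mult power_abs power2_eq_square fact_mult_normalized[of "Suc k" M, symmetric])
      also have "\<dots> \<le> Q\<^sup>2 * (2 ^ k * Q ^ k * X)"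
      proof (intro mult_left_mono mult_right_mono)
        show "real (Suc k) \<le> 2 ^ k"
          using of_nat_mono[OF Suc_leI[OF less_exp[of k]], where 'a = real]
          by (simp only: of_nat_power of_nat_numeral)
      qed (use Q X in auto)
      finally have 1: "cmod (of_real (e k t * (\<theta> k t - \<theta> (Suc k) t)) * G (Suc k)) \<le> Q\<^sup>2 * (2 ^ k * Q ^ k * X)" .
      have "cmod (of_real (e k t * \<theta>' k t) * G k) \<le> (\<bar>e k t\<bar> * (B * (\<mu> k / c))) * (Q ^ (k + 1) * M k)"
        unfolding norm_mult norm_of_real abs_mult by (intro mult_mono mult_left_mono G \<theta>'_le) (use B(1) \<mu>(2)[of k] c(1) in auto)
      also have "\<dots> = B / c * (Q * Q ^ k * X)"
        by (simp add: e_def X_def abs_mult power_abs m_Suc fact_mult_normalized[of k M, symmetric])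
      also have "\<dots> \<le> B / c * (Q\<^sup>2 * (2 ^ k * Q ^ k * X))"
      proof (intro mult_left_mono)
        have "Q * 1 * (Q ^ k * X) \<le> Q * (Q * 2 ^ k) * (Q ^ k * X)"
          using Q X mult_mono[of 1 Q 1 "2 ^ k"] by (intro mult_right_mono mult_left_mono) auto
        then show "Q * Q ^ k * X \<le> Q\<^sup>2 * (2 ^ k * Q ^ k * X)" by (simp add: power2_eq_square mult_ac)
      qed (use B(1) c(1) in auto)
      finally have 2: "cmod (of_real (e k t * \<theta>' k t) * G k) \<le> B / c * (Q\<^sup>2 * (2 ^ k * Q ^ k * X))" .
      have "2 ^ k * Q ^ k * X \<le> (1 / 2) ^ k * (C * h_fun M (\<gamma> * \<bar>t\<bar>))"
      proof -
        \<comment> \<open>The return from m_{k+1} to m_k costs C^k.\<close>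
        have "2 ^ k * Q ^ k * X \<le> 2 ^ k * Q ^ k * (\<bar>t\<bar> ^ k * (normalized M k * C ^ k))"
          unfolding X_def m_Suc using C(2)[of k] m[of k] Q by (intro mult_left_mono) (auto simp: \<mu>_def)
        also have "\<dots> = (1 / 2) ^ k * (P ^ k * normalized M k * \<bar>t\<bar> ^ k)"
        proof -
          have "(2 :: real) ^ k = (1 / 2) ^ k * 4 ^ k" by (simp flip: power_mult_distrib)
          then show ?thesis by (simp add: P_def power_mult_distrib)
        qed
        also have "\<dots> \<le> (1 / 2) ^ k * (C * h_fun M (\<gamma> * \<bar>t\<bar>))"
          using True h_fun_lower_bound[OF reg C P c(1) cP, of k "\<bar>t\<bar>"]
          by (intro mult_left_mono) (auto simp: \<gamma>_def \<mu>_def)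
        finally show ?thesis .
      qed
      then have "(1 + B / c) * Q\<^sup>2 * (2 ^ k * Q ^ k * X) \<le> (1 + B / c) * Q\<^sup>2 * ((1 / 2) ^ k * (C * h_fun M (\<gamma> * \<bar>t\<bar>)))"
        using B(1) c(1) by (intro mult_left_mono) auto
      moreover have "?l \<le> (1 + B / c) * Q\<^sup>2 * (2 ^ k * Q ^ k * X)"
        using norm_triangle_mono[OF 1 2] by (simp add: algebra_simps)
      ultimately show ?thesis by (simp add: A_def mult_ac)
    qed
    then have "cmod (vector_field a V p) \<le> (\<Sum>k<Suc n. A / 2 * h_fun M (\<gamma> * \<bar>t\<bar>) * (1 / 2) ^ k)"
      unfolding eq by (rule sum_norm_le)
    also have "\<dots> = A / 2 * h_fun M (\<gamma> * \<bar>t\<bar>) * (\<Sum>k<Suc n. (1 / 2) ^ k)"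
      by (simp only: sum_distrib_left)
    also have "\<dots> \<le> A / 2 * h_fun M (\<gamma> * \<bar>t\<bar>) * 2"
    proof (intro mult_left_mono)
      show "(\<Sum>k<Suc n. (1 / 2) ^ k) \<le> (2 :: real)"
        by (simp only: geometric_sum[of "1 / 2 :: real"]) (simp add: field_simps)
      have "0 \<le> h_fun M (\<gamma> * \<bar>t\<bar>)"
        unfolding h_fun_def using m P C(1) c(1)
        by (intro cINF_greatest) (auto simp: \<gamma>_def less_imp_le)
      then show "0 \<le> A / 2 * h_fun M (\<gamma> * \<bar>t\<bar>)" using Q B(1) c(1) C(1) by (simp add: A_def)
    qed
    finally show ?thesis by (simp add: p_def)
  qed
  have "A > 0" "\<gamma> > 0"
    using Q B(1) c(1) C(1) P by (auto simp: A_def \<gamma>_def intro!: mult_pos_pos add_pos_pos)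
  moreover have "{- (2 * c)..2 * c} \<subseteq> I" using in_I by (auto simp: abs_le_iff)
  ultimately have "\<exists>A>0. \<exists>\<gamma>>0. \<exists>\<delta>>0. {-\<delta>..\<delta>} \<subseteq> I \<and> (\<forall>x\<in>U. \<forall>t. 0 < \<bar>t\<bar> \<and> \<bar>t\<bar> \<le> \<delta> \<longrightarrow>
      cmod (vector_field a V (x, t)) \<le> A * h_fun M (\<gamma> * \<bar>t\<bar>))"
    using bound c(1) by (intro exI[of _ A] exI[of _ \<gamma>] exI[of _ "2 * c"] conjI) auto
  with C1_V V_0 show ?thesis by blast
qed

end

section \<open>Growth of the iterates of a first-order operator with coefficients of class
  C^M\<close>

section \<open>Iterates of a first-order operator\<close>

text \<open>The sum is the Leibniz expansion of the n-th derivative at 0 of 1 / (1 - s) times r! /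
  (1 - s)^(r+1), that is, of r! / (1 - s)^(r+2).\<close>

lemma sum_binomial_fact:
  "real (r + 1) * (\<Sum>j\<le>n. real (n choose j) * fact j * fact (r + (n - j))) = fact (r + n + 1)"
proof (induction n)
  case (Suc n)
  have "(\<Sum>j\<le>Suc n. real (Suc n choose j) * fact j * fact (r + (Suc n - j)))
      = fact (r + n + 1) + (\<Sum>j\<le>n. real (Suc n choose Suc j) * fact (Suc j) * fact (r + (n - j)))"
    by (subst sum.atMost_Suc_shift) (simp del: fact_Suc)
  also have "(\<Sum>j\<le>n. real (Suc n choose Suc j) * fact (Suc j) * fact (r + (n - j)))
      = (\<Sum>j\<le>n. real (Suc n) * (real (n choose j) * fact j * fact (r + (n - j))))"
  proof (intro sum.cong refl)
    fix j
    have "real (Suc n choose Suc j) * real (Suc j) = real (Suc n) * real (n choose j)"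
      using Suc_times_binomial[of j n] by (metis mult.commute of_nat_mult)
    then show "real (Suc n choose Suc j) * fact (Suc j) * fact (r + (n - j))
        = real (Suc n) * (real (n choose j) * fact j * fact (r + (n - j)))"
      by (simp only: fact_Suc mult.assoc[symmetric])
  qed
  also have "\<dots> = real (Suc n) * (\<Sum>j\<le>n. real (n choose j) * fact j * fact (r + (n - j)))"
    by (simp only: sum_distrib_left)
  finally have "real (r + 1) * (\<Sum>j\<le>Suc n. real (Suc n choose j) * fact j * fact (r + (Suc n - j)))
      = real (r + 1) * fact (r + n + 1)
        + real (Suc n) * (real (r + 1) * (\<Sum>j\<le>n. real (n choose j) * fact j * fact (r + (n - j))))"
    by (simp only: distrib_left mult.left_commute)
  also have "\<dots> = real (r + 1) * fact (r + n + 1) + real (Suc n) * fact (r + n + 1)"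
    by (simp only: Suc)
  also have "\<dots> = fact (r + Suc n + 1)"
    by (simp add: algebra_simps)
  finally show ?case .
qed simp

lemma iter_pderivative_sum:
  assumes "open S" "\<And>i. i \<in> J \<Longrightarrow> smooth_on (g i) S" "p \<in> S" "set bs \<subseteq> Basis"
  shows "iter_pderivative bs (\<lambda>q. \<Sum>i\<in>J. g i q) p = (\<Sum>i\<in>J. iter_pderivative bs (g i) p)"
  using assms(2)
proof (induction J rule: infinite_finite_induct)
  case (insert i J)
  have "smooth_on (\<lambda>q. \<Sum>i\<in>J. g i q) S"
    using insert by (auto simp: smooth_on_def intro!: Ck_on_sum[OF assms(1)])
  then show ?case
    using insert by (simp add: iter_pderivative_add[OF assms(1) _ _ assms(3,4)])
qed (auto simp: iter_pderivative_const)

definition transport ::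
  "('i \<Rightarrow> 'a \<Rightarrow> 'b::real_normed_algebra_1) \<Rightarrow> ('i \<Rightarrow> 'a) \<Rightarrow> 'i set \<Rightarrow> ('a::euclidean_space \<Rightarrow> 'b) \<Rightarrow> 'a \<Rightarrow> 'b" where
  "transport a b J g q = (\<Sum>i\<in>J. a i q * pderivative (b i) g q)"

lemma smooth_on_transport:
  assumes "open S" "\<And>i. i \<in> J \<Longrightarrow> smooth_on (a i) S" "\<And>i. i \<in> J \<Longrightarrow> b i \<in> Basis" "smooth_on g S"
  shows "smooth_on (transport a b J g) S"
  unfolding transport_def[abs_def] smooth_on_def
proof
  fix k
  show "Ck_on k (\<lambda>q. \<Sum>i\<in>J. a i q * pderivative (b i) g q) S"
    using assms smooth_on_pderivative[OF assms(4)]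
    by (intro Ck_on_sum Ck_on_mult) (auto simp: smooth_on_def)
qed

text \<open>By log-convexity the bound is that of the analytic model problem: the constants are the
  derivatives at 0 of the iterates of \<open>N A / (1 - A s) d/ds\<close> applied to \<open>A / (1 - A s)\<close>.\<close>

lemma iter_pderivative_transport_le:
  fixes a :: "'i \<Rightarrow> 'a::euclidean_space \<Rightarrow> 'b::real_normed_algebra_1"
  assumes reg: "regular_sequence M" and S: "open S" and K: "K \<subseteq> S"
    and a: "\<And>i. i \<in> J \<Longrightarrow> smooth_on (a i) S" "\<And>i. i \<in> J \<Longrightarrow> CM_bounded M A (a i) K"
    and b: "\<And>i. i \<in> J \<Longrightarrow> b i \<in> Basis"
    and g: "smooth_on g S" "CM_bounded M A g K" and A: "A \<ge> 1"
    and p: "p \<in> K" and "set bs \<subseteq> Basis"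
  shows "norm (iter_pderivative bs ((transport a b J ^^ k) g) p)
    \<le> A * (real (card J) * A\<^sup>2) ^ k * A ^ length bs * (fact (2 * k + length bs) / (2 ^ k * fact k))
      * normalized M (length bs + k)"
  using \<open>set bs \<subseteq> Basis\<close>
proof (induction k arbitrary: bs)
  case 0
  then show ?case
    using g(2) p by (auto simp: CM_bounded_def fact_mult_normalized mult.assoc)
next
  case (Suc k)
  define G where "G = (transport a b J ^^ k) g"
  define n where "n = length bs"
  define c where "c = A * (real (card J) * A\<^sup>2) ^ k / (2 ^ k * fact k)"
  have c: "c \<ge> 0" using A by (simp add: c_def)
  have pS: "p \<in> S" using p K by auto
  have smooth_G: "smooth_on G S"
    unfolding G_def by (induction k) (auto intro!: smooth_on_transport[OF S] a b g)
  have term_le: "norm (iter_pderivative bs (\<lambda>q. a i q * pderivative (b i) G q) p)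
      \<le> c * A ^ (n + 2) * normalized M (n + Suc k) * (fact (2 * k + n + 2) / real (2 * k + 2))"
    if i: "i \<in> J" for i
  proof -
    \<comment> \<open>The derivative along \<open>b i\<close> counts as one more entry of the list;
      it raises the factorial and the index of m by one.\<close>
    have IH: "norm (iter_pderivative cs (pderivative (b i) G) p)
        \<le> c * A ^ (length cs + 1) * fact (2 * k + 1 + length cs) * normalized M (length cs + 1 + k)"
      if "set cs \<subseteq> Basis" for cs
      using Suc.IH[of "cs @ [b i]"] that b[OF i] by (simp add: G_def c_def mult_ac)
    have "norm (iter_pderivative bs (\<lambda>q. a i q * pderivative (b i) G q) p)
        \<le> (\<Sum>j\<le>n. real (n choose j) * (A ^ (j + 1) * M j)
            * (c * A ^ (n - j + 1) * fact (2 * k + 1 + (n - j)) * normalized M (n - j + 1 + k)))"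
      unfolding n_def
    proof (rule iter_pderivative_mult_le[OF S pS a(1)[OF i]])
      show "smooth_on (pderivative (b i) G) S" by (rule smooth_on_pderivative[OF smooth_G b[OF i]])
      show "norm (iter_pderivative cs (a i) p) \<le> A ^ (length cs + 1) * M (length cs)"
        if "set cs \<subseteq> Basis" for cs
        using a(2)[OF i] that p by (auto simp: CM_bounded_def)
      show "set bs \<subseteq> Basis" by fact
    qed (rule IH)
    \<comment> \<open>Log-convexity merges the two weights into m_{n+k+1}, so that only the
      factorials of the model problem stay under the sum.\<close>
    also have "\<dots> \<le> (\<Sum>j\<le>n. c * A ^ (n + 2) * normalized M (n + Suc k)
        * (real (n choose j) * fact j * fact (2 * k + 1 + (n - j))))"
    proof (rule sum_mono)
      fix j assume "j \<in> {..n}"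
      then have j: "j \<le> n" by simp
      have "real (n choose j) * (A ^ (j + 1) * M j)
            * (c * A ^ (n - j + 1) * fact (2 * k + 1 + (n - j)) * normalized M (n - j + 1 + k))
          = (c * A ^ (n + 2) * (real (n choose j) * fact j * fact (2 * k + 1 + (n - j))))
            * (normalized M j * normalized M (n - j + 1 + k))"
      proof -
        have "A ^ (n + 2) = A ^ (j + 1) * A ^ (n - j + 1)"
          using j by (simp flip: power_add)
        then show ?thesis by (simp only: fact_mult_normalized[of j M, symmetric] mult_ac)
      qed
      also have "\<dots> \<le> (c * A ^ (n + 2) * (real (n choose j) * fact j * fact (2 * k + 1 + (n - j))))
            * normalized M (n + Suc k)"
        using normalized_mult_le[OF reg, of j "n - j + 1 + k"] j c A by (intro mult_left_mono) auto
      finally show "real (n choose j) * (A ^ (j + 1) * M j)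
            * (c * A ^ (n - j + 1) * fact (2 * k + 1 + (n - j)) * normalized M (n - j + 1 + k))
          \<le> c * A ^ (n + 2) * normalized M (n + Suc k)
            * (real (n choose j) * fact j * fact (2 * k + 1 + (n - j)))"
        by (simp only: mult_ac)
    qed
    also have "\<dots> = c * A ^ (n + 2) * normalized M (n + Suc k)
        * (\<Sum>j\<le>n. real (n choose j) * fact j * fact (2 * k + 1 + (n - j)))"
      by (simp only: sum_distrib_left)
    also have "(\<Sum>j\<le>n. real (n choose j) * fact j * fact (2 * k + 1 + (n - j)))
        = fact (2 * k + n + 2) / real (2 * k + 2)"
      using sum_binomial_fact[of "2 * k + 1" n] by (simp add: field_simps del: fact_Suc)
    finally show ?thesis .
  qed
  have "iter_pderivative bs ((transport a b J ^^ Suc k) g) p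
      = iter_pderivative bs (\<lambda>q. \<Sum>i\<in>J. a i q * pderivative (b i) G q) p"
    by (simp add: G_def transport_def[abs_def])
  also have "\<dots> = (\<Sum>i\<in>J. iter_pderivative bs (\<lambda>q. a i q * pderivative (b i) G q) p)"
    using smooth_on_pderivative[OF smooth_G b] a(1)
    by (intro iter_pderivative_sum[OF S _ pS Suc.prems] smooth_on_mult[OF S])
  also have "norm \<dots> \<le> (\<Sum>i\<in>J. c * A ^ (n + 2) * normalized M (n + Suc k) * (fact (2 * k + n + 2) / real (2 * k + 2)))"
    by (rule sum_norm_le) (rule term_le)
  also have "\<dots> = A * (real (card J) * A\<^sup>2) ^ Suc k * A ^ n * (fact (2 * Suc k + n) / (2 ^ Suc k * fact (Suc k)))
      * normalized M (n + Suc k)"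
  proof -
    have eq: "2 * Suc k + n = 2 * k + n + 2" by simp
    have "(2 :: real) ^ Suc k * fact (Suc k) = 2 ^ k * fact k * real (2 * k + 2)"
      by (simp add: algebra_simps)
    then show ?thesis
      unfolding eq by (simp only: c_def sum_constant power_add power_Suc power2_eq_square)
        (simp add: field_simps del: fact_Suc)
  qed
  finally show ?case by (simp only: n_def)
qed

text \<open>The left side is the product of the odd numbers below 2 k, estimated through the central
  binomial coefficient. Thus k iterations cost a single k! up to geometric factors, and k! m_k =
  M_k.\<close>

lemma fact_double_le: "fact (2 * k) / (2 ^ k * fact k) \<le> 2 ^ k * (fact k :: real)"
proof -
  have "fact (2 * k) = real (2 * k choose k) * (fact k * fact k)"
    using binomial_fact[of k "2 * k", where 'a = real] by (simp add: field_simps)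
  also have "\<dots> \<le> 2 ^ (2 * k) * (fact k * fact k)"
    using of_nat_mono[OF binomial_le_pow2[of "2 * k" k], where 'a = real] by (intro mult_right_mono) auto
  finally show ?thesis
    by (simp add: field_simps power_mult power2_eq_square power_mult_distrib[symmetric])
qed

text \<open>Orders 0 and 1 are what the C^1 summation needs; at order 1 the weight m_{k+1} is
  brought back to m_k at the cost of C^k.\<close>

lemma transport_iterate_le:
  fixes a :: "'i \<Rightarrow> 'a::euclidean_space \<Rightarrow> 'b::real_normed_algebra_1"
  assumes reg: "regular_sequence M" and "open S" "K \<subseteq> S" "finite J" "J \<noteq> {}"
    and "\<And>i. i \<in> J \<Longrightarrow> smooth_on (a i) S" "\<And>i. i \<in> J \<Longrightarrow> CM_bounded M A (a i) K"
    and "\<And>i. i \<in> J \<Longrightarrow> b i \<in> Basis"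
    and "smooth_on g S" "CM_bounded M A g K" and A: "A \<ge> 1"
  shows "\<exists>E\<ge>1. \<forall>k. \<forall>p\<in>K. norm ((transport a b J ^^ k) g p) \<le> E ^ (k + 1) * M k \<and>
    (\<forall>e\<in>Basis. norm (pderivative e ((transport a b J ^^ k) g) p) \<le> E ^ (k + 1) * M k)"
proof -
  obtain C where C: "C \<ge> 1" "\<And>k. ratio M k \<le> C ^ k"
    using ratio_le_power[OF reg] by blast
  define N where "N = real (card J)"
  have N: "N \<ge> 1" using assms(4,5) by (simp add: N_def Suc_leI card_gt_0_iff)
  have A2: "A\<^sup>2 \<ge> 1" using A by (simp add: one_le_power)
  have NA: "N * A\<^sup>2 \<ge> 1" using mult_mono[OF N A2] N by simp
  \<comment> \<open>One constant for both orders: 6 is 2 from the factorials times 3 from 2 k + 1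
    \<le> 3^k, \<open>N * A\<^sup>2\<close> is the cost of one iteration, and \<open>C\<close> that
    of passing from m_{k+1} to m_k.\<close>
  define E where "E = 6 * (N * A\<^sup>2) * C"
  have NAC: "N * A\<^sup>2 * C \<ge> 1" using mult_mono[OF NA C(1)] NA by linarith
  have E1: "E \<ge> 1" using NAC by (simp add: E_def)
  have "N * A\<^sup>2 * C \<ge> A\<^sup>2"
  proof -
    have "1 * A\<^sup>2 * 1 \<le> N * A\<^sup>2 * C" using N C(1) A by (intro mult_mono) auto
    then show ?thesis by simp
  qed
  then have EA: "A\<^sup>2 \<le> E" using NAC unfolding E_def by (simp add: mult.assoc)
  have AA: "A \<le> A\<^sup>2" using A by (simp add: power2_eq_square)
  have main: "A\<^sup>2 * (6 * (N * A\<^sup>2) * C) ^ k * M k \<le> E ^ (k + 1) * M k" for k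
    using EA E1 regular_sequence_pos(1)[OF reg, of k]
    by (simp add: E_def[symmetric] mult_right_mono)
  have bound0: "norm ((transport a b J ^^ k) g p) \<le> E ^ (k + 1) * M k" if "p \<in> K" for k p
  proof -
    have "norm ((transport a b J ^^ k) g p)
        \<le> A * (N * A\<^sup>2) ^ k * (fact (2 * k) / (2 ^ k * fact k)) * normalized M k"
      using iter_pderivative_transport_le[OF assms(1-3,6-11) that, where bs = "[]" and k = k] by (simp add: N_def)
    also have "\<dots> \<le> A\<^sup>2 * (N * A\<^sup>2) ^ k * (6 ^ k * C ^ k * fact k) * normalized M k"
    proof (intro mult_right_mono mult_mono AA)
      have "fact (2 * k) / (2 ^ k * fact k) \<le> 2 ^ k * (fact k :: real)" by (rule fact_double_le)
      also have "\<dots> \<le> 6 ^ k * C ^ k * fact k"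
      proof (intro mult_right_mono)
        have "(2 :: real) ^ k * 1 \<le> 6 ^ k * C ^ k"
          using C(1) by (intro mult_mono power_mono one_le_power) auto
        then show "(2 :: real) ^ k \<le> 6 ^ k * C ^ k" by simp
      qed simp
      finally show "fact (2 * k) / (2 ^ k * fact k) \<le> 6 ^ k * C ^ k * (fact k :: real)" .
    qed (use regular_sequence_pos(2)[OF reg, of k] A N in auto)
    also have "\<dots> = A\<^sup>2 * (6 * (N * A\<^sup>2) * C) ^ k * M k"
      by (simp only: fact_mult_normalized[of k M, symmetric] power_mult_distrib mult_ac)
    finally show ?thesis using main[of k] by linarith
  qed
  have bound1: "norm (pderivative e ((transport a b J ^^ k) g) p) \<le> E ^ (k + 1) * M k"
    if "p \<in> K" "e \<in> Basis" for k p e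
  proof -
    have "norm (pderivative e ((transport a b J ^^ k) g) p)
        \<le> A * (N * A\<^sup>2) ^ k * A * (fact (2 * k + 1) / (2 ^ k * fact k)) * normalized M (Suc k)"
      using iter_pderivative_transport_le[OF assms(1-3,6-11) that(1), where bs = "[e]" and k = k] that(2)
      by (simp add: N_def del: fact_Suc)
    also have "\<dots> = A\<^sup>2 * (N * A\<^sup>2) ^ k * (real (2 * k + 1) * (fact (2 * k) / (2 ^ k * fact k)) * ratio M k) * normalized M k"
      by (simp add: normalized_Suc[OF reg] power2_eq_square mult_ac)
    also have "\<dots> \<le> A\<^sup>2 * (N * A\<^sup>2) ^ k * (3 ^ k * (2 ^ k * fact k) * C ^ k) * normalized M k"
    proof (intro mult_right_mono mult_left_mono mult_mono fact_double_le C(2))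
      show "real (2 * k + 1) \<le> 3 ^ k"
      proof (induction k)
        case (Suc k)
        have "(1 :: real) \<le> 3 ^ k" by (rule one_le_power) simp
        with Suc show ?case by simp
      qed simp
    qed (use regular_sequence_pos(2)[OF reg, of k] ratio_ge_1[OF reg, of k] A N in auto)
    also have "\<dots> = A\<^sup>2 * (6 * (N * A\<^sup>2) * C) ^ k * M k"
    proof -
      have "(6 :: real) ^ k = 3 ^ k * 2 ^ k" by (simp flip: power_mult_distrib)
      then show ?thesis
        by (simp only: fact_mult_normalized[of k M, symmetric] power_mult_distrib mult_ac)
    qed
    finally show ?thesis using main[of k] by linarith
  qed
  show ?thesis using E1 bound0 bound1 by blast
qed

section \<open>From the jet space back to (x, t)\<close>

section \<open>The lift of the linearized operator to the jet space\<close>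

text \<open>Hiding the constant lets the coefficients of \<open>lift\<close> be handled by closure
  rules; S carries the holomorphy, K the bounds.\<close>

definition CM_class :: "(nat \<Rightarrow> real) \<Rightarrow> 'n::finite jet set \<Rightarrow> 'n jet set \<Rightarrow> ('n jet \<Rightarrow> complex) \<Rightarrow> bool" where
  "CM_class M S K g \<longleftrightarrow> CR_on g S \<and> (\<exists>A\<ge>1. CM_bounded M A g K)"

lemma CM_class_add:
  assumes "regular_sequence M" "open S" "K \<subseteq> S" "CM_class M S K g" "CM_class M S K h"
  shows "CM_class M S K (\<lambda>q. g q + h q)"
proof -
  obtain A B where AB: "A \<ge> 1" "CM_bounded M A g K" "B \<ge> 1" "CM_bounded M B h K"
    and CR: "CR_on g S" "CR_on h S"
    using assms by (auto simp: CM_class_def)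
  have "CM_bounded M (A + B) (\<lambda>q. g q + h q) K"
    using assms(1-3) CR[THEN CR_onD(1)] AB by (intro CM_bounded_add) auto
  moreover have "A + B \<ge> 1" using AB by linarith
  ultimately show ?thesis
    using CR_on_add[OF assms(2) CR] by (auto simp: CM_class_def)
qed

lemma CM_class_mult:
  assumes "regular_sequence M" "open S" "K \<subseteq> S" "CM_class M S K g" "CM_class M S K h"
  shows "CM_class M S K (\<lambda>q. g q * h q)"
proof -
  obtain A B where AB: "A \<ge> 1" "CM_bounded M A g K" "B \<ge> 1" "CM_bounded M B h K"
    and CR: "CR_on g S" "CR_on h S"
    using assms by (auto simp: CM_class_def)
  have "CM_bounded M (2 * (A * B)) (\<lambda>q. g q * h q) K"
    using assms(1-3) CR[THEN CR_onD(1)] AB by (intro CM_bounded_mult) auto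
  moreover have "2 * (A * B) \<ge> 1" using mult_mono[OF AB(1,3)] AB(1,3) by linarith
  ultimately show ?thesis
    using CR_on_mult[OF assms(2) CR] by (auto simp: CM_class_def)
qed

lemma CM_class_pderivative:
  assumes "regular_sequence M" "open S" "CM_class M S K g" "b \<in> Basis"
  shows "CM_class M S K (pderivative b g)"
  using assms CM_bounded_pderivative CR_on_pderivative unfolding CM_class_def by blast

lemma CM_class_const:
  assumes "regular_sequence M"
  shows "CM_class M S K (\<lambda>_. c)"
proof -
  have "norm (iter_pderivative bs (\<lambda>_. c) p) \<le> (1 + norm c) ^ (length bs + 1) * M (length bs)"
    for bs and p :: "'a jet"
    using regular_sequence_0_1[OF assms] regular_sequence_pos(1)[OF assms, of "length bs"]
    by (auto simp: iter_pderivative_const normalized_def intro!: mult_nonneg_nonneg)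
  then have "CM_bounded M (1 + norm c) (\<lambda>_. c) K" by (simp add: CM_bounded_def)
  then show ?thesis
    unfolding CM_class_def by (intro conjI CR_on_const exI[of _ "1 + norm c"]) auto
qed

lemma CM_class_sum:
  assumes "regular_sequence M" "open S" "K \<subseteq> S" "\<And>i. i \<in> J \<Longrightarrow> CM_class M S K (g i)"
  shows "CM_class M S K (\<lambda>q. \<Sum>i\<in>J. g i q)"
  using assms(4)
proof (induction J rule: infinite_finite_induct)
  case (insert i J)
  then have "CM_class M S K (\<lambda>q. g i q + (\<Sum>i\<in>J. g i q))"
    by (intro CM_class_add[OF assms(1-3)]) auto
  with insert show ?case by simp
qed (simp_all add: CM_class_const[OF assms(1)])

lemma CM_class_zcoord:
  assumes "regular_sequence M" "bounded K"
  shows "CM_class M S K (zcoord i)"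
  unfolding CM_class_def
  using CR_on_zcoord CM_bounded_bounded_linear[OF assms(1) bounded_linear_zcoord assms(2)] by blast

lemma CM_class_xcoord:
  assumes "regular_sequence M" "bounded K"
  shows "CM_class M S K (\<lambda>v. complex_of_real (xcoord i v))"
  unfolding CM_class_def
  using CR_on_xcoord
    CM_bounded_bounded_linear[OF assms(1) bounded_linear_compose[OF bounded_linear_of_real bounded_linear_xcoord] assms(2)]
  by blast

text \<open>The coefficients of the operator \<open>H\<close> from the introduction, with signs written as factors
  \<open>- 1\<close> so that the closure lemmas for sums and products apply.\<close>

fun lift_coeff :: "('n::finite jet \<Rightarrow> complex) \<Rightarrow> 'n option + 'n option \<Rightarrow> 'n jet \<Rightarrow> complex" where
  "lift_coeff f (Inl None) = (\<lambda>_. 1)"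
| "lift_coeff f (Inl (Some j)) = (\<lambda>q. (- 1) * pderivative (zdir (Some j) 1) f q)"
| "lift_coeff f (Inr None) =
     (\<lambda>q. f q + (\<Sum>j\<in>UNIV. (- 1) * (zcoord (Some j) q * pderivative (zdir (Some j) 1) f q)))"
| "lift_coeff f (Inr (Some j)) =
     (\<lambda>q. pderivative (xdir (Some j)) f q + zcoord (Some j) q * pderivative (zdir None 1) f q)"

fun lift_dir :: "'n option + 'n option \<Rightarrow> 'n::finite jet" where
  "lift_dir (Inl i) = xdir i"
| "lift_dir (Inr i) = zdir i 1"

lemma lift_dir_Basis: "lift_dir i \<in> Basis"
  by (cases i) (auto simp: xdir_Basis zdir_Basis)

abbreviation lift :: "('n::finite jet \<Rightarrow> complex) \<Rightarrow> ('n jet \<Rightarrow> complex) \<Rightarrow> 'n jet \<Rightarrow> complex" where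
  "lift f \<equiv> transport (lift_coeff f) lift_dir UNIV"

lemma lift_eq:
  "lift f G q = (\<Sum>i\<in>UNIV. lift_coeff f (Inl i) q * pderivative (xdir i) G q)
    + (\<Sum>i\<in>UNIV. lift_coeff f (Inr i) q * pderivative (zdir i 1) G q)"
  unfolding transport_def UNIV_Plus_UNIV[symmetric] by (subst sum.Plus) auto

lemma CM_class_lift_coeff:
  assumes "regular_sequence M" "open S" "K \<subseteq> S" "bounded K" "CM_class M S K f"
  shows "CM_class M S K (lift_coeff f i)"
proof (cases "(f, i)" rule: lift_coeff.cases)
  case (1 f')
  then show ?thesis using assms(1) by (simp add: CM_class_const)
next
  case (2 f' j)
  have "CM_class M S K (\<lambda>q. (- 1) * pderivative (zdir (Some j) 1) f q)"
    by (intro CM_class_mult CM_class_const CM_class_pderivative assms zdir_Basis)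
  then show ?thesis using 2 by simp
next
  case (3 f')
  have "CM_class M S K (lift_coeff f (Inr None))"
    unfolding lift_coeff.simps
    by (intro CM_class_add CM_class_sum CM_class_mult CM_class_const CM_class_pderivative CM_class_zcoord assms zdir_Basis)
  then show ?thesis using 3 by simp
next
  case (4 f' j)
  have "CM_class M S K (lift_coeff f (Inr (Some j)))"
    unfolding lift_coeff.simps
    by (intro CM_class_add CM_class_mult CM_class_pderivative CM_class_zcoord assms zdir_Basis xdir_Basis)
  then show ?thesis using 4 by simp
qed

lemma CR_on_lift_iterate:
  assumes "open S" "\<And>i. CR_on (lift_coeff f i) S" "CR_on G S"
  shows "CR_on ((lift f ^^ k) G) S"
proof (induction k)
  case (Suc k)
  have "CR_on (lift f H) S" if "CR_on H S" for H
    unfolding transport_def[abs_def]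
    by (intro CR_on_sum CR_on_mult CR_on_pderivative assms that lift_dir_Basis)
  from this[OF Suc] show ?case by simp
qed (simp add: assms)

definition jet_comp :: "((real^'n) \<times> real \<Rightarrow> complex) \<Rightarrow> 'n::finite option \<Rightarrow> (real^'n) \<times> real \<Rightarrow> complex" where
  "jet_comp u i = (case i of None \<Rightarrow> u | Some j \<Rightarrow> dx j u)"

definition jet_of :: "((real^'n) \<times> real \<Rightarrow> complex) \<Rightarrow> (real^'n) \<times> real \<Rightarrow> 'n::finite jet" where
  "jet_of u p = (p, (u p, grad_x u p))"

lemma xcoord_jet_of: "xcoord i (jet_of u p) = xcoord i (p, 0)"
  by (simp add: xcoord_def jet_of_def split: option.split)

lemma zcoord_jet_of: "zcoord i (jet_of u p) = jet_comp u i p"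
  by (simp add: zcoord_def jet_of_def jet_comp_def grad_x_def split: option.split)

text \<open>Splitting off the base point reduces differentiability of the jet to that of the scalar
  functions u and u_{x_j}.\<close>

lemma jet_of_eq: "jet_of u p = (p, 0) + (\<Sum>i\<in>UNIV. zdir i (jet_comp u i p))"
proof -
  have "zcoord i ((p, 0) :: 'a jet) = 0" for i
    by (simp add: zcoord_def split: option.split)
  then have "((p, 0) :: 'a jet) = (\<Sum>i\<in>UNIV. xcoord i ((p, 0) :: 'a jet) *\<^sub>R xdir i)"
    using jet_representation[of "(p, 0) :: 'a jet"]
    by (simp add: linear_0[OF bounded_linear.linear[OF bounded_linear_zdir]])
  then show ?thesis
    using jet_representation[of "jet_of u p"] by (simp add: xcoord_jet_of zcoord_jet_of)
qed

lemma has_derivative_jet_of: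
  assumes "\<And>i. jet_comp u i differentiable (at p)"
  shows "(jet_of u has_derivative (\<lambda>v. (v, 0)
    + (\<Sum>i\<in>UNIV. zdir i (\<Sum>b\<in>Basis. (v \<bullet> b) *\<^sub>R pderivative b (jet_comp u i) p)))) (at p)"
proof -
  have "((\<lambda>p. zdir i (jet_comp u i p)) has_derivative
      (\<lambda>v. zdir i (\<Sum>b\<in>Basis. (v \<bullet> b) *\<^sub>R pderivative b (jet_comp u i) p))) (at p)" for i
    using bounded_linear.has_derivative[OF bounded_linear_zdir has_derivative_pderivative[OF assms]] .
  moreover have "((\<lambda>p. (p, 0) :: 'a jet) has_derivative (\<lambda>v. (v, 0))) (at p)"
    by (auto intro!: derivative_eq_intros)
  ultimately show ?thesis
    unfolding jet_of_eq[abs_def] by (intro has_derivative_add has_derivative_sum) auto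
qed

text \<open>Regularity and position of the jet of u; the differential equation is a premise of the
  lemmas that apply L^u.\<close>

locale jet_solution =
  fixes \<Omega> :: "((real^'n::finite) \<times> real) set" and S :: "'n jet set" and u :: "(real^'n) \<times> real \<Rightarrow> complex"
  assumes open_\<Omega>: "open \<Omega>" and open_S: "open S"
    and u: "Ck_on 2 u \<Omega>" and jet_in: "\<And>p. p \<in> \<Omega> \<Longrightarrow> jet_of u p \<in> S"
begin

lemma dx_Basis: "((axis j 1, 0) :: (real^'n) \<times> real) \<in> Basis"
  and dt_Basis: "((0, 1) :: (real^'n) \<times> real) \<in> Basis"
  by (auto simp: Basis_prod_def axis_in_Basis_iff)

text \<open>Here the C^2 regularity of u is spent: the jet contains first derivatives and has to be
  C^1.\<close>

lemma Ck_on_1_jet_comp: "Ck_on 1 (jet_comp u i) \<Omega>"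
proof (cases i)
  case None
  have "Ck_on (Suc 1) u \<Omega>" using u by (simp only: Suc_1)
  then show ?thesis using None by (simp only: jet_comp_def option.case) (rule Ck_on_SucD)
next
  case (Some j)
  have "Ck_on (Suc 1) u \<Omega>" using u by (simp only: Suc_1)
  then have "Ck_on 1 (dx j u) \<Omega>" using dx_Basis unfolding Ck_on.simps(2) by blast
  then show ?thesis using Some by (simp only: jet_comp_def option.case)
qed

lemma u_differentiable: "p \<in> \<Omega> \<Longrightarrow> u differentiable (at p)"
  using u by (simp add: numeral_2_eq_2)

lemma pderivative_u_differentiable: "p \<in> \<Omega> \<Longrightarrow> b \<in> Basis \<Longrightarrow> pderivative b u differentiable (at p)"
  using u by (simp add: numeral_2_eq_2)

lemma jet_comp_differentiable: "p \<in> \<Omega> \<Longrightarrow> jet_comp u i differentiable (at p)"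
  using Ck_on_1_jet_comp by (simp add: Ck_on_1_iff)

lemma continuous_jet_of: "continuous_on \<Omega> (jet_of u)"
  using has_derivative_jet_of[OF jet_comp_differentiable]
  by (meson continuous_at_imp_continuous_on has_derivative_continuous)

lemma jet_of_compose:
  assumes "CR_on G S" "p \<in> \<Omega>"
  shows "(\<lambda>p. G (jet_of u p)) differentiable (at p)"
    and "b \<in> Basis \<Longrightarrow> pderivative b (\<lambda>p. G (jet_of u p)) p
      = (\<Sum>i\<in>UNIV. xcoord i (b, 0) *\<^sub>R pderivative (xdir i) G (jet_of u p))
        + (\<Sum>i\<in>UNIV. pderivative b (jet_comp u i) p * pderivative (zdir i 1) G (jet_of u p))"
proof -
  note der = has_derivative_compose[OF has_derivative_jet_of[OF jet_comp_differentiable[OF assms(2)]]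
      CR_on_has_derivative[OF assms(1) jet_in[OF assms(2)]]]
  show "(\<lambda>p. G (jet_of u p)) differentiable (at p)"
    using der by (rule differentiableI)
  assume b: "b \<in> Basis"
  define w where "w i = (\<Sum>c\<in>Basis. (b \<bullet> c) *\<^sub>R pderivative c (jet_comp u i) p)" for i
  have w: "w i = pderivative b (jet_comp u i) p" for i
    unfolding w_def using b by (simp add: inner_Basis if_distrib[of "\<lambda>x. x *\<^sub>R _"] cong: if_cong)
  have "xcoord i ((b, 0) + (\<Sum>i\<in>UNIV. zdir i (w i))) = xcoord i (b, 0)" for i
  proof -
    have "xcoord i (zdir j c) = 0" for j c
      by (auto simp: xcoord_def zdir_def split: option.split)
    then show ?thesis
      using bounded_linear.linear[OF bounded_linear_xcoord[of i]]
      by (simp add: linear_add linear_sum)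
  qed
  moreover have "zcoord i ((b, 0) + (\<Sum>i\<in>UNIV. zdir i (w i))) = w i" for i
  proof -
    have "zcoord i ((b, 0) :: 'n jet) = 0"
      by (simp add: zcoord_def split: option.split)
    then show ?thesis
      using bounded_linear.linear[OF bounded_linear_zcoord[of i]]
      by (simp add: linear_add linear_sum zcoord_zdir)
  qed
  ultimately show "pderivative b (\<lambda>p. G (jet_of u p)) p
      = (\<Sum>i\<in>UNIV. xcoord i (b, 0) *\<^sub>R pderivative (xdir i) G (jet_of u p))
        + (\<Sum>i\<in>UNIV. pderivative b (jet_comp u i) p * pderivative (zdir i 1) G (jet_of u p))"
    using pderivative_eq[OF der, of b] by (simp add: w_def[symmetric]) (simp add: w)
qed

text \<open>The gain from the jet space: the restriction of \<open>G\<close> stays C^1 no matter how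
  many iterations produced \<open>G\<close>.\<close>

lemma Ck_on_1_jet_of_compose:
  assumes "CR_on G S"
  shows "Ck_on 1 (\<lambda>p. G (jet_of u p)) \<Omega>"
  unfolding Ck_on_1_iff
proof (intro conjI ballI)
  fix b :: "(real^'n) \<times> real" assume b: "b \<in> Basis"
  have c1: "continuous_on \<Omega> (\<lambda>p. pderivative e G (jet_of u p))" if "e \<in> Basis" for e
    using smooth_on_continuous[OF CR_onD(1)[OF CR_on_pderivative[OF open_S assms that]]] jet_in
    by (intro continuous_on_compose2[OF _ continuous_jet_of]) auto
  have c2: "continuous_on \<Omega> (pderivative b (jet_comp u i))" for i
    using Ck_on_1_jet_comp b by (simp add: Ck_on_1_iff)
  have "continuous_on \<Omega> (\<lambda>p. (\<Sum>i\<in>UNIV. xcoord i (b, 0) *\<^sub>R pderivative (xdir i) G (jet_of u p))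
        + (\<Sum>i\<in>UNIV. pderivative b (jet_comp u i) p * pderivative (zdir i 1) G (jet_of u p)))"
    by (intro continuous_intros c1 c2 xdir_Basis zdir_Basis)
  then show "continuous_on \<Omega> (pderivative b (\<lambda>p. G (jet_of u p)))"
    by (rule continuous_on_eq) (simp add: jet_of_compose(2)[OF assms _ b])
qed (rule jet_of_compose(1)[OF assms])

lemma dx_jet_of_compose:
  assumes "CR_on G S" "p \<in> \<Omega>"
  shows "dx j (\<lambda>p. G (jet_of u p)) p = pderivative (xdir (Some j)) G (jet_of u p)
    + (\<Sum>i\<in>UNIV. dx j (jet_comp u i) p * pderivative (zdir i 1) G (jet_of u p))"
proof -
  have "xcoord i ((axis j 1, 0), 0) = (if i = Some j then 1 else 0)" for i
    by (auto simp: xcoord_def axis_def split: option.split)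
  then show ?thesis
    unfolding jet_of_compose(2)[OF assms dx_Basis]
    by (simp add: if_distrib[of "\<lambda>x. x *\<^sub>R _"] cong: if_cong)
qed

lemma dt_jet_of_compose:
  assumes "CR_on G S" "p \<in> \<Omega>"
  shows "dt (\<lambda>p. G (jet_of u p)) p = pderivative (xdir None) G (jet_of u p)
    + (\<Sum>i\<in>UNIV. dt (jet_comp u i) p * pderivative (zdir i 1) G (jet_of u p))"
proof -
  have "xcoord (i :: 'n option) ((0, 1), 0) = (if i = None then 1 else 0)" for i
    by (auto simp: xcoord_def split: option.split)
  then show ?thesis
    unfolding jet_of_compose(2)[OF assms dt_Basis]
    by (simp add: if_distrib[of "\<lambda>x. x *\<^sub>R _"] cong: if_cong)
qed

text \<open>\<open>dzeta\<close> is a one-variable complex derivative that moves the jet along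
  \<open>zdir (Some j)\<close>; by the Cauchy-Riemann equations it equals the real derivative along
  \<open>zdir (Some j) 1\<close>.\<close>

lemma linearized_coeff_eq:
  assumes "CR_on f S" "p \<in> \<Omega>"
  shows "linearized_coeff f u j p = - pderivative (zdir (Some j) 1) f (jet_of u p)"
proof -
  define P where "P = jet_of u p"
  have P: "P \<in> S" using jet_in[OF assms(2)] by (simp add: P_def)
  obtain D where D: "(f has_derivative D) (at P)"
    using smooth_on_differentiable[OF CR_onD(1)[OF assms(1)] P] by (auto simp: differentiable_def)
  define z where "z = grad_x u p $ j"
  have path: "((p, (u p, \<chi> i. if i = j then w else grad_x u p $ i)) :: 'n jet) = P + zdir (Some j) (w - z)" for w
    by (auto simp: P_def jet_of_def zdir_def z_def vec_eq_iff axis_def)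
  have "((\<lambda>w. w - z) has_derivative (\<lambda>w. w)) (at z)"
    by (auto intro!: derivative_eq_intros)
  from has_derivative_add[OF has_derivative_const[of P] bounded_linear.has_derivative[OF bounded_linear_zdir[of "Some j"] this]]
  have "((\<lambda>w. P + zdir (Some j) (w - z)) has_derivative zdir (Some j)) (at z)"
    by simp
  moreover have "(f has_derivative D) (at (P + zdir (Some j) (z - z)))"
    using D by (simp add: linear_0[OF bounded_linear.linear[OF bounded_linear_zdir]])
  ultimately have "((\<lambda>w. f (P + zdir (Some j) (w - z))) has_derivative (\<lambda>c. D (zdir (Some j) c))) (at z)"
    by (rule has_derivative_compose)
  then have "((\<lambda>w. f (P + zdir (Some j) (w - z))) has_field_derivative pderivative (zdir (Some j) 1) f P) (at z)"
    unfolding has_field_derivative_def using CR_on_zdir[OF assms(1) P D] by (simp add: mult_commute_abs)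
  then have "deriv (\<lambda>w. f (P + zdir (Some j) (w - z))) z = pderivative (zdir (Some j) 1) f P"
    by (rule DERIV_imp_deriv)
  then show ?thesis
    by (simp add: linearized_coeff_def dzeta_def path z_def[symmetric]) (simp add: P_def)
qed

text \<open>For u this is the equation itself. For u_{x_j}, differentiating the equation in x_j
  produces the second-order terms \<Sum> f_{\<zeta>_l} u_{x_j x_l}; after exchanging mixed
  derivatives these are exactly what L^u subtracts.\<close>

lemma vector_field_jet_comp:
  assumes f: "CR_on f S" and eq: "\<And>p. p \<in> \<Omega> \<Longrightarrow> dt u p = f (jet_of u p)" and p: "p \<in> \<Omega>"
  shows "vector_field (linearized_coeff f u) (jet_comp u i) p = lift_coeff f (Inr i) (jet_of u p)"
proof (cases i)
  case None
  then show ?thesis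
    by (simp add: vector_field_def linearized_coeff_eq[OF f p] zcoord_jet_of jet_comp_def eq[OF p] mult.commute
        sum_negf)
next
  case (Some j)
  have commute: "pderivative b (dx j u) p = dx j (pderivative b u) p" if "b \<in> Basis" for b
    using p that
    by (intro pderivative_commute[OF open_\<Omega>] u_differentiable pderivative_u_differentiable dx_Basis)
  have "dt (dx j u) p = dx j (dt u) p" by (rule commute[OF dt_Basis])
  also have "\<dots> = dx j (\<lambda>p. f (jet_of u p)) p"
    by (rule pderivative_cong[OF open_\<Omega> p eq])
  also have "\<dots> = pderivative (xdir (Some j)) f (jet_of u p)
      + (dx j u p * pderivative (zdir None 1) f (jet_of u p)
      + (\<Sum>l\<in>UNIV. dx j (dx l u) p * pderivative (zdir (Some l) 1) f (jet_of u p)))"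
    unfolding dx_jet_of_compose[OF f p] sum_UNIV_option by (simp add: jet_comp_def)
  also have "(\<Sum>l\<in>UNIV. dx j (dx l u) p * pderivative (zdir (Some l) 1) f (jet_of u p))
      = (\<Sum>l\<in>UNIV. dx l (dx j u) p * pderivative (zdir (Some l) 1) f (jet_of u p))"
    by (simp only: commute[OF dx_Basis])
  finally show ?thesis
    by (simp add: Some vector_field_def linearized_coeff_eq[OF f p] zcoord_jet_of jet_comp_def
        sum_negf mult.commute)
qed

text \<open>The chain rule yields the x- and t-part of H plus, for each jet component, L^u of that
  component times the matching \<zeta>-derivative of \<open>G\<close>; the latter factors were just
  identified with the coefficients of H.\<close>

lemma vector_field_jet_of_compose:
  assumes f: "CR_on f S" and eq: "\<And>p. p \<in> \<Omega> \<Longrightarrow> dt u p = f (jet_of u p)" and p: "p \<in> \<Omega>"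
    and G: "CR_on G S"
  shows "vector_field (linearized_coeff f u) (\<lambda>p. G (jet_of u p)) p = lift f G (jet_of u p)"
proof -
  define q where "q = jet_of u p"
  define F where "F l = pderivative (zdir (Some l) 1) f q" for l
  define X where "X i = pderivative (xdir i) G q" for i
  define Z where "Z i = pderivative (zdir i 1) G q" for i
  have L: "dt (jet_comp u i) p - (\<Sum>l\<in>UNIV. F l * dx l (jet_comp u i) p) = lift_coeff f (Inr i) q" for i
    using vector_field_jet_comp[OF f eq p, of i]
    by (simp add: vector_field_def linearized_coeff_eq[OF f p] q_def F_def sum_negf)
  have "vector_field (linearized_coeff f u) (\<lambda>p. G (jet_of u p)) p
      = X None + (\<Sum>i\<in>UNIV. dt (jet_comp u i) p * Z i)
        - (\<Sum>l\<in>UNIV. F l * (X (Some l) + (\<Sum>i\<in>UNIV. dx l (jet_comp u i) p * Z i)))"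
    by (simp add: vector_field_def linearized_coeff_eq[OF f p] dt_jet_of_compose[OF G p]
        dx_jet_of_compose[OF G p] q_def F_def X_def Z_def sum_negf)
  also have "(\<Sum>l\<in>UNIV. F l * (X (Some l) + (\<Sum>i\<in>UNIV. dx l (jet_comp u i) p * Z i)))
      = (\<Sum>l\<in>UNIV. F l * X (Some l)) + (\<Sum>i\<in>UNIV. (\<Sum>l\<in>UNIV. F l * dx l (jet_comp u i) p) * Z i)"
  proof -
    have "(\<Sum>l\<in>UNIV. F l * (\<Sum>i\<in>UNIV. dx l (jet_comp u i) p * Z i))
        = (\<Sum>i\<in>UNIV. (\<Sum>l\<in>UNIV. F l * dx l (jet_comp u i) p) * Z i)"
      unfolding sum_distrib_left sum_distrib_right mult.assoc by (rule sum.swap)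
    then show ?thesis by (simp add: distrib_left sum.distrib)
  qed
  also have "X None + (\<Sum>i\<in>UNIV. dt (jet_comp u i) p * Z i)
      - ((\<Sum>l\<in>UNIV. F l * X (Some l)) + (\<Sum>i\<in>UNIV. (\<Sum>l\<in>UNIV. F l * dx l (jet_comp u i) p) * Z i))
    = (X None - (\<Sum>l\<in>UNIV. F l * X (Some l)))
      + (\<Sum>i\<in>UNIV. (dt (jet_comp u i) p - (\<Sum>l\<in>UNIV. F l * dx l (jet_comp u i) p)) * Z i)"
    by (simp add: left_diff_distrib sum_subtractf)
  also have "\<dots> = lift f G q"
    unfolding L lift_eq by (simp add: sum_UNIV_option X_def Z_def F_def sum_negf)
  finally show ?thesis by (simp add: q_def)
qed

end

section \<open>Approximate solutions of the linearized operator\<close>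

lemma abs_xcoord_Basis_le: "b \<in> Basis \<Longrightarrow> \<bar>xcoord i (b, 0)\<bar> \<le> 1"
proof -
  assume b: "b \<in> Basis"
  have "\<bar>fst b $ j\<bar> \<le> norm b" for j
    using component_le_norm_cart[of "fst b" j] norm_fst_le[of "fst b" "snd b"] by simp
  moreover have "\<bar>snd b\<bar> \<le> norm b"
    using norm_snd_le[of "snd b" "fst b"] by simp
  ultimately show ?thesis using b by (simp add: xcoord_def split: option.split)
qed

text \<open>One argument for all initial data. \<open>G\<close> will be a coordinate function, which
  is of the class on every bounded set, whereas bounds for f are available on compact subsets of
  S.\<close>

lemma (in jet_solution) approximate_solution_exists:
  assumes reg: "regular_sequence M" and \<Omega>_eq: "\<Omega> = \<Omega>' \<times> I" and "open I" "0 \<in> I"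
    and U: "open U" "compact (closure U)" "closure U \<subseteq> \<Omega>'"
    and f: "\<And>K. compact K \<Longrightarrow> K \<subseteq> S \<Longrightarrow> CM_class M S K f"
    and eq: "\<And>p. p \<in> \<Omega> \<Longrightarrow> dt u p = f (jet_of u p)"
    and G: "\<And>K. bounded K \<Longrightarrow> CM_class M S K G"
    and u\<^sub>0: "Ck_on 1 u\<^sub>0 U" "\<And>x. x \<in> U \<Longrightarrow> G (jet_of u (x, 0)) = u\<^sub>0 x"
  shows "\<exists>v. approximate_solution M (linearized_coeff f u) U I u\<^sub>0 v"
proof -
  obtain \<delta> where \<delta>: "\<delta> > 0" "cball 0 \<delta> \<subseteq> I"
    using assms(3,4) open_contains_cball by blast
  have \<delta>I: "{-\<delta>..\<delta>} \<subseteq> I" using \<delta>(2) by (auto simp: subset_iff abs_le_iff dist_norm)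
  have sub: "U \<times> I \<subseteq> \<Omega>"
    using U(3) closure_subset[of U] unfolding \<Omega>_eq by (intro Sigma_mono) auto
  \<comment> \<open>Compactness of the closure of U turns bounds on compact sets into bounds uniform
    on U and a strip; \<open>K\<close> below is the piece of the jet of u lying over
    \<open>K\<^sub>0\<close>.\<close>
  define K\<^sub>0 where "K\<^sub>0 = closure U \<times> {-\<delta>..\<delta>}"
  have K\<^sub>0: "compact K\<^sub>0" "K\<^sub>0 \<subseteq> \<Omega>"
    using U(2,3) \<delta>I by (auto simp: K\<^sub>0_def \<Omega>_eq intro!: compact_Times)
  define K where "K = jet_of u ` K\<^sub>0"
  have K: "compact K" "K \<subseteq> S"
    using K\<^sub>0 jet_in continuous_on_subset[OF continuous_jet_of K\<^sub>0(2)]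
    by (auto simp: K_def intro!: compact_continuous_image)
  note bounded_K = compact_imp_bounded[OF K(1)]
  have CR_f: "CR_on f S" and CR_G: "CR_on G S"
    using f[OF K] G[OF bounded_K] by (auto simp: CM_class_def)
  have coeff: "CM_class M S K (lift_coeff f i)" for i
    by (rule CM_class_lift_coeff[OF reg open_S K(2) bounded_K f[OF K]])
  then have CR_coeff: "CR_on (lift_coeff f i) S" for i
    by (simp add: CM_class_def)
  obtain A where A: "\<And>i. A i \<ge> 1" "\<And>i. CM_bounded M (A i) (lift_coeff f i) K"
    using coeff unfolding CM_class_def by metis
  obtain A\<^sub>0 where A\<^sub>0: "A\<^sub>0 \<ge> 1" "CM_bounded M A\<^sub>0 G K"
    using G[OF bounded_K] unfolding CM_class_def by blast
  \<comment> \<open>A single constant for \<open>G\<close> and all coefficients, as the iteration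
    estimate requires.\<close>
  define A' where "A' = A\<^sub>0 + (\<Sum>i\<in>UNIV. A i)"
  have sum_A: "0 \<le> (\<Sum>i\<in>UNIV. A i)" "A i \<le> (\<Sum>i\<in>UNIV. A i)" for i
    using A(1) by (auto intro!: sum_nonneg member_le_sum intro: order_trans[OF zero_le_one])
  have A': "A\<^sub>0 \<le> A'" "A i \<le> A'" "1 \<le> A'" for i
    using sum_A(1) sum_A(2)[of i] A\<^sub>0(1) by (auto simp: A'_def)
  have "CM_bounded M A' (lift_coeff f i) K" for i
    using A(1)[of i] A' by (intro CM_bounded_mono[OF reg A(2)]) auto
  moreover have "CM_bounded M A' G K"
    using A\<^sub>0(1) A' by (intro CM_bounded_mono[OF reg A\<^sub>0(2)]) auto
  ultimately have "\<exists>E\<ge>1. \<forall>k. \<forall>p\<in>K. norm ((lift f ^^ k) G p) \<le> E ^ (k + 1) * M k \<and>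
      (\<forall>e\<in>Basis. norm (pderivative e ((lift f ^^ k) G) p) \<le> E ^ (k + 1) * M k)"
    using A'(3) CR_onD(1)[OF CR_coeff] CR_onD(1)[OF CR_G] lift_dir_Basis
    by (intro transport_iterate_le[OF reg open_S K(2)]) simp_all
  then obtain E where E: "E \<ge> 1"
    and E_le: "\<And>k p. p \<in> K \<Longrightarrow> norm ((lift f ^^ k) G p) \<le> E ^ (k + 1) * M k"
    and dE_le: "\<And>k p e. p \<in> K \<Longrightarrow> e \<in> Basis \<Longrightarrow> norm (pderivative e ((lift f ^^ k) G) p) \<le> E ^ (k + 1) * M k"
    by blast
  define g where "g k p = (lift f ^^ k) G (jet_of u p)" for k p
  have CR_k: "CR_on ((lift f ^^ k) G) S" for k
    by (rule CR_on_lift_iterate[OF open_S CR_coeff CR_G])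
  \<comment> \<open>First derivatives of the jet involve second derivatives of u, which are
    continuous. Summing over components and directions gives one bound for all of them.\<close>
  have "continuous_on K\<^sub>0 (\<lambda>p. \<Sum>i\<in>UNIV. \<Sum>b\<in>Basis. norm (pderivative b (jet_comp u i) p))"
    using Ck_on_1_jet_comp continuous_on_subset[OF _ K\<^sub>0(2)]
    by (intro continuous_on_sum continuous_on_norm) (auto simp: Ck_on_1_iff)
  then have "bounded ((\<lambda>p. \<Sum>i\<in>UNIV. \<Sum>b\<in>Basis. norm (pderivative b (jet_comp u i) p)) ` K\<^sub>0)"
    using K\<^sub>0(1) compact_continuous_image compact_imp_bounded by blast
  then obtain R where R: "R > 0"
    and R_sum: "\<And>p. p \<in> K\<^sub>0 \<Longrightarrow> \<bar>\<Sum>i\<in>UNIV. \<Sum>b\<in>Basis. norm (pderivative b (jet_comp u i) p)\<bar> \<le> R"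
    by (auto simp: bounded_pos)
  have R_le: "norm (pderivative b (jet_comp u i) p) \<le> R" if "p \<in> K\<^sub>0" "b \<in> Basis" for p b i
  proof -
    have "norm (pderivative b (jet_comp u i) p) \<le> (\<Sum>b\<in>Basis. norm (pderivative b (jet_comp u i) p))"
      using that(2) by (intro member_le_sum) auto
    also have "\<dots> \<le> (\<Sum>i\<in>UNIV. \<Sum>b\<in>Basis. norm (pderivative b (jet_comp u i) p))"
      by (intro member_le_sum[where f = "\<lambda>i. \<Sum>b\<in>Basis. norm (pderivative b (jet_comp u i) p)"] sum_nonneg) auto
    finally show ?thesis using R_sum[OF that(1)] by linarith
  qed
  \<comment> \<open>The chain rule has two sums over \<open>'n option\<close>, with factors bounded
    by 1 and by \<open>R\<close>.\<close>
  define N where "N = real CARD('n option) * (1 + R)"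
  have N: "N \<ge> 1"
  proof -
    have "1 * 1 \<le> real CARD('n option) * (1 + R)"
      using R by (intro mult_mono) (auto simp: Suc_le_eq)
    then show ?thesis by (simp add: N_def)
  qed
  \<comment> \<open>As N \<ge> 1, the factor N is at most N^(k+1) and fits into the power of
    \<open>Q\<close>.\<close>
  define Q where "Q = N * E"
  have QE: "N * (E ^ (k + 1) * M k) \<le> Q ^ (k + 1) * M k" for k
  proof -
    have "N * E ^ (k + 1) \<le> N ^ (k + 1) * E ^ (k + 1)"
      using N E power_increasing[of 1 "k + 1" N] by (intro mult_right_mono) auto
    then have "N * E ^ (k + 1) * M k \<le> N ^ (k + 1) * E ^ (k + 1) * M k"
      using less_imp_le[OF regular_sequence_pos(1)[OF reg, of k]] by (rule mult_right_mono)
    then show ?thesis unfolding Q_def power_mult_distrib by (simp only: mult.assoc)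
  qed
  interpret formal_solution M U I "linearized_coeff f u" g Q \<delta>
  proof
    show "1 \<le> Q" unfolding Q_def using mult_mono[OF N E] N by simp
    show "Ck_on 1 (g k) (U \<times> I)" for k
      unfolding g_def[abs_def] by (rule Ck_on_subset[OF Ck_on_1_jet_of_compose[OF CR_k] sub])
    show "vector_field (linearized_coeff f u) (g k) p = g (Suc k) p" if "p \<in> U \<times> I" for k p
    proof -
      have "p \<in> \<Omega>" using that sub by blast
      from vector_field_jet_of_compose[OF CR_f eq this CR_k] show ?thesis
        by (simp add: g_def[abs_def])
    qed
    fix k x and t :: real assume "x \<in> U" "\<bar>t\<bar> \<le> \<delta>"
    then have xt: "(x, t) \<in> K\<^sub>0" using closure_subset[of U] by (auto simp: K\<^sub>0_def abs_le_iff)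
    then have in_K: "jet_of u (x, t) \<in> K" and in_\<Omega>: "(x, t) \<in> \<Omega>" using K\<^sub>0(2) by (auto simp: K_def)
    have EM: "0 \<le> E ^ (k + 1) * M k" using E regular_sequence_pos(1)[OF reg, of k] by simp
    show "norm (g k (x, t)) \<le> Q ^ (k + 1) * M k"
      using E_le[OF in_K, of k] QE[of k] mult_right_mono[OF N EM] by (simp add: g_def)
    fix b :: "(real^'n) \<times> real" assume b: "b \<in> Basis"
    have "pderivative b (g k) (x, t) = (\<Sum>i\<in>UNIV. xcoord i (b, 0) *\<^sub>R pderivative (xdir i) ((lift f ^^ k) G) (jet_of u (x, t)))
        + (\<Sum>i\<in>UNIV. pderivative b (jet_comp u i) (x, t) * pderivative (zdir i 1) ((lift f ^^ k) G) (jet_of u (x, t)))"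
      unfolding g_def[abs_def] by (rule jet_of_compose(2)[OF CR_k in_\<Omega> b])
    also have "norm \<dots> \<le> (\<Sum>i\<in>(UNIV :: 'n option set). 1 * (E ^ (k + 1) * M k))
        + (\<Sum>i\<in>(UNIV :: 'n option set). R * (E ^ (k + 1) * M k))"
    proof (intro order_trans[OF norm_triangle_ineq] add_mono sum_norm_le)
      show "norm (xcoord i (b, 0) *\<^sub>R pderivative (xdir i) ((lift f ^^ k) G) (jet_of u (x, t))) \<le> 1 * (E ^ (k + 1) * M k)" for i
        unfolding norm_scaleR using abs_xcoord_Basis_le[OF b] dE_le[OF in_K xdir_Basis] by (intro mult_mono) auto
      show "norm (pderivative b (jet_comp u i) (x, t) * pderivative (zdir i 1) ((lift f ^^ k) G) (jet_of u (x, t)))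
          \<le> R * (E ^ (k + 1) * M k)" for i
        unfolding norm_mult using R_le[OF xt b] dE_le[OF in_K zdir_Basis(1)] R by (intro mult_mono) auto
    qed
    also have "\<dots> = N * (E ^ (k + 1) * M k)" by (simp add: N_def algebra_simps)
    finally show "norm (pderivative b (g k) (x, t)) \<le> Q ^ (k + 1) * M k"
      using QE[of k] by linarith
  qed (use reg U(1) assms(3) \<delta>(1) \<delta>I in auto)
  obtain v where v: "Ck_on 1 v (U \<times> UNIV)" "\<And>x. x \<in> U \<Longrightarrow> v (x, 0) = g 0 (x, 0)"
    and bound: "\<exists>A>0. \<exists>\<gamma>>0. \<exists>\<delta>>0. {-\<delta>..\<delta>} \<subseteq> I \<and> (\<forall>x\<in>U. \<forall>t. 0 < \<bar>t\<bar> \<and> \<bar>t\<bar> \<le> \<delta> \<longrightarrow>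
      cmod (vector_field (linearized_coeff f u) v (x, t)) \<le> A * h_fun M (\<gamma> * \<bar>t\<bar>))"
    using exists_sum by blast
  \<comment> \<open>The coefficients of L^u are restrictions of coefficients of the lift to the jet
    of u.\<close>
  have "Ck_on 1 (linearized_coeff f u j) (U \<times> I)" for j
  proof -
    have "Ck_on 1 (\<lambda>p. lift_coeff f (Inl (Some j)) (jet_of u p)) \<Omega>"
      by (rule Ck_on_1_jet_of_compose[OF CR_coeff])
    moreover have "Ck_on 1 (\<lambda>p. lift_coeff f (Inl (Some j)) (jet_of u p)) \<Omega> \<longleftrightarrow> Ck_on 1 (linearized_coeff f u j) \<Omega>"
      by (rule Ck_on_cong[OF open_\<Omega>]) (simp add: linearized_coeff_eq[OF CR_f])
    ultimately have "Ck_on 1 (linearized_coeff f u j) \<Omega>" by blast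
    then show ?thesis using sub by (rule Ck_on_subset)
  qed
  moreover have "v (x, 0) = u\<^sub>0 x" if "x \<in> U" for x
    using v(2)[OF that] u\<^sub>0(2)[OF that] by (simp add: g_def)
  ultimately have "approximate_solution M (linearized_coeff f u) U I u\<^sub>0 v"
    unfolding approximate_solution_def using u\<^sub>0(1) v(1) bound by (meson subsetD)
  then show ?thesis by blast
qed

lemma Ck_on_1_initial_datum:
  fixes u :: "(real^'n) \<times> real \<Rightarrow> complex"
  assumes "Ck_on 1 u \<Omega>" "U \<times> {0} \<subseteq> \<Omega>"
  shows "Ck_on 1 (\<lambda>x. u (x, 0)) U"
  unfolding Ck_on_1_iff
proof (intro conjI ballI)
  fix x assume "x \<in> U"
  then have "u differentiable (at (x, 0))" using assms by (auto simp: Ck_on_1_iff)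
  then obtain D where "(u has_derivative D) (at (x, 0))" by (auto simp: differentiable_def)
  moreover have "((\<lambda>x. (x, 0 :: real)) has_derivative (\<lambda>v. (v, 0))) (at x)"
    by (auto intro!: derivative_eq_intros)
  ultimately show "(\<lambda>x. u (x, 0)) differentiable (at x)"
    using has_derivative_compose differentiableI by blast
next
  fix b :: "real^'n" assume b: "b \<in> Basis"
  have "pderivative b (\<lambda>x. u (x, 0)) = (\<lambda>x. pderivative (b, 0) u (x, 0))"
    by (simp add: pderivative_def fun_eq_iff)
  moreover have "continuous_on \<Omega> (pderivative (b, 0) u)"
    using assms(1) b by (auto simp: Ck_on_1_iff Basis_prod_def)
  then have "continuous_on U (\<lambda>x. pderivative (b, 0) u (x, 0))"
    by (rule continuous_on_compose2) (use assms(2) in \<open>auto intro!: continuous_intros\<close>)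
  ultimately show "continuous_on U (pderivative b (\<lambda>x. u (x, 0)))" by simp
qed

theorem theorem4p3:
  fixes M :: "nat \<Rightarrow> real"
    and \<Omega>' :: "(real^'n) set" and I :: "real set"
    and \<Omega>'' :: "(complex \<times> (complex^'n)) set"
    and f :: "((real^'n) \<times> real) \<times> (complex \<times> (complex^'n)) \<Rightarrow> complex"
    and u :: "(real^'n) \<times> real \<Rightarrow> complex"
    and U :: "(real^'n) set"
  assumes "regular_sequence M"
    and "open \<Omega>'" and "0 \<in> \<Omega>'"
    and "open I" and "is_interval I" and "0 \<in> I"
    and "open \<Omega>''"
    and "CM_holomorphic_on M f (\<Omega>' \<times> I) \<Omega>''"
    and "Ck_on 2 u (\<Omega>' \<times> I)"
    and "\<forall>p\<in>\<Omega>' \<times> I. (u p, grad_x u p) \<in> \<Omega>''"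
    and "\<forall>p\<in>\<Omega>' \<times> I. dt u p = f (p, (u p, grad_x u p))"
    and "open U" and "compact (closure U)" and "closure U \<subseteq> \<Omega>'"
  shows "\<exists>(Z :: 'n \<Rightarrow> (real^'n) \<times> real \<Rightarrow> complex) (\<Psi> :: (real^'n) \<times> real \<Rightarrow> complex).
    (\<forall>j. approximate_solution M (linearized_coeff f u) U I (\<lambda>x. complex_of_real (x $ j)) (Z j)) \<and>
    approximate_solution M (linearized_coeff f u) U I (\<lambda>x. u (x, 0)) \<Psi>"
proof -
  have open_\<Omega>: "open (\<Omega>' \<times> I)" using assms(2,4) by (rule open_Times)
  interpret jet_solution "\<Omega>' \<times> I" "(\<Omega>' \<times> I) \<times> \<Omega>''" u
  proof
    show "jet_of u p \<in> (\<Omega>' \<times> I) \<times> \<Omega>''" if "p \<in> \<Omega>' \<times> I" for p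
      unfolding jet_of_def using bspec[OF assms(10) that] that by simp
  qed (use open_\<Omega> assms(7,9) open_Times in auto)
  have "CR_on f ((\<Omega>' \<times> I) \<times> \<Omega>'')"
    using assms(8) by (intro multi_holomorphic_imp_CR_on) (auto simp: CM_holomorphic_on_def)
  then have f: "CM_class M ((\<Omega>' \<times> I) \<times> \<Omega>'') K f" if "compact K" "K \<subseteq> (\<Omega>' \<times> I) \<times> \<Omega>''" for K
    unfolding CM_class_def using CM_holomorphic_bounded[OF assms(1) open_\<Omega> assms(7,8) that] by blast
  have eq: "dt u p = f (jet_of u p)" if "p \<in> \<Omega>' \<times> I" for p
    unfolding jet_of_def by (rule bspec[OF assms(11) that])
  note exists = approximate_solution_exists[OF assms(1) refl assms(4,6,12-14) f eq]
  have U: "U \<subseteq> \<Omega>'" using assms(14) closure_subset by blast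
  have "\<exists>v. approximate_solution M (linearized_coeff f u) U I (\<lambda>x. complex_of_real (x $ j)) v" for j
  proof (rule exists[where G = "\<lambda>v. complex_of_real (xcoord (Some j) v)"])
    show "Ck_on 1 (\<lambda>x :: real^'n. complex_of_real (x $ j)) U"
      by (intro Ck_on_bounded_linear bounded_linear_compose[OF bounded_linear_of_real bounded_linear_vec_nth])
    show "complex_of_real (xcoord (Some j) (jet_of u (x, 0))) = complex_of_real (x $ j)" for x
      unfolding xcoord_jet_of by (simp add: xcoord_def)
  qed (auto intro: CM_class_xcoord[OF assms(1)])
  then obtain Z where "\<And>j. approximate_solution M (linearized_coeff f u) U I (\<lambda>x. complex_of_real (x $ j)) (Z j)"
    by metis
  moreover have "\<exists>v. approximate_solution M (linearized_coeff f u) U I (\<lambda>x. u (x, 0)) v"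
  proof (rule exists[where G = "zcoord None"])
    have "Ck_on 1 u (\<Omega>' \<times> I)"
      using Ck_on_1_jet_comp[of None] by (simp only: jet_comp_def option.case)
    then show "Ck_on 1 (\<lambda>x. u (x, 0)) U"
      by (rule Ck_on_1_initial_datum) (use U assms(6) in auto)
    show "zcoord None (jet_of u (x, 0)) = u (x, 0)" for x
      unfolding zcoord_jet_of by (simp add: jet_comp_def)
  qed (auto intro: CM_class_zcoord[OF assms(1)])
  ultimately show ?thesis by blast
qed

end
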